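(* Suppose that $f : \mathbb{X}_{d,0} \to \mathbb{R}$ is a continuous intrinsic function with the following property: if $\Omega \in \mathbb{X}_d$ and $f(\Omega,x) = f(\mathcal{B},0)$ for all $x \in \Omega$, then $\Omega$ is biholomorphic to $\mathcal{B}$. Then there exists some $\epsilon = \epsilon(d,f) > 0$ such that: if $\Omega \subset \mathbb{C}^d$ is a bounded convex domain with $C^\infty$ boundary and $$|f(\Omega,z) - f(\mathcal{B},0)| \leq \epsilon$$ for all $z$ outside some compact subset of $\Omega$, then $\Omega$ is strongly pseudoconvex and thus $$\lim_{z \to \partial\Omega} f(\Omega,z) = f(\mathcal{B},0).$$
   Context: $\mathcal{B} \subset \mathbb{C}^d$ is the unit ball. $\mathbb{X}_d$ is the set of convex domains in $\mathbb{C}^d$ which do not contain a complex affine line, and $\mathbb{X}_{d,0}$ is the set of pairs $(\Omega,x)$ with $\Omega \in \mathbb{X}_d$, $x \in \Omega$. A function $f : \mathbb{X}_{d,0} \to \mathbb{R}$ is intrinsic if $f(\Omega_1,p_1) = f(\Omega_2,p_2)$ whenever there is a biholomorphism $\varphi : \Omega_1 \to \Omega_2$ with $\varphi(p_1) = p_2$. Topology: for compact sets, $d_H$ is the Hausdorff distance (for the Euclidean distance); for $R>0$ and closed $A, B$, let $d_H^{(R)}(A,B) = d_H(A \cap B_R(0), B \cap B_R(0))$, with $B_R(0)$ the closed Euclidean ball. Open convex sets $\Omega_n$ converge to an open convex set $\Omega$ in the local Hausdorff topology if there is $R_0 \geq 0$ with $\lim_{n\to\infty} d_H^{(R)}(\overline{\Omega}_n,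 \overline{\Omega}) = 0$ for all $R \geq R_0$. $\mathbb{X}_d$ carries the local Hausdorff topology; $(\Omega_n,x_n) \to (\Omega,x)$ in $\mathbb{X}_{d,0}$ means $\Omega_n \to \Omega$ in the local Hausdorff topology and $x_n \to x$. *)

theory Defs
  imports "HOL-Analysis.Analysis" "HOL-Library.Going_To_Filter"
begin

section \<open>Holomorphic maps and biholomorphisms in several variables\<close>

text \<open>Complex \<open>d\<close>-space is \<^typ>\<open>complex ^ 'd\<close> with its Euclidean norm; \<open>c *s v\<close> is complex scalar
  multiplication. A map is holomorphic if its real derivative exists and is complex linear.
  All sets to which the following definition is applied are open.\<close>

definition holomorphic_map :: "(complex ^ 'd \<Rightarrow> complex ^ 'd) \<Rightarrow> (complex ^ 'd) set \<Rightarrow> bool"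
  where "holomorphic_map g S \<longleftrightarrow>
    (\<forall>z\<in>S. \<exists>L. (g has_derivative L) (at z) \<and> (\<forall>c v. L (c *s v) = c *s L v))"

definition biholomorphism ::
  "(complex ^ 'd \<Rightarrow> complex ^ 'd) \<Rightarrow> (complex ^ 'd) set \<Rightarrow> (complex ^ 'd) set \<Rightarrow> bool"
  where "biholomorphism \<phi> S T \<longleftrightarrow>
    bij_betw \<phi> S T \<and> holomorphic_map \<phi> S \<and> holomorphic_map (the_inv_into S \<phi>) T"

definition biholomorphic :: "(complex ^ 'd) set \<Rightarrow> (complex ^ 'd) set \<Rightarrow> bool"
  where "biholomorphic S T \<longleftrightarrow> (\<exists>\<phi>. biholomorphism \<phi> S T)"


section \<open>Convex domains and the local Hausdorff topology\<close>

definition convex_domain :: "(complex ^ 'd) set \<Rightarrow> bool"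
  where "convex_domain \<Omega> \<longleftrightarrow> open \<Omega> \<and> convex \<Omega> \<and> \<Omega> \<noteq> {}"

definition complex_affine_line :: "(complex ^ 'd) set \<Rightarrow> bool"
  where "complex_affine_line l \<longleftrightarrow> (\<exists>a v. v \<noteq> 0 \<and> l = range (\<lambda>c. a + c *s v))"

definition XX :: "(complex ^ 'd) set set"
  where "XX = {\<Omega>. convex_domain \<Omega> \<and> \<not> (\<exists>l. complex_affine_line l \<and> l \<subseteq> \<Omega>)}"

definition XX0 :: "((complex ^ 'd) set \<times> (complex ^ 'd)) set"
  where "XX0 = {(\<Omega>, x). \<Omega> \<in> XX \<and> x \<in> \<Omega>}"

text \<open>The values are in \<^typ>\<open>ennreal\<close> because \<open>A \<inter> cball 0 R\<close> can be empty: the empty set has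
  distance \<open>0\<close> from itself and \<open>\<infinity>\<close> from any nonempty set.\<close>

definition hausdorff_distance :: "'a::metric_space set \<Rightarrow> 'a set \<Rightarrow> ennreal"
  where "hausdorff_distance A B =
    max (SUP a\<in>A. INF b\<in>B. ennreal (dist a b)) (SUP b\<in>B. INF a\<in>A. ennreal (dist a b))"

definition hausdorff_distance_R ::
  "real \<Rightarrow> 'a::real_normed_vector set \<Rightarrow> 'a set \<Rightarrow> ennreal"
  where "hausdorff_distance_R R A B = hausdorff_distance (A \<inter> cball 0 R) (B \<inter> cball 0 R)"

definition local_hausdorff_convergent ::
  "(nat \<Rightarrow> 'a::real_normed_vector set) \<Rightarrow> 'a set \<Rightarrow> bool"
  where "local_hausdorff_convergent \<Omega>s \<Omega> \<longleftrightarrow>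
    (\<exists>R\<^sub>0\<ge>0. \<forall>R\<ge>R\<^sub>0. (\<lambda>n. hausdorff_distance_R R (closure (\<Omega>s n)) (closure \<Omega>)) \<longlonglongrightarrow> 0)"

text \<open>The topology on \<^const>\<open>XX0\<close> is given by its convergent sequences, so continuity is
  sequential continuity. Values of \<open>f\<close> outside \<^const>\<open>XX0\<close> are irrelevant, here and below.\<close>

definition continuous_on_XX0 :: "((complex ^ 'd) set \<times> (complex ^ 'd) \<Rightarrow> real) \<Rightarrow> bool"
  where "continuous_on_XX0 f \<longleftrightarrow>
    (\<forall>\<Omega>s xs \<Omega> x. (\<forall>n. (\<Omega>s n, xs n) \<in> XX0) \<and> (\<Omega>, x) \<in> XX0 \<and>
        local_hausdorff_convergent \<Omega>s \<Omega> \<and> xs \<longlonglongrightarrow> x \<longrightarrow>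
      (\<lambda>n. f (\<Omega>s n, xs n)) \<longlonglongrightarrow> f (\<Omega>, x))"

definition intrinsic :: "((complex ^ 'd) set \<times> (complex ^ 'd) \<Rightarrow> real) \<Rightarrow> bool"
  where "intrinsic f \<longleftrightarrow>
    (\<forall>\<Omega>\<^sub>1 p\<^sub>1 \<Omega>\<^sub>2 p\<^sub>2. (\<Omega>\<^sub>1, p\<^sub>1) \<in> XX0 \<and> (\<Omega>\<^sub>2, p\<^sub>2) \<in> XX0 \<and>
        (\<exists>\<phi>. biholomorphism \<phi> \<Omega>\<^sub>1 \<Omega>\<^sub>2 \<and> \<phi> p\<^sub>1 = p\<^sub>2) \<longrightarrow>
      f (\<Omega>\<^sub>1, p\<^sub>1) = f (\<Omega>\<^sub>2, p\<^sub>2))"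


section \<open>Boundary regularity and strong pseudoconvexity\<close>

text \<open>\<open>k\<close> times continuously differentiable, for open \<open>U\<close>: by recursion on \<open>k\<close>, all directional
  derivatives of \<open>r\<close> are \<open>k - 1\<close> times continuously differentiable.\<close>

primrec Ck_on :: "nat \<Rightarrow> 'a::euclidean_space set \<Rightarrow> ('a \<Rightarrow> real) \<Rightarrow> bool"
  where
    "Ck_on 0 U r \<longleftrightarrow> continuous_on U r"
  | "Ck_on (Suc k) U r \<longleftrightarrow> (\<forall>x\<in>U. r differentiable (at x)) \<and>
      (\<forall>v. Ck_on k U (\<lambda>x. frechet_derivative r (at x) v))"

definition local_defining_function ::
  "'a::euclidean_space set \<Rightarrow> 'a \<Rightarrow> 'a set \<Rightarrow> ('a \<Rightarrow> real) \<Rightarrow> bool"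
  where "local_defining_function \<Omega> p U r \<longleftrightarrow> open U \<and> p \<in> U \<and>
    \<Omega> \<inter> U = {x \<in> U. r x < 0} \<and>
    (\<forall>x\<in>U. r differentiable (at x) \<and> frechet_derivative r (at x) \<noteq> (\<lambda>v. 0))"

definition smooth_boundary :: "'a::euclidean_space set \<Rightarrow> bool"
  where "smooth_boundary \<Omega> \<longleftrightarrow>
    (\<forall>p\<in>frontier \<Omega>. \<exists>U r. local_defining_function \<Omega> p U r \<and> (\<forall>k. Ck_on k U r))"

text \<open>The Wirtinger derivatives \<open>\<partial>/\<partial>z\<^sub>j\<close> and \<open>\<partial>/\<partial>\<bar>z\<^sub>j\<close>; the directions \<open>axis j 1\<close> and \<open>axis j \<i>\<close>
  are those of the real coordinates \<open>x\<^sub>j\<close> and \<open>y\<^sub>j\<close>.\<close>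

definition dz :: "'d \<Rightarrow> (complex ^ 'd \<Rightarrow> complex) \<Rightarrow> complex ^ 'd \<Rightarrow> complex"
  where "dz j g p =
    (frechet_derivative g (at p) (axis j 1) - \<i> * frechet_derivative g (at p) (axis j \<i>)) / 2"

definition dzbar :: "'d \<Rightarrow> (complex ^ 'd \<Rightarrow> complex) \<Rightarrow> complex ^ 'd \<Rightarrow> complex"
  where "dzbar j g p =
    (frechet_derivative g (at p) (axis j 1) + \<i> * frechet_derivative g (at p) (axis j \<i>)) / 2"

definition complex_tangent_space :: "(complex ^ 'd \<Rightarrow> real) \<Rightarrow> complex ^ 'd \<Rightarrow> (complex ^ 'd) set"
  where "complex_tangent_space r p =
    {v. (\<Sum>j\<in>UNIV. dz j (\<lambda>z. complex_of_real (r z)) p * v $ j) = 0}"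

text \<open>For \<open>r\<close> of class \<open>C\<^sup>2\<close> the sum is real; \<^const>\<open>Re\<close> only adjusts the type.\<close>

definition levi_form :: "(complex ^ 'd \<Rightarrow> real) \<Rightarrow> complex ^ 'd \<Rightarrow> complex ^ 'd \<Rightarrow> real"
  where "levi_form r p v =
    Re (\<Sum>j\<in>UNIV. \<Sum>k\<in>UNIV. dz j (dzbar k (\<lambda>z. complex_of_real (r z))) p * v $ j * cnj (v $ k))"

text \<open>Positive definiteness of the Levi form on the complex tangent space does not depend on the
  choice of the defining function.\<close>

definition strongly_pseudoconvex :: "(complex ^ 'd) set \<Rightarrow> bool"
  where "strongly_pseudoconvex \<Omega> \<longleftrightarrow>
    (\<forall>p\<in>frontier \<Omega>. \<exists>U r. local_defining_function \<Omega> p U r \<and> Ck_on 2 U r \<and>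
      (\<forall>v\<in>complex_tangent_space r p. v \<noteq> 0 \<longrightarrow> levi_form r p v > 0))"

text \<open>The filter of \<open>z \<rightarrow> \<partial>\<Omega>\<close>, \<open>z \<in> \<Omega>\<close>, for bounded \<open>\<Omega>\<close>.\<close>

definition to_boundary :: "'a::euclidean_space set \<Rightarrow> 'a filter"
  where "to_boundary \<Omega> = (\<lambda>z. infdist z (frontier \<Omega>)) going_to (nhds 0) within \<Omega>"

end

theory Submission
  imports Defs "HOL-Complex_Analysis.Riemann_Mapping" "HOL-Complex_Analysis.Great_Picard" "HOL-Real_Asymp.Real_Asymp"
begin

text \<open>The gap comes from a gap between two exponents. Let \<open>p\<close> be a boundary point of a smoothly
  bounded convex domain \<open>\<Omega>\<close>, let \<open>\<nu>\<close> be transversal to the boundary at \<open>p\<close> and pointing outwards, and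
  let \<open>R \<tau>\<close> be the radius of the largest complex disc in \<open>\<Omega>\<close> with centre \<open>p - \<tau> \<nu>\<close> and a given complex tangential
  direction \<open>v\<close>. On the ball \<open>R \<tau>\<close> is comparable to \<open>\<tau> powr (1/2)\<close>. If \<open>\<Omega>\<close> is not strongly pseudoconvex at
  \<open>p\<close>, then the Levi form vanishes in some direction \<open>v\<close>; by convexity the real Hessian then vanishes on the
  complex line of \<open>v\<close>, the boundary has third order contact with it, and \<open>R \<tau>\<close> is at least a
  multiple of \<open>\<tau> powr (1/3)\<close> (\<open>flat_boundary_point_exists\<close>).

  Choose an exponent between \<open>1/3\<close> and \<open>1/2\<close>, say \<open>5/12\<close>. Then \<open>R \<tau> / \<tau> powr (5/12)\<close> is unbounded as
  \<open>\<tau>\<close> tends to \<open>0\<close>, so there are arbitrarily small \<open>\<tau>\<close> at which it almost attains its supremum over all larger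
  depths: seen from such a \<open>\<tau>\<close>, the radius grows at most like the power \<open>5/12\<close> of the depth
  (\<open>running_maximum\<close>). Affine maps normalize \<open>\<Omega>\<close> around \<open>p - \<tau> \<nu>\<close> to a domain of
  bounded geometry (\<open>affine_normalization\<close>, \<open>flat_picture_exists\<close>). Suppose that there were such domains for
  gaps tending to \<open>0\<close>. Their normalizations subconverge, by the theorem of Arzela and Ascoli for
  Minkowski functionals (\<open>minkowski_selection\<close>). Fixed compact subsets of the limit \<open>D\<close> come from
  points near the boundary of the original domains, so \<open>f\<close> has on \<open>D\<close> the constant value
  \<open>f (ball 0 1, 0)\<close> and \<open>D\<close> is biholomorphic to the ball. Moreover \<open>D\<close> meets the complex line of the normal in a half-plane, which is a holomorphic
  retract of \<open>D\<close>, and the tangential radius of \<open>D\<close> at depth \<open>T\<close> is at most \<open>3 * T powr (5/12)\<close> for all \<open>T \<ge> 1\<close>.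
  On a convex domain biholomorphic to the ball that radius is at least a multiple of \<open>sqrt T\<close>
  (\<open>halfplane_slice_radius\<close>), a contradiction (\<open>flat_pictures_impossible\<close>).

  The limit of \<open>f\<close> at the boundary of a strongly pseudoconvex domain is again a rescaling argument
  (\<open>strongly_pseudoconvex_point_limit\<close>): anisotropic dilations centred at points that tend to the boundary turn the
  domain into one bounded by a quadric, and the latter is mapped to the ball by an explicit
  biholomorphism (\<open>quadratic_model.biholomorphic_ball\<close>).\<close>


section \<open>Complex linear algebra on complex Euclidean space\<close>

definition cinner :: "complex ^ 'd \<Rightarrow> complex ^ 'd \<Rightarrow> complex"
  where "cinner x y = (\<Sum>i\<in>UNIV. x $ i * cnj (y $ i))"

definition complex_linear_map :: "(complex ^ 'd \<Rightarrow> complex ^ 'd) \<Rightarrow> bool"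
  where "complex_linear_map L \<longleftrightarrow> linear L \<and> (\<forall>c v. L (c *s v) = c *s L v)"

definition complex_functional :: "(complex ^ 'd \<Rightarrow> complex) \<Rightarrow> bool"
  where "complex_functional k \<longleftrightarrow> linear k \<and> (\<forall>c v. k (c *s v) = c * k v)"

lemma scaleR_eq_smult: "r *\<^sub>R (v :: complex ^ 'd) = complex_of_real r *s v"
  by (simp add: vec_eq_iff scaleR_conv_of_real[where 'a = complex])

lemma norm_smult: "norm (c *s (v :: complex ^ 'd)) = cmod c * norm v"
  by (simp add: norm_vec_def L2_set_right_distrib norm_mult)

lemma linear_smult_left: "linear (\<lambda>c. c *s (v :: complex ^ 'd))"
  by (rule linearI) (simp_all add: vec_eq_iff algebra_simps)

lemma bounded_linear_smult_left: "bounded_linear (\<lambda>c. c *s (v :: complex ^ 'd))"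
  by (simp add: linear_smult_left linear_linear)

lemma tendsto_smult [tendsto_intros]:
  assumes "(c \<longlongrightarrow> c0) F" "(v \<longlongrightarrow> v0) F"
  shows "((\<lambda>n. c n *s (v n :: complex ^ 'd)) \<longlongrightarrow> c0 *s v0) F"
  using assms by (intro vec_tendstoI) (auto intro!: tendsto_intros)

lemma continuous_on_smult [continuous_intros]:
  assumes "continuous_on S c" "continuous_on S v"
  shows "continuous_on S (\<lambda>n. c n *s (v n :: complex ^ 'd))"
  using assms unfolding continuous_on_def by (auto intro: tendsto_smult)

lemma complex_functional_compose:
  "complex_functional k \<Longrightarrow> complex_linear_map B \<Longrightarrow> complex_functional (\<lambda>x. k (B x))"
  unfolding complex_linear_map_def complex_functional_def
  using linear_compose[of B k] by (auto simp: o_def)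

lemma
  assumes "complex_functional k"
  shows complex_functional_add: "k (x + y) = k x + k y"
    and complex_functional_diff: "k (x - y) = k x - k y"
    and complex_functional_minus: "k (- x) = - k x"
    and complex_functional_smult: "k (c *s x) = c * k x"
    and complex_functional_zero: "k 0 = 0"
    and complex_functional_scaleR: "k (r *\<^sub>R x) = r *\<^sub>R k x"
    and complex_functional_bounded_linear: "bounded_linear k"
  using assms unfolding complex_functional_def
  by (auto simp: linear_add linear_diff linear_neg linear_0 linear_scale linear_linear)

lemma
  assumes "complex_linear_map L"
  shows complex_linear_map_add: "L (x + y) = L x + L y"
    and complex_linear_map_diff: "L (x - y) = L x - L y"
    and complex_linear_map_minus: "L (- x) = - L x"
    and complex_linear_map_smult: "L (c *s x) = c *s L x"
    and complex_linear_map_zero: "L 0 = 0"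
    and complex_linear_map_scaleR: "L (r *\<^sub>R x) = r *\<^sub>R L x"
    and complex_linear_map_linear: "linear L"
    and complex_linear_map_bounded_linear: "bounded_linear L"
  using assms unfolding complex_linear_map_def
  by (auto simp: linear_add linear_diff linear_neg linear_0 linear_scale linear_linear)

lemma cinner_add_left: "cinner (x + y) z = cinner x z + cinner y z"
  and cinner_diff_left: "cinner (x - y) z = cinner x z - cinner y z"
  and cinner_smult_left: "cinner (c *s x) z = c * cinner x z"
  and cinner_add_right: "cinner z (x + y) = cinner z x + cinner z y"
  and cinner_diff_right: "cinner z (x - y) = cinner z x - cinner z y"
  and cinner_smult_right: "cinner z (c *s x) = cnj c * cinner z x"
  and cinner_zero_left [simp]: "cinner 0 z = 0"
  and cinner_zero_right [simp]: "cinner z 0 = 0"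
  and cinner_minus_right: "cinner z (- x) = - cinner z x"
  by (simp_all add: cinner_def algebra_simps sum.distrib sum_subtractf sum_distrib_left sum_negf)

lemmas cinner_simps = cinner_add_left cinner_diff_left cinner_smult_left
  cinner_add_right cinner_diff_right cinner_smult_right cinner_minus_right

lemma cnj_cinner: "cnj (cinner x y) = cinner y x"
  by (simp add: cinner_def mult.commute)

lemma cinner_self: "cinner x x = complex_of_real ((norm x)\<^sup>2)"
proof -
  have "(norm x)\<^sup>2 = (\<Sum>i\<in>UNIV. (cmod (x $ i))\<^sup>2)"
    by (simp add: norm_vec_def L2_set_def sum_nonneg)
  then show ?thesis by (simp add: cinner_def complex_norm_square flip: of_real_power)
qed

lemma inner_eq_Re_cinner: "x \<bullet> y = Re (cinner x y)"
  by (simp add: cinner_def inner_vec_def inner_complex_def)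

lemma norm_cinner_le: "cmod (cinner x y) \<le> norm x * norm y"
proof (cases "cinner x y = 0")
  case False
  define c where "c = cnj (cinner x y) / cmod (cinner x y)"
  have c: "cmod c = 1" using False by (simp add: c_def norm_divide)
  have "cinner (c *s x) y = cmod (cinner x y)"
    using False unfolding cinner_smult_left c_def
    by (simp add: divide_simps complex_norm_square[symmetric] mult.commute power2_eq_square)
  then have "cmod (cinner x y) = (c *s x) \<bullet> y" by (simp add: inner_eq_Re_cinner)
  also have "\<dots> \<le> norm (c *s x) * norm y" by (rule norm_cauchy_schwarz)
  finally show ?thesis by (simp add: norm_smult c)
qed simp

lemma complex_functional_cinner: "complex_functional (\<lambda>x. cinner x y)"
  unfolding complex_functional_def
  by (auto intro!: linearI simp: cinner_simps scaleR_eq_smult scaleR_conv_of_real[where 'a = complex])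

lemma norm_add_orthogonal:
  assumes "cinner x y = 0"
  shows "(norm (x + y))\<^sup>2 = (norm x)\<^sup>2 + (norm y)\<^sup>2"
proof -
  have "cinner y x = 0" using assms cnj_cinner[of x y] by simp
  then have "cinner (x + y) (x + y) = cinner x x + cinner y y"
    using assms by (simp add: cinner_simps)
  then show ?thesis unfolding cinner_self of_real_add[symmetric] of_real_eq_iff .
qed


section \<open>Holomorphic maps and biholomorphisms\<close>

lemma holomorphic_mapE:
  assumes "holomorphic_map g S" "z \<in> S"
  obtains L where "(g has_derivative L) (at z)" "complex_linear_map L"
  using assms unfolding holomorphic_map_def complex_linear_map_def
  by (metis has_derivative_linear)

lemma holomorphic_map_compose:
  assumes "holomorphic_map g S" "holomorphic_map h T" "g ` S \<subseteq> T"
  shows "holomorphic_map (\<lambda>x. h (g x)) S"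
  unfolding holomorphic_map_def
proof
  fix z assume z: "z \<in> S"
  obtain L where L: "(g has_derivative L) (at z)" "complex_linear_map L"
    using holomorphic_mapE[OF assms(1) z] .
  obtain M where M: "(h has_derivative M) (at (g z))" "complex_linear_map M"
    using holomorphic_mapE[OF assms(2), of "g z"] z assms(3) by blast
  have "((\<lambda>x. h (g x)) has_derivative (\<lambda>x. M (L x))) (at z)"
    using diff_chain_at[OF L(1) M(1)] by (simp add: o_def)
  with L(2) M(2) show "\<exists>L. ((\<lambda>x. h (g x)) has_derivative L) (at z) \<and> (\<forall>c v. L (c *s v) = c *s L v)"
    by (auto simp: complex_linear_map_smult)
qed

lemma holomorphic_map_continuous_on: "holomorphic_map g S \<Longrightarrow> continuous_on S g"
  unfolding holomorphic_map_def
  by (meson continuous_at_imp_continuous_on has_derivative_continuous)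

lemma holomorphic_map_cong_open:
  assumes "holomorphic_map g S" "open S" "\<And>x. x \<in> S \<Longrightarrow> h x = g x"
  shows "holomorphic_map h S"
  unfolding holomorphic_map_def
proof
  fix z assume z: "z \<in> S"
  then obtain L where "(g has_derivative L) (at z)" "\<forall>c v. L (c *s v) = c *s L v"
    using assms(1) unfolding holomorphic_map_def by blast
  moreover from this(1) have "(h has_derivative L) (at z)"
    by (rule has_derivative_transform_within_open[OF _ assms(2) z]) (simp add: assms(3))
  ultimately show "\<exists>L. (h has_derivative L) (at z) \<and> (\<forall>c v. L (c *s v) = c *s L v)" by blast
qed

lemma holomorphic_map_complex_linear_map:
  assumes "complex_linear_map L" shows "holomorphic_map (\<lambda>x. L x + b) S"
  unfolding holomorphic_map_def
proof
  fix z
  have "((\<lambda>x. L x + b) has_derivative L) (at z)"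
    using bounded_linear_imp_has_derivative[OF complex_linear_map_bounded_linear[OF assms]]
    by (auto intro!: derivative_eq_intros)
  then show "\<exists>L'. ((\<lambda>x. L x + b) has_derivative L') (at z) \<and> (\<forall>c v. L' (c *s v) = c *s L' v)"
    using complex_linear_map_smult[OF assms] by blast
qed

lemma biholomorphismI:
  assumes "open T" "holomorphic_map g S" "holomorphic_map h T"
    and "\<And>x. x \<in> S \<Longrightarrow> g x \<in> T \<and> h (g x) = x" "\<And>y. y \<in> T \<Longrightarrow> h y \<in> S \<and> g (h y) = y"
  shows "biholomorphism g S T"
proof -
  have bij: "bij_betw g S T" using assms(4,5) by (intro bij_betw_byWitness[of _ h]) auto
  have "the_inv_into S g y = h y" if "y \<in> T" for y
    using assms(5)[OF that] bij by (metis bij_betw_def the_inv_into_f_f)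
  then show ?thesis unfolding biholomorphism_def
    using bij assms holomorphic_map_cong_open by blast
qed

lemma biholomorphismE:
  assumes "biholomorphism g S T"
  obtains h where "holomorphic_map g S" "holomorphic_map h T"
    and "\<And>x. x \<in> S \<Longrightarrow> g x \<in> T \<and> h (g x) = x" "\<And>y. y \<in> T \<Longrightarrow> h y \<in> S \<and> g (h y) = y"
proof (rule that[of "the_inv_into S g"])
  have bij: "bij_betw g S T" using assms unfolding biholomorphism_def by simp
  show "\<And>x. x \<in> S \<Longrightarrow> g x \<in> T \<and> the_inv_into S g (g x) = x"
    using bij by (metis bij_betw_def imageI the_inv_into_f_f)
  show "\<And>y. y \<in> T \<Longrightarrow> the_inv_into S g y \<in> S \<and> g (the_inv_into S g y) = y"
    using bij by (metis bij_betw_def f_the_inv_into_f order_refl the_inv_into_into)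
qed (use assms in \<open>auto simp: biholomorphism_def\<close>)

lemma biholomorphism_compose:
  assumes "biholomorphism g S T" "biholomorphism g' T W" "open W"
  shows "biholomorphism (\<lambda>x. g' (g x)) S W"
proof -
  obtain h where h: "holomorphic_map g S" "holomorphic_map h T"
    "\<And>x. x \<in> S \<Longrightarrow> g x \<in> T \<and> h (g x) = x" "\<And>y. y \<in> T \<Longrightarrow> h y \<in> S \<and> g (h y) = y"
    using biholomorphismE[OF assms(1)] by metis
  obtain h' where h': "holomorphic_map g' T" "holomorphic_map h' W"
    "\<And>x. x \<in> T \<Longrightarrow> g' x \<in> W \<and> h' (g' x) = x" "\<And>y. y \<in> W \<Longrightarrow> h' y \<in> T \<and> g' (h' y) = y"
    using biholomorphismE[OF assms(2)] by metis
  show ?thesis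
  proof (rule biholomorphismI[OF assms(3), of _ _ "\<lambda>y. h (h' y)"])
    show "holomorphic_map (\<lambda>x. g' (g x)) S"
      using h(3) by (intro holomorphic_map_compose[OF h(1) h'(1)]) auto
    show "holomorphic_map (\<lambda>y. h (h' y)) W"
      using h'(4) by (intro holomorphic_map_compose[OF h'(2) h(2)]) auto
  qed (use h h' in auto)
qed

lemma biholomorphism_affine:
  assumes "complex_linear_map A" "complex_linear_map B"
    and "\<And>x. A (B x) = x" "\<And>x. B (A x) = x" and "open S"
  shows "biholomorphism (\<lambda>x. A (x - a)) S {y. a + B y \<in> S}"
proof (rule biholomorphismI[of _ _ _ "\<lambda>y. B y + a"])
  have "continuous_on UNIV (\<lambda>y. a + B y)"
    using complex_linear_map_bounded_linear[OF assms(2)]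
    by (intro continuous_intros linear_continuous_on)
  then show "open {y. a + B y \<in> S}"
    using open_vimage[OF assms(5), of "\<lambda>y. a + B y"] by (simp add: vimage_def)
  show "holomorphic_map (\<lambda>x. A (x - a)) S"
    using holomorphic_map_complex_linear_map[OF assms(1), of "- A a"]
    by (simp add: complex_linear_map_diff[OF assms(1)])
  show "holomorphic_map (\<lambda>y. B y + a) {y. a + B y \<in> S}"
    by (rule holomorphic_map_complex_linear_map[OF assms(2)])
qed (use assms in \<open>auto simp: add.commute complex_linear_map_diff\<close>)

text \<open>Restricted to a complex line and followed by a linear functional, a holomorphic map becomes
  a holomorphic function of one variable. All function theory below happens on such slices.\<close>

lemma has_field_derivative_slice:
  assumes "(g has_derivative L) (at (a + c *s v))" "complex_linear_map L" "complex_functional k"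
  shows "((\<lambda>c. k (g (a + c *s v))) has_field_derivative k (L v)) (at c)"
proof -
  have 1: "((\<lambda>c. a + c *s v) has_derivative (\<lambda>h. h *s v)) (at c)"
    using bounded_linear_imp_has_derivative[OF bounded_linear_smult_left]
    by (auto intro!: derivative_eq_intros)
  have 2: "(k has_derivative k) (at (g (a + c *s v)))"
    by (intro bounded_linear_imp_has_derivative complex_functional_bounded_linear assms)
  have "((\<lambda>c. k (g (a + c *s v))) has_derivative (\<lambda>h. k (L (h *s v)))) (at c)"
    using has_derivative_compose[OF has_derivative_compose[OF 1 assms(1)] 2] .
  moreover have "(\<lambda>h. k (L (h *s v))) = (*) (k (L v))"
    by (simp add: fun_eq_iff complex_linear_map_smult[OF assms(2)]
        complex_functional_smult[OF assms(3)] mult.commute)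
  ultimately show ?thesis unfolding has_field_derivative_def by simp
qed

lemma holomorphic_on_slice:
  assumes "holomorphic_map g S" "complex_functional k" "\<And>c. c \<in> T \<Longrightarrow> a + c *s v \<in> S"
  shows "(\<lambda>c. k (g (a + c *s v))) holomorphic_on T"
  unfolding holomorphic_on_def
proof
  fix c assume c: "c \<in> T"
  obtain L where "(g has_derivative L) (at (a + c *s v))" "complex_linear_map L"
    using holomorphic_mapE[OF assms(1) assms(3)[OF c]] .
  from has_field_derivative_slice[OF this assms(2)]
  show "(\<lambda>c. k (g (a + c *s v))) field_differentiable at c within T"
    unfolding field_differentiable_def using has_field_derivative_at_within by blast
qed


section \<open>Schwarz lemmas and a Phragmen-Lindeloef principle in one variable\<close>

lemma Schwarz_derivative_zero:
  assumes "h holomorphic_on ball 0 R" "\<And>z. z \<in> ball 0 R \<Longrightarrow> cmod (h z) < 1" "h 0 = 0"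
    and "(h has_field_derivative h') (at 0)" "0 < R"
  shows "R * cmod h' \<le> 1"
proof -
  define g where "g = (\<lambda>z. h (of_real R * z))"
  have "(*) (complex_of_real R) ` ball 0 1 \<subseteq> ball 0 R"
    using assms(5) by (auto simp: norm_mult)
  then have "(h \<circ> (*) (complex_of_real R)) holomorphic_on ball 0 1"
    by (intro holomorphic_on_compose holomorphic_intros)
       (use assms(1) holomorphic_on_subset in blast)
  then have hol: "g holomorphic_on ball 0 1" by (simp add: g_def o_def)
  have "(h has_field_derivative h') (at (of_real R * 0))" using assms(4) by simp
  then have "(g has_field_derivative h' * of_real R) (at 0)" unfolding g_def
    by (rule DERIV_chain2) (auto intro!: derivative_eq_intros)
  then have "deriv g 0 = h' * of_real R" by (rule DERIV_imp_deriv)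
  moreover have "norm (deriv g 0) \<le> 1"
    by (rule Schwarz_Lemma(2)[OF hol, of 0]) (use assms in \<open>auto simp: g_def norm_mult\<close>)
  ultimately show ?thesis using assms(5) by (simp add: norm_mult mult.commute)
qed

text \<open>Composition with a Moebius map that sends \<open>h 0\<close> to \<open>0\<close> reduces this to the case above.\<close>

lemma Schwarz_Pick_derivative:
  assumes "h holomorphic_on ball 0 R" "\<And>z. z \<in> ball 0 R \<Longrightarrow> cmod (h z) < 1"
    and "(h has_field_derivative h') (at 0)" "0 < R"
  shows "R * cmod h' \<le> 1 - (cmod (h 0))\<^sup>2"
proof -
  define w where "w = h 0"
  have w: "cmod w < 1" using assms(2,4) by (simp add: w_def)
  define g where "g = (\<lambda>z. (h z - w) / (1 - cnj w * h z))"
  have nz: "1 - cnj w * h z \<noteq> 0" if "z \<in> ball 0 R" for z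
  proof -
    have "cmod (cnj w * h z) < 1"
      using w assms(2)[OF that] mult_strict_mono'[of "cmod w" 1 "cmod (h z)" 1] by (simp add: norm_mult)
    then show ?thesis by auto
  qed
  have hol: "g holomorphic_on ball 0 R"
    unfolding g_def by (intro holomorphic_intros assms(1)) (use nz in auto)
  have lt: "cmod (g z) < 1" if "z \<in> ball 0 R" for z
    using Moebius_function_norm_lt_1[OF w assms(2)[OF that], of 0]
    by (simp add: g_def Moebius_function_simple)
  have pos: "0 < 1 - (cmod w)\<^sup>2" using w by (simp add: abs_square_less_1)
  have cw: "1 - cnj w * w = of_real (1 - (cmod w)\<^sup>2)"
    unfolding of_real_diff complex_norm_square by (simp add: mult.commute)
  have nz0: "1 - cnj w * h 0 \<noteq> 0" using nz assms(4) by simp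
  have "(g has_field_derivative h' / (1 - cnj w * w)) (at 0)"
    unfolding g_def
    by (rule derivative_eq_intros assms(3) refl nz0)+ (use nz0 in \<open>auto simp: w_def divide_simps\<close>)
  from Schwarz_derivative_zero[OF hol lt _ this assms(4)]
  have "R * cmod (h' / (1 - cnj w * w)) \<le> 1" by (simp add: g_def w_def)
  moreover have "cmod (1 - cnj w * w) = 1 - (cmod w)\<^sup>2"
    unfolding cw norm_of_real using pos by simp
  ultimately have "R * cmod h' / (1 - (cmod w)\<^sup>2) \<le> 1"
    by (simp add: norm_divide)
  then show ?thesis using pos by (simp add: w_def)
qed

text \<open>The quotient of the distances to \<open>A = h 0\<close> and to its mirror image \<open>A'\<close> in the line \<open>Re = b\<close> is
  less than \<open>1\<close> on the half-plane, so \<open>(h - A) / (h - A')\<close> is a map into the disc.\<close>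

lemma halfplane_Schwarz_derivative:
  assumes "h holomorphic_on ball 0 R" "\<And>z. z \<in> ball 0 R \<Longrightarrow> Re (h z) < b"
    and "(h has_field_derivative h') (at 0)" "0 < R"
  shows "R * cmod h' \<le> 2 * (b - Re (h 0))"
proof -
  define A where "A = h 0"
  define A' where "A' = 2 * of_real b - cnj A"
  have A: "Re A < b" using assms(2,4) by (simp add: A_def)
  define g where "g = (\<lambda>z. (h z - A) / (h z - A'))"
  have nz: "h z - A' \<noteq> 0" if "z \<in> ball 0 R" for z
  proof -
    have "Re A' > b" using A by (simp add: A'_def)
    then show ?thesis using assms(2)[OF that] by auto
  qed
  have hol: "g holomorphic_on ball 0 R"
    unfolding g_def by (intro holomorphic_intros assms(1)) (use nz in auto)
  have lt: "cmod (g z) < 1" if z: "z \<in> ball 0 R" for z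
  proof -
    have "(cmod (h z - A'))\<^sup>2 - (cmod (h z - A))\<^sup>2 = 4 * (b - Re A) * (b - Re (h z))"
      unfolding cmod_power2 A'_def by (simp add: power2_eq_square algebra_simps)
    moreover have "\<dots> > 0" using A assms(2)[OF z] by simp
    ultimately have "cmod (h z - A) < cmod (h z - A')"
      by (intro power2_less_imp_less[of "cmod (h z - A)"]) auto
    then show ?thesis using nz[OF z] by (simp add: g_def norm_divide)
  qed
  have nz0: "h 0 - A' \<noteq> 0" using nz assms(4) by simp
  have AA: "A - A' = of_real (2 * (Re A - b))"
    by (simp add: A'_def complex_eq_iff)
  have "(g has_field_derivative h' / (A - A')) (at 0)"
    unfolding g_def
    by (rule derivative_eq_intros assms(3) refl nz0)+ (use nz0 in \<open>auto simp: A_def divide_simps\<close>)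
  from Schwarz_derivative_zero[OF hol lt _ this assms(4)]
  have "R * cmod (h' / (A - A')) \<le> 1" by (simp add: g_def A_def)
  moreover have "cmod (A - A') = 2 * (b - Re A)"
    unfolding AA norm_of_real using A by simp
  moreover have "0 < 2 * (b - Re A)" using A by simp
  ultimately show ?thesis by (simp add: norm_divide A_def pos_divide_le_eq)
qed

text \<open>Division by \<open>1 - e * (\<mu> + 1)\<close> turns the sublinear growth into decay at infinity, so that the
  maximum principle on large half-discs bounds the quotient by its values on the line \<open>Re = -1\<close>; then \<open>e\<close> tends to
  \<open>0\<close>.\<close>

lemma halfplane_Phragmen_Lindeloef:
  assumes hol: "a holomorphic_on {\<mu>. Re \<mu> < 0}"
    and le: "\<And>\<mu>. Re \<mu> \<le> -1 \<Longrightarrow> cmod (a \<mu>) \<le> M * sqrt (- Re \<mu>)"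
    and \<mu>: "Re \<mu> \<le> -1"
  shows "cmod (a \<mu>) \<le> M"
proof -
  have M: "0 \<le> M" using le[of "-1"] order_trans[OF norm_ge_zero] by simp
  have key: "cmod (a \<mu>) \<le> M * cmod (1 - of_real e * (\<mu> + 1))" if e: "0 < e" and \<mu>: "Re \<mu> < -1" for e \<mu>
  proof -
    define d where "d = (\<lambda>z. 1 - complex_of_real e * (z + 1))"
    \<comment> \<open>The radius is so large that \<open>sqrt (1 + R) \<le> e * R\<close>.\<close>
    define R where "R = max (cmod (\<mu> + 1) + 1) (max 1 (2 / e\<^sup>2))"
    have R: "cmod (\<mu> + 1) < R" "1 \<le> R" "2 / e\<^sup>2 \<le> R" by (auto simp: R_def)
    have "1 + R \<le> 2 * R" using R by simp
    also have "2 \<le> e\<^sup>2 * R" using R(3) e by (simp add: divide_simps mult.commute)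
    then have "2 * R \<le> (e * R)\<^sup>2" using R(2) by (simp add: power2_eq_square algebra_simps)
    finally have R2: "sqrt (1 + R) \<le> e * R" using e R(2) by (intro real_le_lsqrt) auto
    have Red: "Re (d z) \<ge> 1" if "Re z \<le> -1" for z
    proof -
      have "e * (Re z + 1) \<le> 0" using that e by (simp add: mult_nonneg_nonpos)
      then show ?thesis by (simp add: d_def)
    qed
    have d1: "cmod (d z) \<ge> 1" if "Re z \<le> -1" for z
      using Red[OF that] complex_Re_le_cmod[of "d z"] by linarith
    have d2: "cmod (d z) \<ge> e * cmod (z + 1)" if "Re z \<le> -1" for z
    proof -
      have "(e * cmod (z + 1))\<^sup>2 \<le> (cmod (d z))\<^sup>2"
      proof -
        have "(cmod (d z))\<^sup>2 = 1 - 2 * e * (Re z + 1) + (e * cmod (z + 1))\<^sup>2"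
          unfolding cmod_power2 power_mult_distrib d_def by (simp add: power2_eq_square algebra_simps)
        moreover have "e * (Re z + 1) \<le> 0" using that e by (simp add: mult_nonneg_nonpos)
        ultimately show ?thesis by simp
      qed
      then show ?thesis by (rule power2_le_imp_le) simp
    qed
    define S where "S = {z. Re z < -1} \<inter> ball (-1) R"
    have cl: "closure S \<subseteq> {z. Re z \<le> -1} \<inter> cball (-1) R"
      by (intro closure_minimal) (auto simp: S_def closed_halfspace_Re_le)
    have bS: "bounded S" unfolding S_def by (intro bounded_Int) simp
    have opS: "open S" unfolding S_def by (intro open_Int open_halfspace_Re_lt open_ball)
    have hb: "(\<lambda>z. a z / d z) holomorphic_on S"
    proof -
      have "a holomorphic_on S" by (rule holomorphic_on_subset[OF hol]) (auto simp: S_def)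
      moreover have "d z \<noteq> 0" if "z \<in> S" for z using d1[of z] that by (auto simp: S_def)
      moreover have "d holomorphic_on S" unfolding d_def by (intro holomorphic_intros)
      ultimately show ?thesis by (intro holomorphic_on_divide)
    qed
    have cb: "continuous_on (closure S) (\<lambda>z. a z / d z)"
    proof -
      have "continuous_on {z. Re z \<le> -1} a"
        using holomorphic_on_imp_continuous_on[OF hol] by (rule continuous_on_subset) auto
      then have "continuous_on (closure S) a" by (rule continuous_on_subset) (use cl in auto)
      moreover have "\<forall>z\<in>closure S. d z \<noteq> 0" using cl d1 by force
      ultimately show ?thesis unfolding d_def by (intro continuous_intros) auto
    qed
    have fr: "cmod (a z / d z) \<le> M" if z: "z \<in> frontier S" for z
    proof -
      have zc: "Re z \<le> -1" "cmod (z + 1) \<le> R" "z \<notin> S"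
        using z cl opS by (auto simp: frontier_def interior_open dist_norm norm_minus_commute add.commute)
      have dz: "cmod (d z) > 0" using d1[OF zc(1)] by linarith
      consider "Re z = -1" | "cmod (z + 1) = R"
        using zc by (force simp: S_def dist_norm norm_minus_commute add.commute)
      then have "cmod (a z) \<le> M * cmod (d z)"
      proof cases
        case 1
        have "cmod (a z) \<le> M * 1" using le[OF zc(1)] 1 by simp
        also have "\<dots> \<le> M * cmod (d z)" using d1[OF zc(1)] M by (intro mult_left_mono)
        finally show ?thesis .
      next
        case 2
        have "- Re z \<le> 1 + R" using abs_Re_le_cmod[of "z + 1"] 2 by simp
        then have "cmod (a z) \<le> M * sqrt (1 + R)"
          using le[OF zc(1)] M by (meson mult_left_mono order_trans real_sqrt_le_mono)
        also have "\<dots> \<le> M * cmod (d z)"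
          using R2 d2[OF zc(1)] 2 M by (intro mult_left_mono) auto
        finally show ?thesis .
      qed
      then show ?thesis using dz by (simp add: norm_divide divide_simps)
    qed
    have "\<mu> \<in> S" using \<mu> R(1) by (simp add: S_def dist_norm norm_minus_commute add.commute)
    from maximum_modulus_frontier[of "\<lambda>z. a z / d z" S M, OF _ cb _ fr this] hb opS
    have "cmod (a \<mu> / d \<mu>) \<le> M" using bS by (simp add: interior_open)
    moreover have "cmod (d \<mu>) > 0" using d1[of \<mu>] \<mu> by linarith
    ultimately show ?thesis by (simp add: norm_divide divide_simps d_def)
  qed
  show ?thesis
  proof (cases "Re \<mu> = -1")
    case True then show ?thesis using le[of \<mu>] by simp
  next
    case False
    have "((\<lambda>e. M * cmod (1 - of_real e * (\<mu> + 1))) \<longlongrightarrow> M * cmod (1 - of_real 0 * (\<mu> + 1))) (at_right 0)"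
      by (intro tendsto_intros)
    moreover have "\<forall>\<^sub>F e in at_right 0. cmod (a \<mu>) \<le> M * cmod (1 - of_real e * (\<mu> + 1))"
      using key[of _ \<mu>] \<mu> False by (auto simp: eventually_at_filter)
    ultimately show ?thesis
      using tendsto_lowerbound[of _ "M * cmod (1 - of_real 0 * (\<mu> + 1))" "at_right (0::real)"] by simp
  qed
qed


section \<open>Directional derivatives of holomorphic maps\<close>

text \<open>The Taylor remainder, with the second derivative bounded by the Cauchy estimate on discs of radius \<open>\<rho> / 4\<close>.\<close>

lemma difference_quotient_error:
  assumes hol: "f holomorphic_on ball 0 \<rho>" and M: "\<And>c. c \<in> ball 0 \<rho> \<Longrightarrow> cmod (f c) \<le> M"
    and "0 < \<rho>" and h: "h \<noteq> 0" "cmod h < \<rho> / 2"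
  shows "cmod ((f h - f 0) / h - deriv f 0) \<le> 32 * M / \<rho>\<^sup>2 * cmod h"
proof -
  define S where "S = ball (0::complex) (\<rho> / 2)"
  have sub: "S \<subseteq> ball 0 \<rho>" using assms(3) by (auto simp: S_def)
  have d: "((deriv ^^ i) f has_field_derivative (deriv ^^ Suc i) f x) (at x within S)" if "x \<in> S" for i x
  proof -
    have "(deriv ^^ i) f holomorphic_on ball 0 \<rho>"
      by (rule holomorphic_higher_deriv[OF hol open_ball])
    from holomorphic_derivI[OF this open_ball, of x] that sub show ?thesis
      by (auto intro: has_field_derivative_at_within)
  qed
  have B: "cmod ((deriv ^^ Suc 1) f x) \<le> fact 2 * M / (\<rho> / 4)^2" if x: "x \<in> S" for x
  proof -
    have "cball x (\<rho> / 4) \<subseteq> ball 0 \<rho>"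
    proof
      fix y assume "y \<in> cball x (\<rho> / 4)"
      then show "y \<in> ball 0 \<rho>"
        using x assms(3) norm_triangle_ineq[of x "y - x"]
        by (simp add: S_def dist_norm norm_minus_commute)
    qed
    then have "f holomorphic_on ball x (\<rho> / 4)" "continuous_on (cball x (\<rho> / 4)) f"
      "\<And>y. cmod (x - y) = \<rho> / 4 \<Longrightarrow> cmod (f y) \<le> M"
      using holomorphic_on_subset[OF hol] ball_subset_cball[of x "\<rho> / 4"] M
        continuous_on_subset[OF holomorphic_on_imp_continuous_on[OF hol]]
      by (force simp: dist_norm)+
    from Cauchy_inequality[OF this(1,2) _ this(3), of 2] assms(3) show ?thesis
      by (simp add: numeral_2_eq_2)
  qed
  have "cmod ((deriv ^^ 0) f h - (\<Sum>i\<le>1. (deriv ^^ i) f 0 * (h - 0) ^ i / fact i))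
      \<le> fact 2 * M / (\<rho> / 4)^2 * cmod (h - 0) ^ Suc 1 / fact 1"
    by (rule complex_Taylor[where S = S, OF _ d B])
       (use h assms(3) in \<open>auto simp: S_def\<close>)
  then have *: "cmod (f h - f 0 - deriv f 0 * h) \<le> 32 * M / \<rho>\<^sup>2 * (cmod h)\<^sup>2"
    by (simp add: power2_eq_square algebra_simps)
  have "(f h - f 0) / h - deriv f 0 = (f h - f 0 - deriv f 0 * h) / h"
    using h by (simp add: divide_simps)
  then have "cmod ((f h - f 0) / h - deriv f 0) = cmod (f h - f 0 - deriv f 0 * h) / cmod h"
    by (simp add: norm_divide)
  also have "\<dots> \<le> 32 * M / \<rho>\<^sup>2 * (cmod h)\<^sup>2 / cmod h"
    using * by (intro divide_right_mono) auto
  finally show ?thesis using h by (simp add: power2_eq_square)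
qed

text \<open>The derivative in a transversal direction is a locally uniform limit of difference
  quotients, by the Cauchy estimates in that direction.\<close>

lemma holomorphic_on_directional_derivative:
  assumes hol: "holomorphic_map g S" and S: "open S" and k: "complex_functional k"
    and T: "open T" "\<And>\<zeta>. \<zeta> \<in> T \<Longrightarrow> a + \<zeta> *s x \<in> S"
  shows "(\<lambda>\<zeta>. k (frechet_derivative g (at (a + \<zeta> *s x)) y)) holomorphic_on T"
proof -
  let ?D = "\<lambda>\<zeta>. k (frechet_derivative g (at (a + \<zeta> *s x)) y)"
  have "?D field_differentiable (at \<zeta>0)" if \<zeta>0: "\<zeta>0 \<in> T" for \<zeta>0
  proof -
    obtain e where e: "0 < e" "cball (a + \<zeta>0 *s x) e \<subseteq> S"
      using S T(2)[OF \<zeta>0] open_contains_cball by blast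
    define \<rho> where "\<rho> = e / (norm x + norm y + 1)"
    have nn: "0 < norm x + norm y + 1" by (simp add: add_nonneg_pos)
    have \<rho>: "0 < \<rho>" using e(1) nn by (simp add: \<rho>_def)
    have inC: "a + \<zeta> *s x + c *s y \<in> cball (a + \<zeta>0 *s x) e" if "cmod (\<zeta> - \<zeta>0) \<le> \<rho>" "cmod c \<le> \<rho>" for \<zeta> c
    proof -
      have "norm ((\<zeta> - \<zeta>0) *s x + c *s y) \<le> cmod (\<zeta> - \<zeta>0) * norm x + cmod c * norm y"
        by (metis norm_smult norm_triangle_ineq)
      also have "\<dots> \<le> \<rho> * norm x + \<rho> * norm y"
        using that by (intro add_mono mult_right_mono) auto
      also have "\<dots> \<le> \<rho> * (norm x + norm y + 1)" using \<rho> by (simp add: algebra_simps)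
      also have "\<dots> = e" using nn by (simp add: \<rho>_def)
      finally have "norm ((\<zeta> - \<zeta>0) *s x + c *s y) \<le> e" .
      moreover have "a + \<zeta> *s x + c *s y - (a + \<zeta>0 *s x) = (\<zeta> - \<zeta>0) *s x + c *s y"
        by (simp add: vector_sub_rdistrib)
      ultimately show ?thesis by (metis dist_norm mem_cball dist_commute)
    qed
    define F where "F = (\<lambda>\<zeta> c. k (g (a + \<zeta> *s x + c *s y)))"
    have "continuous_on (cball (a + \<zeta>0 *s x) e) (\<lambda>z. k (g z))"
      by (rule continuous_on_compose2[OF
            linear_continuous_on[OF complex_functional_bounded_linear[OF k]]
            continuous_on_subset[OF holomorphic_map_continuous_on[OF hol] e(2)] subset_UNIV])
    then have "bounded ((\<lambda>z. k (g z)) ` cball (a + \<zeta>0 *s x) e)"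
      by (intro compact_imp_bounded compact_continuous_image) auto
    then obtain M where M: "\<And>z. z \<in> cball (a + \<zeta>0 *s x) e \<Longrightarrow> cmod (k (g z)) \<le> M"
      unfolding bounded_iff by blast
    define h where "h = (\<lambda>n. complex_of_real (\<rho> / (2 * real (n + 2))))"
    have h: "h n \<noteq> 0" "cmod (h n) < \<rho> / 2" for n
      using \<rho> unfolding h_def norm_of_real of_real_eq_0_iff by (auto simp: divide_simps)
    define q where "q = (\<lambda>n \<zeta>. (F \<zeta> (h n) - F \<zeta> 0) / h n)"
    have holc: "F \<zeta> holomorphic_on ball 0 \<rho>" if "cmod (\<zeta> - \<zeta>0) \<le> \<rho>" for \<zeta>
      unfolding F_def using inC[OF that] e(2)
      by (intro holomorphic_on_slice[OF hol k]) force
    have derc: "deriv (F \<zeta>) 0 = ?D \<zeta>" if "cmod (\<zeta> - \<zeta>0) \<le> \<rho>" for \<zeta>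
    proof -
      have "a + \<zeta> *s x + 0 *s y \<in> S" using inC[OF that, of 0] e(2) \<rho> by auto
      from holomorphic_mapE[OF hol this] obtain L
        where L: "(g has_derivative L) (at (a + \<zeta> *s x + 0 *s y))" "complex_linear_map L" .
      have "(F \<zeta> has_field_derivative k (L y)) (at 0)"
        unfolding F_def by (rule has_field_derivative_slice[OF L k])
      moreover have "L = frechet_derivative g (at (a + \<zeta> *s x))"
        using frechet_derivative_at[OF L(1)] by simp
      ultimately show ?thesis by (simp add: DERIV_imp_deriv)
    qed
    have err: "cmod (q n \<zeta> - ?D \<zeta>) \<le> 32 * M / \<rho>\<^sup>2 * cmod (h n)" if "cmod (\<zeta> - \<zeta>0) \<le> \<rho>" for n \<zeta>
      unfolding q_def derc[OF that, symmetric]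
      by (rule difference_quotient_error[OF holc[OF that] _ \<rho> h])
         (use M inC[OF that] in \<open>auto simp: F_def\<close>)
    have holq: "q n holomorphic_on ball \<zeta>0 \<rho>" for n
    proof -
      have "(\<lambda>\<zeta>. F \<zeta> c) holomorphic_on ball \<zeta>0 \<rho>" if "cmod c \<le> \<rho>" for c
      proof -
        have "(\<lambda>\<zeta>. k (g ((a + c *s y) + \<zeta> *s x))) holomorphic_on ball \<zeta>0 \<rho>"
        proof (rule holomorphic_on_slice[OF hol k])
          fix \<zeta> assume "\<zeta> \<in> ball \<zeta>0 \<rho>"
          then have "a + \<zeta> *s x + c *s y \<in> S"
            using inC[OF _ that, of \<zeta>] e(2) by (auto simp: dist_norm norm_minus_commute)
          then show "a + c *s y + \<zeta> *s x \<in> S" by (simp add: algebra_simps)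
        qed
        then show ?thesis by (simp add: F_def algebra_simps)
      qed
      from this[of "h n"] this[of 0] show ?thesis
        unfolding q_def using h(1)[of n] h(2)[of n] \<rho> by (intro holomorphic_intros) auto
    qed
    have "h \<longlonglongrightarrow> 0"
    proof -
      have "(\<lambda>n. \<rho> / (2 * real (n + 2))) \<longlonglongrightarrow> 0" by real_asymp
      then have "(\<lambda>n. complex_of_real (\<rho> / (2 * real (n + 2)))) \<longlonglongrightarrow> of_real 0" by (rule tendsto_of_real)
      then show ?thesis by (simp add: h_def)
    qed
    then have lim: "(\<lambda>n. 32 * M / \<rho>\<^sup>2 * cmod (h n)) \<longlonglongrightarrow> 0"
      by (intro tendsto_mult_right_zero tendsto_norm_zero)
    have "?D holomorphic_on ball \<zeta>0 \<rho>"
    proof (rule holomorphic_uniform_sequence[OF open_ball holq])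
      fix \<zeta>1 assume "\<zeta>1 \<in> ball \<zeta>0 \<rho>"
      then obtain d where d: "d > 0" "cball \<zeta>1 d \<subseteq> ball \<zeta>0 \<rho>" using open_contains_cball open_ball by blast
      have "uniform_limit (cball \<zeta>1 d) q ?D sequentially"
      proof (rule uniform_limitI)
        fix e' :: real assume "e' > 0"
        then have "\<forall>\<^sub>F n in sequentially. 32 * M / \<rho>\<^sup>2 * cmod (h n) < e'"
          using lim order_tendstoD(2) by blast
        then show "\<forall>\<^sub>F n in sequentially. \<forall>\<zeta>\<in>cball \<zeta>1 d. dist (q n \<zeta>) (?D \<zeta>) < e'"
        proof eventually_elim
          case (elim n)
          show ?case
          proof
            fix \<zeta> assume "\<zeta> \<in> cball \<zeta>1 d"
            then have "cmod (\<zeta> - \<zeta>0) \<le> \<rho>" using d(2) by (auto simp: dist_norm norm_minus_commute)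
            from err[OF this, of n] elim show "dist (q n \<zeta>) (?D \<zeta>) < e'" by (simp add: dist_norm)
          qed
        qed
      qed
      then show "\<exists>d>0. cball \<zeta>1 d \<subseteq> ball \<zeta>0 \<rho> \<and> uniform_limit (cball \<zeta>1 d) q ?D sequentially"
        using d by blast
    qed
    then show ?thesis using \<rho> by (simp add: holomorphic_on_imp_differentiable_at)
  qed
  then show ?thesis
    unfolding holomorphic_on_def using field_differentiable_at_within by blast
qed


section \<open>Holomorphic functions and automorphisms of the ball\<close>

definition holomorphic_fun :: "(complex ^ 'd \<Rightarrow> complex) \<Rightarrow> (complex ^ 'd) set \<Rightarrow> bool"
  where "holomorphic_fun h S \<longleftrightarrow> (\<forall>z\<in>S. \<exists>k. (h has_derivative k) (at z) \<and> complex_functional k)"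

lemma holomorphic_funE:
  assumes "holomorphic_fun h S" "z \<in> S"
  obtains k where "(h has_derivative k) (at z)" "complex_functional k"
  using assms unfolding holomorphic_fun_def by blast

lemma complex_functionalI:
  "(h has_derivative k) F \<Longrightarrow> (\<And>c v. k (c *s v) = c * k v) \<Longrightarrow> complex_functional k"
  unfolding complex_functional_def using has_derivative_linear by blast

lemma holomorphic_fun_const: "holomorphic_fun (\<lambda>x. c) S"
  unfolding holomorphic_fun_def complex_functional_def
  by (auto intro!: exI[of _ "\<lambda>x. 0"] linearI)

lemma holomorphic_fun_functional: "complex_functional k \<Longrightarrow> holomorphic_fun k S"
  unfolding holomorphic_fun_def
  using bounded_linear_imp_has_derivative complex_functional_bounded_linear by blast

lemma holomorphic_fun_add:
  assumes "holomorphic_fun g S" "holomorphic_fun h S" shows "holomorphic_fun (\<lambda>x. g x + h x) S"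
  unfolding holomorphic_fun_def
proof
  fix z assume z: "z \<in> S"
  obtain k where k: "(g has_derivative k) (at z)" "complex_functional k"
    using holomorphic_funE[OF assms(1) z] .
  obtain l where l: "(h has_derivative l) (at z)" "complex_functional l"
    using holomorphic_funE[OF assms(2) z] .
  have "((\<lambda>x. g x + h x) has_derivative (\<lambda>x. k x + l x)) (at z)"
    using k l by (intro has_derivative_add)
  moreover from this have "complex_functional (\<lambda>x. k x + l x)"
    by (rule complex_functionalI) (simp add: k l complex_functional_smult algebra_simps)
  ultimately show "\<exists>k. ((\<lambda>x. g x + h x) has_derivative k) (at z) \<and> complex_functional k" by blast
qed

lemma holomorphic_fun_mult:
  assumes "holomorphic_fun g S" "holomorphic_fun h S" shows "holomorphic_fun (\<lambda>x. g x * h x) S"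
  unfolding holomorphic_fun_def
proof
  fix z assume z: "z \<in> S"
  obtain k where k: "(g has_derivative k) (at z)" "complex_functional k"
    using holomorphic_funE[OF assms(1) z] .
  obtain l where l: "(h has_derivative l) (at z)" "complex_functional l"
    using holomorphic_funE[OF assms(2) z] .
  have "((\<lambda>x. g x * h x) has_derivative (\<lambda>x. g z * l x + k x * h z)) (at z)"
    using k l by (intro has_derivative_mult)
  moreover from this have "complex_functional (\<lambda>x. g z * l x + k x * h z)"
    by (rule complex_functionalI) (simp add: k l complex_functional_smult algebra_simps)
  ultimately show "\<exists>k. ((\<lambda>x. g x * h x) has_derivative k) (at z) \<and> complex_functional k" by blast
qed

lemma holomorphic_fun_inverse:
  assumes "holomorphic_fun g S" "\<And>x. x \<in> S \<Longrightarrow> g x \<noteq> 0" shows "holomorphic_fun (\<lambda>x. 1 / g x) S"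
  unfolding holomorphic_fun_def
proof
  fix z assume z: "z \<in> S"
  obtain k where k: "(g has_derivative k) (at z)" "complex_functional k"
    using holomorphic_funE[OF assms(1) z] .
  have "((\<lambda>x. 1 / g x) has_derivative (\<lambda>x. - (inverse (g z) * k x * inverse (g z)))) (at z)"
    using Deriv.has_derivative_inverse[OF assms(2)[OF z] k(1)] by (simp add: inverse_eq_divide)
  moreover from this have "complex_functional (\<lambda>x. - (inverse (g z) * k x * inverse (g z)))"
    by (rule complex_functionalI) (simp add: k complex_functional_smult algebra_simps)
  ultimately show "\<exists>k. ((\<lambda>x. 1 / g x) has_derivative k) (at z) \<and> complex_functional k" by blast
qed

lemma holomorphic_fun_sum:
  assumes "finite I" "\<And>i. i \<in> I \<Longrightarrow> holomorphic_fun (g i) S"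
  shows "holomorphic_fun (\<lambda>x. \<Sum>i\<in>I. g i x) S"
  using assms by (induction I rule: finite_induct) (auto intro: holomorphic_fun_const holomorphic_fun_add)

lemma bounded_bilinear_smult: "bounded_bilinear (\<lambda>c (v :: complex ^ 'd). c *s v)"
proof
  show "\<exists>K. \<forall>a (b :: complex ^ 'd). norm (a *s b) \<le> norm a * norm b * K"
    by (intro exI[of _ 1]) (simp add: norm_smult)
qed (simp_all add: vec_eq_iff algebra_simps)

lemma holomorphic_map_smult:
  assumes "holomorphic_fun h S" "holomorphic_map g S" shows "holomorphic_map (\<lambda>x. h x *s g x) S"
  unfolding holomorphic_map_def
proof
  fix z assume z: "z \<in> S"
  obtain k where k: "(h has_derivative k) (at z)" "complex_functional k"
    using holomorphic_funE[OF assms(1) z] .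
  obtain L where L: "(g has_derivative L) (at z)" "complex_linear_map L"
    using holomorphic_mapE[OF assms(2) z] .
  have "((\<lambda>x. h x *s g x) has_derivative (\<lambda>x. h z *s L x + k x *s g z)) (at z)"
    by (rule bounded_bilinear.FDERIV[OF bounded_bilinear_smult k(1) L(1)])
  moreover have "h z *s L (c *s v) + k (c *s v) *s g z = c *s (h z *s L v + k v *s g z)" for c v
    by (simp add: k L complex_functional_smult complex_linear_map_smult vec_eq_iff algebra_simps)
  ultimately show "\<exists>L. ((\<lambda>x. h x *s g x) has_derivative L) (at z) \<and> (\<forall>c v. L (c *s v) = c *s L v)"
    by blast
qed

lemma holomorphic_map_add:
  assumes "holomorphic_map h S" "holomorphic_map g S" shows "holomorphic_map (\<lambda>x. h x + g x) S"
  unfolding holomorphic_map_def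
proof
  fix z assume z: "z \<in> S"
  obtain K where K: "(h has_derivative K) (at z)" "complex_linear_map K"
    using holomorphic_mapE[OF assms(1) z] .
  obtain L where L: "(g has_derivative L) (at z)" "complex_linear_map L"
    using holomorphic_mapE[OF assms(2) z] .
  have "((\<lambda>x. h x + g x) has_derivative (\<lambda>x. K x + L x)) (at z)"
    by (rule has_derivative_add[OF K(1) L(1)])
  moreover have "K (c *s v) + L (c *s v) = c *s (K v + L v)" for c v
    by (simp add: K L complex_linear_map_smult vec_eq_iff algebra_simps)
  ultimately show "\<exists>L. ((\<lambda>x. h x + g x) has_derivative L) (at z) \<and> (\<forall>c v. L (c *s v) = c *s L v)"
    by blast
qed

lemma holomorphic_map_id: "holomorphic_map (\<lambda>x. x) S"
  using holomorphic_map_complex_linear_map[of "\<lambda>x. x" 0]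
  by (simp add: complex_linear_map_def linear_id[unfolded id_def])

lemma holomorphic_map_const: "holomorphic_map (\<lambda>x. b) S"
  unfolding holomorphic_map_def by (auto intro!: exI[of _ "\<lambda>x. 0"])

text \<open>The automorphism of the ball that moves \<open>b\<close> to \<open>0\<close>. The usual formula uses the projection to the line of
  \<open>b\<close>; here it is rewritten, with \<open>1 - s = (norm b)\<^sup>2 / (1 + s)\<close> for \<open>s = sqrt (1 - (norm b)\<^sup>2)\<close>, in a form that makes sense
  for \<open>b = 0\<close>.\<close>

definition ball_move :: "complex ^ 'd \<Rightarrow> complex ^ 'd \<Rightarrow> complex ^ 'd"
  where "ball_move b x = (1 / (1 - cinner x b)) *s
    (of_real (sqrt (1 - (norm b)\<^sup>2)) *s x +
      (cinner x b * of_real (1 / (1 + sqrt (1 - (norm b)\<^sup>2))) - 1) *s b)"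

lemma cinner_neq_1: "norm x < 1 \<Longrightarrow> norm b < 1 \<Longrightarrow> cinner x b \<noteq> 1"
  using norm_cinner_le[of x b] mult_strict_mono'[of "norm x" 1 "norm b" 1] by auto

text \<open>The reason is the identity
  \<open>1 - (norm (ball_move b x))\<^sup>2 = (1 - (norm b)\<^sup>2) * (1 - (norm x)\<^sup>2) / (cmod (1 - cinner x b))\<^sup>2\<close>.\<close>

lemma norm_ball_move:
  assumes b: "norm b < 1" and x: "norm x < 1"
  shows "norm (ball_move b x) < 1"
proof -
  define r where "r = sqrt (1 - (norm b)\<^sup>2)"
  define s where "s = complex_of_real r"
  define k where "k = complex_of_real (1 / (1 + r))"
  define t where "t = cinner x b"
  define N where "N = s *s x + (t * k - 1) *s b"
  have b2: "(norm b)\<^sup>2 < 1" using b by (simp add: abs_square_less_1)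
  have r: "0 < r" "r\<^sup>2 = 1 - (norm b)\<^sup>2" using b2 by (auto simp: r_def)
  have "1 + s = complex_of_real (1 + r)" by (simp add: s_def)
  then have "1 + s \<noteq> 0" using r(1) by (simp only: of_real_eq_0_iff)
  then have k: "k * (1 + s) = 1" by (simp add: k_def s_def)
  have s: "s * s = 1 - cinner b b" "cnj s = s" "cnj k = k"
  proof -
    have "s * s = of_real (r\<^sup>2)" by (simp add: s_def power2_eq_square)
    then show "s * s = 1 - cinner b b" unfolding r(2) cinner_self by simp
  qed (simp_all add: s_def k_def)
  have "cinner N N = s * s * cinner x x + s * cnj (t * k - 1) * t + (t * k - 1) * s * cnj t
      + (t * k - 1) * cnj (t * k - 1) * cinner b b"
    unfolding N_def cinner_simps t_def s(2,3) by (simp add: cnj_cinner s(2,3) algebra_simps)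
  also have "\<dots> = (1 - t) * (1 - cnj t) - s * s * (1 - cinner x x)"
  proof -
    have *: "s * s * X + s * (t' * k - 1) * t + (t * k - 1) * s * t' + (t * k - 1) * (t' * k - 1) * (1 - s * s)
        - ((1 - t) * (1 - t') - s * s * (1 - X))
      = (k * (1 + s) - 1) * (t * t' * (k * (1 - s) + 1) - (t + t') * (1 - s))" for X t' :: complex
      by (simp add: algebra_simps)
    have B: "cinner b b = 1 - s * s" using s(1) by simp
    show ?thesis
      using *[of "cinner x x" "cnj t"] unfolding complex_cnj_diff complex_cnj_mult s(2,3) complex_cnj_one B k
      by simp
  qed
  finally have "complex_of_real ((norm N)\<^sup>2) = of_real ((cmod (1 - t))\<^sup>2 - r\<^sup>2 * (1 - (norm x)\<^sup>2))"
    unfolding cinner_self of_real_diff complex_norm_square s_def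
    by (simp add: complex_norm_square[symmetric] power2_eq_square flip: of_real_power)
  then have "(norm N)\<^sup>2 = (cmod (1 - t))\<^sup>2 - r\<^sup>2 * (1 - (norm x)\<^sup>2)"
    unfolding of_real_eq_iff .
  moreover have "0 < r\<^sup>2 * (1 - (norm x)\<^sup>2)" using r(1) x by (intro mult_pos_pos) (auto simp: abs_square_less_1)
  ultimately have "norm N < cmod (1 - t)"
    by (intro power2_less_imp_less[of "norm N"]) auto
  moreover have "ball_move b x = (1 / (1 - t)) *s N"
    by (simp add: ball_move_def N_def t_def s_def k_def r_def)
  moreover have "1 - t \<noteq> 0" using cinner_neq_1[OF x b] by (simp add: t_def)
  ultimately show ?thesis by (simp add: norm_smult norm_divide)
qed

lemma ball_move_inverse:
  assumes b: "norm b < 1" and x: "norm x < 1"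
  shows "ball_move (- b) (ball_move b x) = x"
proof -
  define r where "r = sqrt (1 - (norm b)\<^sup>2)"
  define s where "s = complex_of_real r"
  define k where "k = complex_of_real (1 / (1 + r))"
  define t where "t = cinner x b"
  define y where "y = ball_move b x"
  define u where "u = cinner y b"
  have b2: "(norm b)\<^sup>2 < 1" using b by (simp add: abs_square_less_1)
  have r: "0 < r" "r\<^sup>2 = 1 - (norm b)\<^sup>2" using b2 by (auto simp: r_def)
  have "1 + s = complex_of_real (1 + r)" by (simp add: s_def)
  then have "1 + s \<noteq> 0" using r(1) by (simp only: of_real_eq_0_iff)
  then have k: "k * (1 + s) = 1" by (simp add: k_def s_def)
  have s: "s * s = 1 - cinner b b" "s \<noteq> 0"
  proof -
    have "s * s = of_real (r\<^sup>2)" by (simp add: s_def power2_eq_square)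
    then show "s * s = 1 - cinner b b" unfolding r(2) cinner_self by simp
  qed (use r(1) in \<open>simp add: s_def\<close>)
  have t: "1 - t \<noteq> 0" using cinner_neq_1[OF x b] by (simp add: t_def)
  have y: "y = (1 / (1 - t)) *s (s *s x + (t * k - 1) *s b)"
    by (simp add: y_def ball_move_def t_def s_def k_def r_def)
  have yi: "y $ i * (1 - t) = s * x $ i + (t * k - 1) * b $ i" for i
  proof -
    have "y $ i = (s * x $ i + (t * k - 1) * b $ i) / (1 - t)"
      by (simp add: y add_divide_distrib diff_divide_distrib left_diff_distrib)
    then show ?thesis unfolding nonzero_eq_divide_eq[OF t] .
  qed
  have u: "u * (1 - t) = t - 1 + s * s"
  proof -
    have "u * (1 - t) = s * t + (t * k - 1) * cinner b b"
      unfolding u_def y cinner_simps using t by (simp add: t_def)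
    also have "\<dots> = t - 1 + s * s + (k * (1 + s) - 1) * t * (1 - s)"
    proof -
      have "cinner b b = 1 - s * s" using s(1) by simp
      then show ?thesis by (simp only:) (simp add: algebra_simps)
    qed
    finally have "u * (1 - t) = t - 1 + s * s" unfolding k by simp
    then show ?thesis .
  qed
  then have u1: "(1 + u) * (1 - t) = s * s" by (simp add: distrib_right)
  then have u0: "1 + u \<noteq> 0" using s by auto
  have "ball_move (- b) y = (1 / (1 + u)) *s (s *s y + (u * k + 1) *s b)"
    unfolding ball_move_def r_def[symmetric] norm_minus_cancel cinner_simps s_def k_def u_def
    by (simp add: vec_eq_iff algebra_simps)
  also have "\<dots> = x"
  proof -
    have "s * y $ i + (u * k + 1) * b $ i = (1 + u) * x $ i" for i
    proof -
      have "(s * y $ i + (u * k + 1) * b $ i) * (1 - t) = (1 + u) * x $ i * (1 - t)"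
      proof -
        have "(s * y $ i + (u * k + 1) * b $ i) * (1 - t)
            = s * (y $ i * (1 - t)) + (k * (u * (1 - t)) + (1 - t)) * b $ i"
          by (simp add: algebra_simps)
        also have "\<dots> = s * s * x $ i + (k * (1 + s) - 1) * (t - (1 - s)) * b $ i"
          unfolding yi u by (simp add: algebra_simps)
        also have "\<dots> = (1 + u) * (1 - t) * x $ i" unfolding k u1 by simp
        finally show ?thesis by (simp add: algebra_simps)
      qed
      then show ?thesis using t by simp
    qed
    then have "s *s y + (u * k + 1) *s b = (1 + u) *s x" 
      unfolding vec_eq_iff vector_add_component vector_smult_component by blast
    then show ?thesis using u0 by (simp only: vector_smult_assoc) simp
  qed
  finally show ?thesis by (simp add: y_def)
qed

lemma holomorphic_ball_move:
  assumes "norm b < 1" shows "holomorphic_map (ball_move b) (ball 0 1)"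
proof -
  have 1: "holomorphic_fun (\<lambda>x. cinner x b) (ball 0 1)"
    by (intro holomorphic_fun_functional complex_functional_cinner)
  have 2: "holomorphic_fun (\<lambda>x. 1 + (-1) * cinner x b) (ball 0 1)"
    by (intro holomorphic_fun_add holomorphic_fun_mult holomorphic_fun_const 1)
  have 3: "holomorphic_fun (\<lambda>x. cinner x b * of_real (1 / (1 + sqrt (1 - (norm b)\<^sup>2))) + (-1)) (ball 0 1)"
    by (intro holomorphic_fun_add holomorphic_fun_mult holomorphic_fun_const 1)
  have 4: "1 + (-1) * cinner x b \<noteq> 0" if "x \<in> ball 0 1" for x
    using cinner_neq_1[of x b] that assms by simp
  have "holomorphic_map (\<lambda>x. (1 / (1 + (-1) * cinner x b)) *s
    (of_real (sqrt (1 - (norm b)\<^sup>2)) *s x +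
      (cinner x b * of_real (1 / (1 + sqrt (1 - (norm b)\<^sup>2))) + (-1)) *s b)) (ball 0 1)"
    by (rule holomorphic_map_smult holomorphic_map_add holomorphic_map_id holomorphic_map_const
        holomorphic_fun_const holomorphic_fun_inverse 2 3 4 | assumption)+
  moreover have "ball_move b = (\<lambda>x. (1 / (1 + (-1) * cinner x b)) *s
    (of_real (sqrt (1 - (norm b)\<^sup>2)) *s x +
      (cinner x b * of_real (1 / (1 + sqrt (1 - (norm b)\<^sup>2))) + (-1)) *s b))"
    by (simp add: ball_move_def fun_eq_iff)
  ultimately show ?thesis by simp
qed

lemma ball_automorphism:
  assumes "norm b < 1"
  shows "biholomorphism (ball_move b) (ball 0 1) (ball 0 1)" and "ball_move b b = 0"
proof -
  show "biholomorphism (ball_move b) (ball 0 1) (ball 0 1)"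
    using assms ball_move_inverse[of "- b"]
    by (intro biholomorphismI[of _ _ _ "ball_move (- b)"])
       (auto simp: holomorphic_ball_move norm_ball_move ball_move_inverse)
  define r where "r = sqrt (1 - (norm b)\<^sup>2)"
  have b2: "(norm b)\<^sup>2 < 1" using assms by (simp add: abs_square_less_1)
  have r: "0 < r" "r\<^sup>2 = 1 - (norm b)\<^sup>2" using b2 by (auto simp: r_def)
  have "(norm b)\<^sup>2 * (1 / (1 + r)) = 1 - r"
    using r by (simp add: divide_simps power2_eq_square) (simp add: algebra_simps)
  then have "of_real ((norm b)\<^sup>2 * (1 / (1 + r))) - 1 = - complex_of_real r" by simp
  then show "ball_move b b = 0"
    unfolding ball_move_def r_def[symmetric] cinner_self of_real_mult[symmetric]
    by (simp only: add.commute vector_sneg_minus1[symmetric] mult_minus_left vector_smult_lneg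
        right_minus vector_smult_rzero vector_sadd_rdistrib[symmetric] left_minus vector_smult_lzero)
qed


section \<open>Half-plane slices of convex domains biholomorphic to the ball\<close>

text \<open>In convex domains affine discs are as good as holomorphic ones, up to a factor of \<open>2\<close>: a functional that
  separates \<open>D\<close> from a point outside maps the holomorphic disc into a half-plane, where the Schwarz lemma bounds the
  derivative.\<close>

lemma convex_affine_disc:
  assumes D: "open D" "convex D" and h: "holomorphic_map h S"
    and S: "\<And>c. cmod c < \<rho> \<Longrightarrow> a + c *s w \<in> S \<and> h (a + c *s w) \<in> D"
    and L: "(h has_derivative L) (at a)" "complex_linear_map L"
    and \<rho>: "0 < \<rho>" and c: "cmod c < \<rho> / 2"
  shows "h a + c *s L w \<in> D"
proof (rule ccontr)
  assume q: "h a + c *s L w \<notin> D"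
  define q where "q = h a + c *s L w"
  have a: "a \<in> S" "h a \<in> D" using S[of 0] \<rho> by auto
  obtain y b where y: "y \<noteq> 0" "y \<bullet> q \<ge> b" "\<And>x. x \<in> D \<Longrightarrow> y \<bullet> x \<le> b"
    using separating_hyperplane_sets[of D "{q}"] D(2) q a(2) by (auto simp: q_def)
  have lt: "y \<bullet> x < b" if x: "x \<in> D" for x
  proof -
    obtain e where e: "e > 0" "cball x e \<subseteq> D"
      using open_contains_cball_eq[OF D(1), THEN spec, THEN iffD1, OF x] by auto
    define t where "t = e / norm y"
    have t: "0 < t" "t * norm y = e" using e(1) y(1) unfolding t_def by simp_all
    have "dist x (x + t *\<^sub>R y) \<le> e" unfolding dist_norm using t by simp
    then have "x + t *\<^sub>R y \<in> D" using e(2) unfolding mem_cball[symmetric] by (rule subsetD[rotated])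
    then have "y \<bullet> (x + t *\<^sub>R y) \<le> b" by (rule y(3))
    then have "y \<bullet> x + t * (y \<bullet> y) \<le> b" by (simp only: inner_add_right inner_scaleR_right)
    moreover have "0 < t * (y \<bullet> y)" using t(1) y(1) by (intro mult_pos_pos) auto
    ultimately show ?thesis by linarith
  qed
  let ?k = "\<lambda>x. cinner x y"
  have Re: "Re (?k x) = y \<bullet> x" for x by (metis inner_eq_Re_cinner inner_commute)
  have "(\<lambda>c. ?k (h (a + c *s w))) holomorphic_on ball 0 \<rho>"
    using S by (intro holomorphic_on_slice[OF h complex_functional_cinner]) auto
  moreover have "Re (?k (h (a + c *s w))) < b" if "c \<in> ball 0 \<rho>" for c
    unfolding Re using S[of c] that by (intro lt) auto
  moreover have "((\<lambda>c. ?k (h (a + c *s w))) has_field_derivative ?k (L w)) (at 0)"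
    using L by (intro has_field_derivative_slice complex_functional_cinner) auto
  ultimately have "\<rho> * cmod (?k (L w)) \<le> 2 * (b - Re (?k (h (a + 0 *s w))))"
    using halfplane_Schwarz_derivative[OF _ _ _ \<rho>, of "\<lambda>c. ?k (h (a + c *s w))"] by blast
  also have "\<dots> \<le> 2 * (Re (?k q) - Re (?k (h a)))" using y(2) by (simp add: Re)
  also have "\<dots> = 2 * Re (c * ?k (L w))" by (simp add: q_def cinner_simps)
  also have "\<dots> \<le> 2 * (cmod c * cmod (?k (L w)))"
    using complex_Re_le_cmod[of "c * ?k (L w)"] by (simp add: norm_mult)
  finally have *: "\<rho> * cmod (?k (L w)) \<le> 2 * cmod c * cmod (?k (L w))" by simp
  show False
  proof (cases "?k (L w) = 0")
    case True
    then have "Re (?k q) = Re (?k (h a))" by (simp add: q_def cinner_simps)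
    then show False using lt[OF a(2)] y(2) by (simp add: Re)
  next
    case False then show False using * c by simp
  qed
qed

lemma Bessel_two:
  assumes "norm u = 1" "norm e = 1" "cinner u e = 0"
  shows "(cmod (cinner x u))\<^sup>2 + (cmod (cinner x e))\<^sup>2 \<le> (norm x)\<^sup>2"
proof -
  have eu: "cinner e u = 0" using assms(3) cnj_cinner[of u e] by simp
  have u1: "cinner u u = 1" "cinner e e = 1" using assms by (simp_all add: cinner_self)
  define p where "p = cinner x u" define q where "q = cinner x e"
  define z where "z = x - p *s u - q *s e"
  have z: "cinner z u = 0" "cinner z e = 0"
    by (simp_all add: z_def cinner_simps u1 eu assms(3) p_def q_def)
  have "(norm (q *s e + z))\<^sup>2 = (norm (q *s e))\<^sup>2 + (norm z)\<^sup>2"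
    by (rule norm_add_orthogonal) (metis cinner_smult_left cnj_cinner complex_cnj_zero mult_zero_right z(2))
  moreover have "(norm (p *s u + (q *s e + z)))\<^sup>2 = (norm (p *s u))\<^sup>2 + (norm (q *s e + z))\<^sup>2"
    using z(1) cnj_cinner[of z u] by (intro norm_add_orthogonal) (simp add: cinner_simps assms(3))
  moreover have "x = p *s u + (q *s e + z)" by (simp add: z_def)
  ultimately have "(norm x)\<^sup>2 = (norm (p *s u))\<^sup>2 + (norm (q *s e))\<^sup>2 + (norm z)\<^sup>2" by simp
  then show ?thesis using assms by (simp add: norm_smult p_def q_def)
qed


lemma Schwarz_ball_fun:
  assumes "holomorphic_map g (ball 0 1)" "complex_functional k"
    and "h holomorphic_on T" "\<And>x. x \<in> ball 0 1 \<Longrightarrow> k (g x) \<in> T \<and> cmod (h (k (g x))) < 1"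
    and "h (k (g 0)) = 0" "x \<in> ball 0 1"
  shows "cmod (h (k (g x))) \<le> norm x"
proof (cases "x = 0")
  case False
  define y where "y = of_real (1 / norm x) *s x"
  have y: "norm y = 1" using False by (simp add: y_def norm_smult norm_divide)
  have x: "x = of_real (norm x) *s y" using False by (simp add: y_def vector_smult_assoc)
  have in1: "c *s y \<in> ball 0 1" if "cmod c < 1" for c using that y by (simp add: norm_smult)
  have "(\<lambda>c. k (g (0 + c *s y))) holomorphic_on ball 0 1"
    using in1 by (intro holomorphic_on_slice[OF assms(1,2)]) auto
  from holomorphic_on_compose_gen[OF this assms(3)] assms(4) in1
  have "(\<lambda>c. h (k (g (c *s y)))) holomorphic_on ball 0 1" by (auto simp: o_def image_subset_iff)
  from Schwarz_Lemma(1)[OF this, of "of_real (norm x)"] assms in1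
  have "cmod (h (k (g (of_real (norm x) *s y)))) \<le> norm x" by simp
  then show ?thesis using x by simp
qed (use assms(5) in simp)

text \<open>The quotient of the two sides is the modulus of a component of the ball automorphism that moves \<open>\<zeta> *s u\<close> to \<open>0\<close>.
  The bound follows from Bessel's inequality and
  \<open>(1 - (cmod \<zeta>)\<^sup>2) * (1 - (cmod g)\<^sup>2) \<le> (cmod (1 - cnj \<zeta> * g))\<^sup>2\<close>.\<close>

lemma disc_Bessel_bound:
  assumes "norm u = 1" "norm e = 1" "cinner u e = 0" "norm x < 1" "cmod \<zeta> < 1"
  shows "sqrt (1 - (cmod \<zeta>)\<^sup>2) * cmod (cinner x e) < cmod (1 - cnj \<zeta> * cinner x u)"
proof -
  let ?g = "cinner x u"
  have g: "(cmod (cinner x e))\<^sup>2 < 1 - (cmod ?g)\<^sup>2"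
    using Bessel_two[OF assms(1-3), of x] assms(4) abs_square_less_1[of "norm x"] by simp
  have s: "0 < 1 - (cmod \<zeta>)\<^sup>2" using assms(5) by (simp add: abs_square_less_1)
  have "(sqrt (1 - (cmod \<zeta>)\<^sup>2) * cmod (cinner x e))\<^sup>2 = (1 - (cmod \<zeta>)\<^sup>2) * (cmod (cinner x e))\<^sup>2"
    using s by (simp add: power_mult_distrib)
  also have "\<dots> < (1 - (cmod \<zeta>)\<^sup>2) * (1 - (cmod ?g)\<^sup>2)"
    using g s by (rule mult_strict_left_mono)
  also have "\<dots> \<le> (cmod (1 - cnj \<zeta> * ?g))\<^sup>2"
  proof -
    have "(cmod (1 - cnj \<zeta> * ?g))\<^sup>2 - (1 - (cmod \<zeta>)\<^sup>2) * (1 - (cmod ?g)\<^sup>2) = (cmod (?g - \<zeta>))\<^sup>2"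
      unfolding cmod_power2 by (simp add: power2_eq_square algebra_simps)
    then show ?thesis using zero_le_power2[of "cmod (?g - \<zeta>)"] by linarith
  qed
  finally show ?thesis by (rule power2_less_imp_less) simp
qed

text \<open>The translate is a convex combination of a point of \<open>D\<close> slightly further out than \<open>x\<close> and a point far away in the
  half-plane.\<close>

lemma translate_left_halfplane:
  assumes D: "open D" "convex D" and half: "\<And>\<eta>. Re \<eta> < 1 \<Longrightarrow> \<eta> *s \<xi> \<in> D"
    and x: "x \<in> D" and \<nu>: "Re \<nu> \<le> 0"
  shows "x + \<nu> *s \<xi> \<in> D"
proof -
  obtain e where e: "e > 0" "cball x e \<subseteq> D"
    using open_contains_cball_eq[OF D(1), THEN spec, THEN iffD1, OF x] by auto
  define t where "t = e / (norm x + e + 1)"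
  have nn: "0 < norm x + e + 1" using e(1) norm_ge_zero[of x] by linarith
  have t: "0 < t" "t < 1" "t * norm x \<le> e"
  proof -
    have "norm x + 1 > 0" using norm_ge_zero[of x] by linarith
    then show "0 < t" "t < 1" using e(1) nn by (auto simp: t_def divide_simps)
    have "e * norm x \<le> e * (norm x + e + 1)" using e(1) by (intro mult_left_mono) auto
    then show "t * norm x \<le> e" using nn by (simp add: t_def divide_simps mult.commute)
  qed
  have "x + t *\<^sub>R x \<in> D" using t by (intro subsetD[OF e(2)]) (simp add: dist_norm)
  moreover have "(\<nu> * of_real ((1 + t) / t)) *s \<xi> \<in> D"
  proof (rule half)
    have "Re \<nu> * ((1 + t) / t) \<le> 0" using \<nu> t by (intro mult_nonpos_nonneg) auto
    then show "Re (\<nu> * of_real ((1 + t) / t)) < 1" by (simp add: Re_divide_of_real times_divide_eq_right del: of_real_add of_real_divide)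
  qed
  moreover have "1 / (1 + t) + t / (1 + t) = 1" using t by (simp add: field_simps)
  ultimately have "(1 / (1 + t)) *\<^sub>R (x + t *\<^sub>R x) + (t / (1 + t)) *\<^sub>R ((\<nu> * of_real ((1 + t) / t)) *s \<xi>) \<in> D"
    using D(2) t by (intro convexD) auto
  moreover have "(1 / (1 + t)) *\<^sub>R (x + t *\<^sub>R x) = x"
  proof -
    have "x + t *\<^sub>R x = (1 + t) *\<^sub>R x" by (simp add: algebra_simps)
    then show ?thesis using t by simp
  qed
  moreover have "(t / (1 + t)) *\<^sub>R ((\<nu> * of_real ((1 + t) / t)) *s \<xi>) = \<nu> *s \<xi>"
  proof -
    have "complex_of_real (t / (1 + t)) * of_real ((1 + t) / t) = of_real (t / (1 + t) * ((1 + t) / t))"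
      by (simp only: of_real_mult)
    also have "t / (1 + t) * ((1 + t) / t) = 1" using t by simp
    finally show ?thesis
      by (simp add: scaleR_eq_smult vector_smult_assoc mult.left_commute del: of_real_divide of_real_add)
  qed
  ultimately show ?thesis by simp
qed

text \<open>The half-plane \<open>\<lambda>\<mu>. (1 + \<mu>) *s \<xi>\<close>, \<open>Re \<mu> < 0\<close>, is a complex geodesic of \<open>D\<close>, because the functional \<open>k\<close> is a left inverse with values
  in a half-plane. Hence a biholomorphism \<open>\<phi>\<close> to the ball, normalized by \<open>\<phi> 0 = 0\<close>, sends it to a flat
  disc \<open>\<lambda>\<zeta>. \<zeta> *s u\<close> with a unit vector \<open>u\<close>. Let \<open>w \<mu>\<close> be the image of the vector \<open>v\<close> at the point with parameter \<open>\<mu>\<close>, let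
  \<open>\<tau> = - Re \<mu>\<close> and \<open>s = sqrt (1 - (cmod \<zeta>)\<^sup>2)\<close>. The component of \<open>w \<mu>\<close> orthogonal to \<open>u\<close> measures the tangential radius \<open>R\<close> in
  \<open>D\<close>: it is at most \<open>s / R\<close> by the Schwarz lemma, and, since \<open>k v = 0\<close> makes the other component
  negligible, a disc of radius comparable to \<open>s\<close> divided by it fits into the ball and then, by convexity, into \<open>D\<close>.

  Here \<open>s = 2 * sqrt \<tau> / cmod (1 - \<mu>)\<close>. As \<open>D\<close> is mapped into itself by the translations by \<open>\<nu> *s \<xi>\<close>,
  \<open>Re \<nu> \<le> 0\<close>, the radius \<open>R\<close> is bounded below for \<open>\<tau> \<ge> 1\<close>, so the holomorphic function \<open>\<lambda>\<mu>. (1 - \<mu>) * cinner (w \<mu>) e\<close>, with \<open>e\<close> orthogonal to \<open>u\<close>, grows at most like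
  \<open>sqrt \<tau>\<close>, uniformly in \<open>Im \<mu>\<close>. By the Phragmen-Lindeloef principle it is then bounded, and \<open>R\<close> must grow at least like
  \<open>sqrt \<tau>\<close>.\<close>

lemma halfplane_slice_radius:
  assumes D: "open D" "convex D" and bih: "biholomorphic D (ball 0 1)"
    and half: "\<And>\<eta>. Re \<eta> < 1 \<Longrightarrow> \<eta> *s \<xi> \<in> D"
    and k: "complex_functional k" "\<And>x. x \<in> D \<Longrightarrow> Re (k x) < 1" "k \<xi> = 1" "k v = 0"
  obtains C where "C > 0"
    and "\<And>T c. 1 \<le> T \<Longrightarrow> cmod c < C * sqrt T \<Longrightarrow> of_real (1 - T) *s \<xi> + c *s v \<in> D"
proof -
  define z where "z = (\<lambda>\<mu>. \<xi> + \<mu> *s \<xi>)"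
  have z_alt: "z \<mu> = (1 + \<mu>) *s \<xi>" for \<mu> by (simp add: z_def vector_sadd_rdistrib)
  have zD: "z \<mu> \<in> D" if "Re \<mu> < 0" for \<mu> unfolding z_alt using that by (intro half) simp
  have z0: "z (-1) = 0" by (simp add: z_alt)
  have D0: "0 \<in> D" using zD[of "-1"] z0 by simp
  have kz: "k (z \<mu>) - 1 = \<mu>" for \<mu> 
    unfolding z_alt complex_functional_smult[OF k(1)] k(3) by simp
  obtain \<phi>0 where \<phi>0: "biholomorphism \<phi>0 D (ball 0 1)" using bih unfolding biholomorphic_def by blast
  then have "\<phi>0 0 \<in> ball 0 1" using D0 unfolding biholomorphism_def bij_betw_def by blast
  then have b: "norm (\<phi>0 0) < 1" by simp
  define \<phi> where "\<phi> = (\<lambda>x. ball_move (\<phi>0 0) (\<phi>0 x))"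
  have "biholomorphism \<phi> D (ball 0 1)" unfolding \<phi>_def
    by (rule biholomorphism_compose[OF \<phi>0 ball_automorphism(1)[OF b] open_ball])
  then obtain \<psi> where hol: "holomorphic_map \<phi> D" "holomorphic_map \<psi> (ball 0 1)"
    and \<phi>: "\<And>x. x \<in> D \<Longrightarrow> \<phi> x \<in> ball 0 1 \<and> \<psi> (\<phi> x) = x"
    and \<psi>: "\<And>y. y \<in> ball 0 1 \<Longrightarrow> \<psi> y \<in> D \<and> \<phi> (\<psi> y) = y"
    by (rule biholomorphismE) blast
  have \<phi>00: "\<phi> 0 = 0" by (simp add: \<phi>_def ball_automorphism(2)[OF b])
  have \<psi>00: "\<psi> 0 = 0" using \<phi>[OF D0] \<phi>00 by simp
  \<comment> \<open>The Cayley transform and its inverse between the disc and the left half-plane.\<close>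
  define cay where "cay = (\<lambda>\<zeta>::complex. (\<zeta> - 1) / (\<zeta> + 1))"
  define yac where "yac = (\<lambda>\<mu>::complex. (1 + \<mu>) / (1 - \<mu>))"
  have ne1: "\<zeta> + 1 \<noteq> 0" if "cmod \<zeta> < 1" for \<zeta> :: complex
  proof
    assume "\<zeta> + 1 = 0" then have "\<zeta> = -1" by (simp add: add_eq_0_iff2)
    then show False using that by simp
  qed
  have ne2: "1 - \<mu> \<noteq> 0" if "Re \<mu> < 1" for \<mu> :: complex using that by auto
  have yac_cay: "yac (cay \<zeta>) = \<zeta>" if "cmod \<zeta> < 1" for \<zeta>
    using ne1[OF that] by (simp add: yac_def cay_def divide_simps)
  have cay_yac: "cay (yac \<mu>) = \<mu>" if "Re \<mu> < 0" for \<mu>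
    using ne2[of \<mu>] that by (simp add: yac_def cay_def divide_simps)
  have norm_yac: "1 - (cmod (yac \<mu>))\<^sup>2 = 4 * (- Re \<mu>) / (cmod (1 - \<mu>))\<^sup>2" if "Re \<mu> < 1" for \<mu>
  proof -
    have "(cmod (1 - \<mu>))\<^sup>2 - (cmod (1 + \<mu>))\<^sup>2 = 4 * (- Re \<mu>)"
      unfolding cmod_power2 by (simp add: power2_eq_square algebra_simps)
    moreover have "(cmod (yac \<mu>))\<^sup>2 = (cmod (1 + \<mu>))\<^sup>2 / (cmod (1 - \<mu>))\<^sup>2"
      by (simp add: yac_def norm_divide power_divide)
    moreover have "(cmod (1 - \<mu>))\<^sup>2 \<noteq> 0" using ne2[OF that] by simp
    ultimately show ?thesis by (metis diff_divide_distrib divide_self)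
  qed
  have yac1: "cmod (yac \<mu>) < 1" if "Re \<mu> < 0" for \<mu>
  proof -
    have "0 < 1 - (cmod (yac \<mu>))\<^sup>2"
    proof -
      have "0 < 4 * (- Re \<mu>) / (cmod (1 - \<mu>))\<^sup>2"
        using ne2[of \<mu>] that by (intro divide_pos_pos) auto
      then show ?thesis using norm_yac[of \<mu>] that by linarith
    qed
    then show ?thesis by (simp add: abs_square_less_1)
  qed
  have cay0: "Re (cay \<zeta>) < 0" if "cmod \<zeta> < 1" for \<zeta>
  proof -
    have "Re (cay \<zeta>) = ((cmod \<zeta>)\<^sup>2 - 1) / (cmod (\<zeta> + 1))\<^sup>2"
      unfolding cay_def Re_divide cmod_power2
      by (rule arg_cong2[of _ _ _ _ "(/)"]) (simp_all add: power2_eq_square algebra_simps)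
    moreover have "(cmod \<zeta>)\<^sup>2 < 1" using that by (simp add: abs_square_less_1)
    ultimately show ?thesis using ne1[OF that] by (simp add: divide_neg_pos)
  qed
  have hol_cay: "cay holomorphic_on ball 0 1"
    unfolding cay_def by (intro holomorphic_intros) (use ne1 in auto)
  have hol_yac1: "(\<lambda>\<mu>. yac (\<mu> - 1)) holomorphic_on {\<mu>. Re \<mu> < 1}"
    unfolding yac_def by (intro holomorphic_intros) auto
  have cayz: "Re (k (\<psi> x) - 1) < 0" if "x \<in> ball 0 1" for x using k(2) \<psi>[OF that] by auto
  \<comment> \<open>The half-plane is sent to a flat disc: \<open>\<beta>\<close> does not increase norms by the Schwarz lemma for \<open>\<beta>\<close>, and does not
    decrease them by the Schwarz lemma for its left inverse. Equality at one point determines \<open>\<beta>\<close>.\<close>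
  define \<beta> where "\<beta> = (\<lambda>\<zeta>. \<phi> (z (cay \<zeta>)))"
  have \<beta>: "\<beta> \<zeta> \<in> ball 0 1" "\<psi> (\<beta> \<zeta>) = z (cay \<zeta>)" if "cmod \<zeta> < 1" for \<zeta>
    using \<phi>[OF zD[OF cay0[OF that]]] by (auto simp: \<beta>_def)
  have \<beta>0: "\<beta> 0 = 0" by (simp add: \<beta>_def cay_def z0 \<phi>00)
  have hol\<beta>: "(\<lambda>\<zeta>. cinner (\<beta> \<zeta>) y) holomorphic_on ball 0 1" for y
  proof -
    have "(\<lambda>\<mu>. cinner (\<phi> (\<xi> + \<mu> *s \<xi>)) y) holomorphic_on {\<mu>. Re \<mu> < 0}"
      using zD by (intro holomorphic_on_slice[OF hol(1) complex_functional_cinner]) (auto simp: z_def)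
    from holomorphic_on_compose_gen[OF hol_cay this] cay0
    show ?thesis by (auto simp: o_def \<beta>_def z_def image_subset_iff)
  qed
  have \<beta>y: "cmod (cinner (\<beta> \<zeta>) y) < 1" if "cmod \<zeta> < 1" "norm y = 1" for \<zeta> y
    using norm_cinner_le[of "\<beta> \<zeta>" y] \<beta>(1)[OF that(1)] that(2) by simp
  have \<beta>_le: "norm (\<beta> \<zeta>) \<le> cmod \<zeta>" if \<zeta>: "cmod \<zeta> < 1" for \<zeta>
  proof (cases "\<beta> \<zeta> = 0")
    case False
    define y where "y = of_real (1 / norm (\<beta> \<zeta>)) *s \<beta> \<zeta>"
    have y: "norm y = 1" using False by (simp add: y_def norm_smult norm_divide)
    have "cmod (cinner (\<beta> \<zeta>) y) \<le> cmod \<zeta>"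
      by (rule Schwarz_Lemma(1)[OF hol\<beta> _ _ \<zeta>]) (use \<beta>0 \<beta>y[OF _ y] in auto)
    moreover have "cinner (\<beta> \<zeta>) y = of_real (1 / norm (\<beta> \<zeta>) * (norm (\<beta> \<zeta>))\<^sup>2)"
      by (simp add: y_def cinner_simps cinner_self)
    then have "cmod (cinner (\<beta> \<zeta>) y) = norm (\<beta> \<zeta>)"
      unfolding norm_of_real by (simp only:) (use False in \<open>simp add: power2_eq_square\<close>)
    ultimately show ?thesis by simp
  qed simp
  have \<beta>_ge: "cmod \<zeta> \<le> norm (\<beta> \<zeta>)" if \<zeta>: "cmod \<zeta> < 1" for \<zeta>
  proof -
    have "cmod (yac (k (\<psi> (\<beta> \<zeta>)) - 1)) \<le> norm (\<beta> \<zeta>)"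
    proof (rule Schwarz_ball_fun[OF hol(2) k(1) hol_yac1 _ _ \<beta>(1)[OF \<zeta>]])
      show "\<And>x. x \<in> ball 0 1 \<Longrightarrow> k (\<psi> x) \<in> {\<mu>. Re \<mu> < 1} \<and> cmod (yac (k (\<psi> x) - 1)) < 1"
        using cayz yac1 by auto
      show "yac (k (\<psi> 0) - 1) = 0" by (simp add: \<psi>00 complex_functional_zero[OF k(1)] yac_def)
    qed
    then show ?thesis by (simp add: \<beta>(2)[OF \<zeta>] kz yac_cay[OF \<zeta>])
  qed
  define u where "u = 2 *s \<beta> (1/2)"
  have u: "norm u = 1" using \<beta>_le[of "1/2"] \<beta>_ge[of "1/2"] by (simp add: u_def norm_smult)
  have uu: "cinner u u = 1" by (simp add: cinner_self u)
  have \<beta>u: "\<beta> \<zeta> = \<zeta> *s u" if \<zeta>: "cmod \<zeta> < 1" for \<zeta>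
  proof -
    have half: "\<beta> (1/2) = (1/2) *s u" by (simp add: u_def vector_smult_assoc)
    then have c2: "cinner (\<beta> (1/2)) u = 1/2" by (simp add: cinner_simps uu)
    have c3: "cmod (cinner (\<beta> (1/2)) u) = cmod (1/2)" by (simp only: c2)
    have "\<exists>\<alpha>. (\<forall>z. norm z < 1 \<longrightarrow> cinner (\<beta> z) u = \<alpha> * z) \<and> norm \<alpha> = 1"
      by (rule Schwarz_Lemma(3)[OF hol\<beta> _ _ \<zeta>])
         (use \<beta>0 \<beta>y[OF _ u] c3 in \<open>auto intro!: exI[of _ "1/2"]\<close>)
    then obtain \<alpha> where \<alpha>: "\<And>z. norm z < 1 \<Longrightarrow> cinner (\<beta> z) u = \<alpha> * z" by blast
    have "\<alpha> = 1" using \<alpha>[of "1/2"] c2 by simp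
    then have c: "cinner (\<beta> \<zeta>) u = \<zeta>" using \<alpha>[OF \<zeta>] by simp
    have "cinner (\<zeta> *s u) (\<beta> \<zeta> - \<zeta> *s u) = \<zeta> * cnj (cinner (\<beta> \<zeta> - \<zeta> *s u) u)"
      by (simp add: cinner_simps cnj_cinner algebra_simps)
    also have "\<dots> = 0" by (simp add: cinner_simps c uu)
    finally have "(norm (\<zeta> *s u + (\<beta> \<zeta> - \<zeta> *s u)))\<^sup>2 = (norm (\<zeta> *s u))\<^sup>2 + (norm (\<beta> \<zeta> - \<zeta> *s u))\<^sup>2"
      by (rule norm_add_orthogonal)
    then have "(norm (\<beta> \<zeta>))\<^sup>2 = (cmod \<zeta>)\<^sup>2 + (norm (\<beta> \<zeta> - \<zeta> *s u))\<^sup>2" by (simp add: norm_smult u)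
    moreover have "(norm (\<beta> \<zeta>))\<^sup>2 \<le> (cmod \<zeta>)\<^sup>2" using \<beta>_le[OF \<zeta>] by (simp add: power_mono)
    ultimately have "(norm (\<beta> \<zeta> - \<zeta> *s u))\<^sup>2 \<le> 0" by linarith
    then show ?thesis by simp
  qed
  have \<phi>z: "\<phi> (z \<mu>) = yac \<mu> *s u" if "Re \<mu> < 0" for \<mu>
    using \<beta>u[OF yac1[OF that]] cay_yac[OF that] by (simp add: \<beta>_def)
  have \<psi>u: "\<psi> (\<zeta> *s u) = z (cay \<zeta>)" if "cmod \<zeta> < 1" for \<zeta>
    using \<beta>(2)[OF that] \<beta>u[OF that] by simp
  define w where "w = (\<lambda>\<mu>. frechet_derivative \<phi> (at (z \<mu>)) v)"
  define s where "s = (\<lambda>\<mu>. sqrt (1 - (cmod (yac \<mu>))\<^sup>2))"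
  have s_eq: "s \<mu> = 2 * sqrt (- Re \<mu>) / cmod (1 - \<mu>)" if "Re \<mu> < 0" for \<mu>
  proof -
    have "s \<mu> = sqrt (2\<^sup>2 * (- Re \<mu>) / (cmod (1 - \<mu>))\<^sup>2)"
      using that norm_yac[of \<mu>] by (simp add: s_def)
    then show ?thesis unfolding real_sqrt_divide real_sqrt_mult by simp
  qed
  have s_pos: "s \<mu> > 0" "(s \<mu>)\<^sup>2 = 1 - (cmod (yac \<mu>))\<^sup>2" if "Re \<mu> < 0" for \<mu>
    using yac1[OF that] abs_square_less_1[of "cmod (yac \<mu>)"] by (auto simp: s_def)
  have deriv\<phi>: "((\<lambda>c. cinner (\<phi> (z \<mu> + c *s v)) e) has_field_derivative cinner (w \<mu>) e) (at 0)"
    if \<mu>: "Re \<mu> < 0" for \<mu> e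
  proof -
    obtain L where L: "(\<phi> has_derivative L) (at (z \<mu>))" "complex_linear_map L"
      using holomorphic_mapE[OF hol(1) zD[OF \<mu>]] .
    have "L = frechet_derivative \<phi> (at (z \<mu>))" by (rule frechet_derivative_at[OF L(1)])
    moreover have "(\<phi> has_derivative L) (at (z \<mu> + 0 *s v))" using L(1) by simp
    note has_field_derivative_slice[OF this L(2) complex_functional_cinner, of e]
    ultimately show ?thesis by (simp add: w_def)
  qed
  define off where "off = (\<lambda>\<mu>. w \<mu> - cinner (w \<mu>) u *s u)"
  have u_off: "cinner u (off \<mu>) = 0" for \<mu>
  proof -
    have "cinner (off \<mu>) u = 0" by (simp add: off_def cinner_simps uu)
    then show ?thesis using cnj_cinner[of "off \<mu>" u] by simp
  qed
  have \<psi>_deriv: "\<exists>M. (\<psi> has_derivative M) (at (yac \<mu> *s u)) \<and> complex_linear_map M \<and> M (w \<mu>) = v"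
    if \<mu>: "Re \<mu> < 0" for \<mu>
  proof -
    obtain L where L: "(\<phi> has_derivative L) (at (z \<mu>))" "complex_linear_map L"
      using holomorphic_mapE[OF hol(1) zD[OF \<mu>]] .
    have Lv: "L v = w \<mu>" unfolding w_def frechet_derivative_at[OF L(1), symmetric] ..
    have "yac \<mu> *s u \<in> ball 0 1" using yac1[OF \<mu>] by (simp add: norm_smult u)
    from holomorphic_mapE[OF hol(2) this] obtain M
      where M: "(\<psi> has_derivative M) (at (yac \<mu> *s u))" "complex_linear_map M" .
    have "((\<lambda>x. \<psi> (\<phi> x)) has_derivative (\<lambda>x. M (L x))) (at (z \<mu>))"
      using has_derivative_compose[OF L(1)] M(1) \<phi>z[OF \<mu>] by simp
    then have "((\<lambda>x. x) has_derivative (\<lambda>x. M (L x))) (at (z \<mu>))"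
      by (rule has_derivative_transform_within_open[OF _ D(1) zD[OF \<mu>]]) (simp add: \<phi>)
    then have "(\<lambda>x. M (L x)) = (\<lambda>x. x)"
      using has_derivative_unique has_derivative_ident by blast
    then have "M (w \<mu>) = v" unfolding Lv[symmetric] by (rule fun_cong)
    then show ?thesis using M by blast
  qed
  \<comment> \<open>Upper bound for the component of the derivative orthogonal to the flat disc.\<close>
  have upper: "R * cmod (cinner (w \<mu>) e) \<le> s \<mu>"
    if \<mu>: "Re \<mu> < 0" and R: "0 < R" "\<And>c. cmod c < R \<Longrightarrow> z \<mu> + c *s v \<in> D"
      and e: "norm e = 1" "cinner u e = 0" for \<mu> R e
  proof -
    define \<zeta> where "\<zeta> = yac \<mu>"
    have \<zeta>: "cmod \<zeta> < 1" using yac1[OF \<mu>] by (simp add: \<zeta>_def)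
    define N where "N = (\<lambda>c. cinner (\<phi> (z \<mu> + c *s v)) e)"
    define G where "G = (\<lambda>c. 1 - cnj \<zeta> * cinner (\<phi> (z \<mu> + c *s v)) u)"
    define h where "h = (\<lambda>c. of_real (s \<mu>) * N c / G c)"
    have bd: "s \<mu> * cmod (N c) < cmod (G c)" if "cmod c < R" for c
      unfolding N_def G_def s_def \<zeta>_def[symmetric]
      by (rule disc_Bessel_bound[OF u e _ \<zeta>]) (use \<phi>[OF R(2)[OF that]] in simp)
    have Gnz: "G c \<noteq> 0" if "cmod c < R" for c
    proof
      assume "G c = 0"
      then have "s \<mu> * cmod (N c) < 0" using bd[OF that] by simp
      then show False using s_pos(1)[OF \<mu>] by (simp add: mult_less_0_iff)
    qed
    have sl: "(\<lambda>c. cinner (\<phi> (z \<mu> + c *s v)) y) holomorphic_on ball 0 R" for y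
      using R(2) by (intro holomorphic_on_slice[OF hol(1) complex_functional_cinner]) auto
    have hh: "h holomorphic_on ball 0 R"
      unfolding h_def using Gnz sl[of e] sl[of u] unfolding N_def G_def
      by (intro holomorphic_intros) auto
    have lt: "cmod (h c) < 1" if "c \<in> ball 0 R" for c
      using bd[of c] Gnz[of c] that s_pos(1)[OF \<mu>]
      by (simp add: h_def norm_divide norm_mult)
    have ue: "cinner u e = 0" by fact
    have N0: "N 0 = 0" by (simp add: N_def \<phi>z[OF \<mu>] cinner_simps ue)
    have G0: "G 0 = of_real ((s \<mu>)\<^sup>2)"
      unfolding s_pos(2)[OF \<mu>] of_real_diff complex_norm_square
      by (simp add: G_def \<phi>z[OF \<mu>] cinner_simps uu \<zeta>_def mult.commute)
    have G00: "G 0 \<noteq> 0" using Gnz[of 0] R(1) by simp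
    have "(N has_field_derivative cinner (w \<mu>) e) (at 0)" unfolding N_def by (rule deriv\<phi>[OF \<mu>])
    moreover have "(G has_field_derivative - (cnj \<zeta> * cinner (w \<mu>) u)) (at 0)"
      unfolding G_def using deriv\<phi>[OF \<mu>, of u] by (auto intro!: derivative_eq_intros)
    ultimately have "(h has_field_derivative of_real (s \<mu>) * cinner (w \<mu>) e / G 0) (at 0)"
      unfolding h_def using G00 N0 by (auto intro!: derivative_eq_intros simp: divide_simps)
    from Schwarz_derivative_zero[OF hh lt _ this R(1)]
    have "R * cmod (of_real (s \<mu>) * cinner (w \<mu>) e / G 0) \<le> 1" by (simp add: h_def N0)
    then have "R * (s \<mu> * cmod (cinner (w \<mu>) e) / (s \<mu>)\<^sup>2) \<le> 1"
      unfolding G0 using s_pos(1)[OF \<mu>] by (simp add: norm_divide norm_mult norm_power)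
    then show ?thesis using s_pos(1)[OF \<mu>] by (simp add: power2_eq_square field_simps)
  qed
  obtain R1 where R1: "0 < R1" "\<And>c. cmod c < R1 \<Longrightarrow> c *s v \<in> D"
  proof -
    have "open ((\<lambda>c. c *s v) -` D)"
      using D(1) linear_continuous_on[OF bounded_linear_smult_left] by (intro open_vimage)
    moreover have "0 \<in> (\<lambda>c. c *s v) -` D" using D0 by simp
    ultimately obtain r where "r > 0" "ball 0 r \<subseteq> (\<lambda>c. c *s v) -` D"
      using open_contains_ball by blast
    then show ?thesis by (intro that[of r]) (auto simp: subset_iff)
  qed
  have R1': "z \<mu> + c *s v \<in> D" if "Re \<mu> \<le> -1" "cmod c < R1" for \<mu> c
  proof -
    have "c *s v + (1 + \<mu>) *s \<xi> \<in> D"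
      using that by (intro translate_left_halfplane[OF D half R1(2)]) auto
    then show ?thesis by (simp add: z_alt add.commute)
  qed
  have hol_w: "(\<lambda>\<mu>. cinner (w \<mu>) e) holomorphic_on {\<mu>. Re \<mu> < 0}" for e
    unfolding w_def z_def using zD
    by (intro holomorphic_on_directional_derivative[OF hol(1) D(1) complex_functional_cinner])
       (auto simp: z_def open_halfspace_Re_lt)
  have PL: "cmod (1 - \<mu>) * cmod (cinner (w \<mu>) e) \<le> 2 / R1"
    if e: "norm e = 1" "cinner u e = 0" and \<mu>: "Re \<mu> \<le> -1" for e \<mu>
  proof -
    define a where "a = (\<lambda>\<mu>. (1 - \<mu>) * cinner (w \<mu>) e)"
    have "a holomorphic_on {\<mu>. Re \<mu> < 0}"
      unfolding a_def by (intro holomorphic_intros hol_w)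
    moreover have "cmod (a \<mu>) \<le> 2 / R1 * sqrt (- Re \<mu>)" if "Re \<mu> \<le> -1" for \<mu>
    proof -
      have "R1 * cmod (cinner (w \<mu>) e) \<le> 2 * sqrt (- Re \<mu>) / cmod (1 - \<mu>)"
        using upper[OF _ R1(1) R1'[OF that] e] s_eq[of \<mu>] that by simp
      moreover have "0 < cmod (1 - \<mu>)" using ne2[of \<mu>] that by simp
      ultimately show ?thesis using R1(1) unfolding a_def norm_mult by (simp add: field_simps)
    qed
    ultimately have "cmod (a \<mu>) \<le> 2 / R1" using \<mu>
      by (rule halfplane_Phragmen_Lindeloef)
    then show ?thesis by (simp add: a_def norm_mult)
  qed
  \<comment> \<open>The functional \<open>k\<close>, transported to the disc, restricts to the identity on the flat disc and
    annihilates \<open>w \<mu>\<close>; its derivative in orthogonal directions is small by the Schwarz-Pick lemma.\<close>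
  have lower: "cmod (cinner (w \<mu>) u) \<le> s \<mu> * norm (off \<mu>)" if \<mu>: "Re \<mu> < 0" for \<mu>
  proof -
    define \<zeta> where "\<zeta> = yac \<mu>"
    have \<zeta>: "cmod \<zeta> < 1" using yac1[OF \<mu>] by (simp add: \<zeta>_def)
    define p where "p = cinner (w \<mu>) u"
    define w' where "w' = off \<mu>"
    have w'_eq: "w' = w \<mu> - p *s u" by (simp add: w'_def off_def p_def)
    have uw': "cinner u w' = 0" unfolding w'_def by (rule u_off)
    obtain M where M: "(\<psi> has_derivative M) (at (\<zeta> *s u))" "complex_linear_map M" and Mw: "M (w \<mu>) = v"
      using \<psi>_deriv[OF \<mu>] unfolding \<zeta>_def by blast
    have kMu: "k (M u) = 2 / (\<zeta> + 1)\<^sup>2"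
    proof -
      have "(\<psi> has_derivative M) (at (0 + \<zeta> *s u))" using M(1) by simp
      from has_field_derivative_slice[OF this M(2) k(1)]
      have "((\<lambda>c. k (\<psi> (c *s u))) has_field_derivative k (M u)) (at \<zeta>)" by simp
      moreover have "((\<lambda>c. k (\<psi> (c *s u))) has_field_derivative 2 / (\<zeta> + 1)\<^sup>2) (at \<zeta>)"
      proof (rule has_field_derivative_transform_within_open[of "\<lambda>c. cay c + 1" _ _ "ball 0 1"])
        show "((\<lambda>c. cay c + 1) has_field_derivative 2 / (\<zeta> + 1)\<^sup>2) (at \<zeta>)"
          unfolding cay_def using ne1[OF \<zeta>]
          by (auto intro!: derivative_eq_intros simp: power2_eq_square)
        show "cay c + 1 = k (\<psi> (c *s u))" if "c \<in> ball 0 1" for c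
          using that kz[of "cay c"] by (simp add: \<psi>u algebra_simps)
      qed (use \<zeta> in auto)
      ultimately show ?thesis by (rule DERIV_unique)
    qed
    have kMw': "k (M w') = - p * k (M u)"
      unfolding w'_eq complex_linear_map_diff[OF M(2)] complex_linear_map_smult[OF M(2)]
        complex_functional_diff[OF k(1)] complex_functional_smult[OF k(1)] Mw k(4) by simp
    have nz: "\<zeta> + 1 \<noteq> 0" by (rule ne1[OF \<zeta>])
    show ?thesis
    proof (cases "w' = 0")
      case True
      then have "p * k (M u) = 0"
        using kMw' by (simp add: complex_linear_map_zero[OF M(2)] complex_functional_zero[OF k(1)])
      then have "p = 0" using kMu nz by simp
      then show ?thesis using s_pos(1)[OF \<mu>] by (simp add: p_def[symmetric])
    next
      case False
      define R where "R = s \<mu> / norm w'"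
      have R: "0 < R" using False s_pos(1)[OF \<mu>] by (simp add: R_def)
      have inB: "\<zeta> *s u + c *s w' \<in> ball 0 1" if c: "cmod c < R" for c
      proof -
        have "cmod c * norm w' < s \<mu>" using c False by (simp add: R_def pos_less_divide_eq)
        then have "(cmod c * norm w')\<^sup>2 < (s \<mu>)\<^sup>2"
          by (intro power_strict_mono) auto
        then have "(cmod \<zeta>)\<^sup>2 + (cmod c * norm w')\<^sup>2 < 1"
          using s_pos(2)[OF \<mu>] by (simp add: \<zeta>_def)
        moreover have "(norm (\<zeta> *s u + c *s w'))\<^sup>2 = (cmod \<zeta>)\<^sup>2 + (cmod c * norm w')\<^sup>2"
          using norm_add_orthogonal[of "\<zeta> *s u" "c *s w'"]
          by (simp add: cinner_simps uw' norm_smult u)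
        ultimately show ?thesis using abs_square_less_1[of "norm (\<zeta> *s u + c *s w')"] by simp
      qed
      define g where "g = (\<lambda>c. yac (k (\<psi> (\<zeta> *s u + c *s w')) - 1))"
      have ksl: "(\<lambda>c. k (\<psi> (\<zeta> *s u + c *s w'))) holomorphic_on ball 0 R"
        using inB by (intro holomorphic_on_slice[OF hol(2) k(1)]) auto
      have "((\<lambda>\<mu>. yac (\<mu> - 1)) \<circ> (\<lambda>c. k (\<psi> (\<zeta> *s u + c *s w')))) holomorphic_on ball 0 R"
        by (rule holomorphic_on_compose_gen[OF ksl hol_yac1]) (use cayz inB in force)
      then have "g holomorphic_on ball 0 R" by (simp add: g_def o_def)
      moreover have "cmod (g c) < 1" if "c \<in> ball 0 R" for c
        unfolding g_def using that by (intro yac1 cayz inB) simp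
      moreover have "(g has_field_derivative - p) (at 0)"
      proof -
        have "(\<psi> has_derivative M) (at (\<zeta> *s u + 0 *s w'))" using M(1) by simp
        from has_field_derivative_slice[OF this M(2) k(1)]
        have 1: "((\<lambda>c. k (\<psi> (\<zeta> *s u + c *s w')) - 1) has_field_derivative k (M w')) (at 0)"
          by (auto intro!: derivative_eq_intros)
        have val: "k (\<psi> (\<zeta> *s u + 0 *s w')) - 1 = \<mu>"
          using \<psi>u[OF \<zeta>] cay_yac[OF \<mu>] by (simp add: kz \<zeta>_def)
        have "1 - \<mu> \<noteq> 0" using ne2[of \<mu>] \<mu> by simp
        then have "(yac has_field_derivative 2 / (1 - \<mu>)\<^sup>2) (at \<mu>)"
          unfolding yac_def by (auto intro!: derivative_eq_intros simp: power2_eq_square)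
        then have "(g has_field_derivative 2 / (1 - \<mu>)\<^sup>2 * k (M w')) (at 0)"
          unfolding g_def using 1 val by (intro DERIV_chain2) auto
        moreover have "2 / (1 - \<mu>)\<^sup>2 * k (M w') = - p"
        proof -
          have "(\<zeta> + 1) * (1 - \<mu>) = 2" using \<open>1 - \<mu> \<noteq> 0\<close> by (simp add: \<zeta>_def yac_def field_simps)
          then have "(\<zeta> + 1)\<^sup>2 * (1 - \<mu>)\<^sup>2 = 4" by (metis power_mult_distrib power2_eq_square num_double numeral_times_numeral)
          then show ?thesis unfolding kMw' kMu using nz \<open>1 - \<mu> \<noteq> 0\<close>
            by (simp add: divide_simps) (simp add: algebra_simps)
        qed
        ultimately show ?thesis by simp
      qed
      ultimately have "R * cmod (- p) \<le> 1 - (cmod (g 0))\<^sup>2"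
        using R by (rule Schwarz_Pick_derivative)
      moreover have "g 0 = \<zeta>" using \<psi>u[OF \<zeta>] by (simp add: g_def kz yac_cay[OF \<zeta>])
      ultimately have "R * cmod p \<le> (s \<mu>)\<^sup>2" using s_pos(2)[OF \<mu>] by (simp add: \<zeta>_def)
      then have "cmod p \<le> s \<mu> * norm w'"
        using False s_pos(1)[OF \<mu>] by (simp add: R_def field_simps power2_eq_square)
      then show ?thesis by (simp add: p_def w'_def)
    qed
  qed
  show ?thesis
  proof (rule that[of "R1 / 6"])
    show "0 < R1 / 6" using R1(1) by simp
    fix T :: real and c assume T: "1 \<le> T" and c: "cmod c < R1 / 6 * sqrt T"
    define \<mu> where "\<mu> = complex_of_real (- T)"
    have \<mu>: "Re \<mu> < 0" "Re \<mu> \<le> -1" using T by (auto simp: \<mu>_def)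
    define \<zeta> where "\<zeta> = yac \<mu>"
    have \<zeta>: "cmod \<zeta> < 1" using yac1[OF \<mu>(1)] by (simp add: \<zeta>_def)
    define p where "p = cinner (w \<mu>) u"
    define w' where "w' = off \<mu>"
    have w'_eq: "w' = w \<mu> - p *s u" by (simp add: w'_def off_def p_def)
    have uw': "cinner u w' = 0" unfolding w'_def by (rule u_off)
    have c1: "cmod (1 - \<mu>) = 1 + T"
    proof -
      have "1 - \<mu> = of_real (1 + T)" by (simp add: \<mu>_def)
      then have "cmod (1 - \<mu>) = \<bar>1 + T\<bar>" by (simp only: norm_of_real)
      then show ?thesis using T by simp
    qed
    have sT: "s \<mu> = 2 * sqrt T / (1 + T)" using s_eq[OF \<mu>(1)] c1 by (simp add: \<mu>_def)
    have w'_le: "(1 + T) * norm w' \<le> 2 / R1"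
    proof (cases "w' = 0")
      case False
      define e where "e = of_real (1 / norm w') *s w'"
      have e: "norm e = 1" "cinner u e = 0"
        using False uw' by (simp_all add: e_def norm_smult norm_divide cinner_simps)
      have "cinner (w \<mu>) e = cinner (p *s u + w') e" by (simp add: w'_eq)
      also have "\<dots> = cinner w' e" by (simp add: cinner_simps e)
      also have "\<dots> = of_real (1 / norm w' * (norm w')\<^sup>2)" by (simp add: e_def cinner_simps cinner_self)
      also have "1 / norm w' * (norm w')\<^sup>2 = norm w'" using False by (simp add: power2_eq_square)
      finally have "cmod (cinner (w \<mu>) e) = norm w'" by simp
      then show ?thesis using PL[OF e \<mu>(2)] by (simp add: c1)
    qed (use R1(1) in simp)
    \<comment> \<open>With a third of the admissible radius, both components of the displacement stay
    within the ball; convexity costs another factor of \<open>2\<close>.\<close>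
    define \<rho> where "\<rho> = R1 / 3 * sqrt T"
    have \<rho>: "0 < \<rho>" using R1(1) T by (simp add: \<rho>_def)
    have s0: "0 < s \<mu>" by (rule s_pos(1)[OF \<mu>(1)])
    have inB: "\<zeta> *s u + c *s w \<mu> \<in> ball 0 1" if c: "cmod c < \<rho>" for c
    proof -
      have "cmod c * norm w' \<le> \<rho> * (2 / R1 / (1 + T))"
      proof (intro mult_mono)
        show "norm w' \<le> 2 / R1 / (1 + T)"
          using w'_le T by (simp only: pos_le_divide_eq mult.commute)
      qed (use c \<rho> in auto)
      also have "\<dots> = s \<mu> / 3" using R1(1) by (simp add: \<rho>_def sT mult.commute)
      finally have cw: "cmod c * norm w' \<le> s \<mu> / 3" .
      have "cmod c * cmod p \<le> cmod c * (s \<mu> * norm w')"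
        using lower[OF \<mu>(1)] by (intro mult_left_mono) (auto simp: p_def w'_def)
      also have "\<dots> = s \<mu> * (cmod c * norm w')" by simp
      also have "\<dots> \<le> s \<mu> * (s \<mu> / 3)" using cw s0 by (intro mult_left_mono) auto
      finally have cp: "cmod c * cmod p \<le> (s \<mu>)\<^sup>2 / 3" by (simp add: power2_eq_square)
      define \<sigma> where "\<sigma> = (s \<mu>)\<^sup>2"
      have \<sigma>: "0 < \<sigma>" "\<sigma> \<le> 1" "(cmod \<zeta>)\<^sup>2 = 1 - \<sigma>"
        using s0 s_pos(2)[OF \<mu>(1)] \<zeta> abs_square_less_1[of "cmod \<zeta>"]
        by (auto simp: \<sigma>_def \<zeta>_def)
      have "cmod (\<zeta> + c * p) \<le> cmod \<zeta> + \<sigma> / 3"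
        using norm_triangle_ineq[of \<zeta> "c * p"] cp by (simp add: norm_mult \<sigma>_def)
      then have "(cmod (\<zeta> + c * p))\<^sup>2 \<le> (cmod \<zeta> + \<sigma> / 3)\<^sup>2" by (rule power_mono) simp
      also have "\<dots> = 1 - \<sigma> + 2 * \<sigma> / 3 * cmod \<zeta> + \<sigma> * \<sigma> / 9"
        using \<sigma>(3) by (simp add: power2_eq_square algebra_simps)
      also have "\<dots> \<le> 1 - \<sigma> + 2 * \<sigma> / 3 * 1 + \<sigma> * 1 / 9"
        using \<sigma> \<zeta> by (intro add_mono mult_left_mono divide_right_mono) auto
      finally have 1: "(cmod (\<zeta> + c * p))\<^sup>2 \<le> 1 - 2 * \<sigma> / 9" by simp
      have "(cmod c * norm w')\<^sup>2 \<le> (s \<mu> / 3)\<^sup>2" using cw by (rule power_mono) simp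
      also have "\<dots> = \<sigma> / 9" by (simp add: \<sigma>_def power2_eq_square)
      finally have 2: "(cmod c * norm w')\<^sup>2 \<le> \<sigma> / 9" .
      have "\<zeta> *s u + c *s w \<mu> = (\<zeta> + c * p) *s u + c *s w'"
        by (simp add: w'_eq vec_eq_iff algebra_simps)
      moreover have "(norm ((\<zeta> + c * p) *s u + c *s w'))\<^sup>2 = (cmod (\<zeta> + c * p))\<^sup>2 + (cmod c * norm w')\<^sup>2"
        using norm_add_orthogonal[of "(\<zeta> + c * p) *s u" "c *s w'"]
        unfolding norm_smult u by (simp add: cinner_simps uw')
      ultimately have "(norm (\<zeta> *s u + c *s w \<mu>))\<^sup>2 = (cmod (\<zeta> + c * p))\<^sup>2 + (cmod c * norm w')\<^sup>2"
        by (simp only:)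
      then have "(norm (\<zeta> *s u + c *s w \<mu>))\<^sup>2 < 1" using 1 2 \<sigma>(1) by linarith
      then show ?thesis using abs_square_less_1[of "norm (\<zeta> *s u + c *s w \<mu>)"] by simp
    qed
    obtain M where M: "(\<psi> has_derivative M) (at (\<zeta> *s u))" "complex_linear_map M" and Mw: "M (w \<mu>) = v"
      using \<psi>_deriv[OF \<mu>(1)] unfolding \<zeta>_def by blast
    have "\<psi> (\<zeta> *s u) + c *s M (w \<mu>) \<in> D"
      by (rule convex_affine_disc[OF D hol(2) _ M \<rho>])
         (use inB \<psi> c in \<open>auto simp: \<rho>_def\<close>)
    moreover have "\<psi> (\<zeta> *s u) = of_real (1 - T) *s \<xi>"
      using \<psi>u[OF \<zeta>] cay_yac[OF \<mu>(1)] by (simp add: \<zeta>_def z_alt \<mu>_def)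
    ultimately show "of_real (1 - T) *s \<xi> + c *s v \<in> D" by (simp add: Mw)
  qed
qed


section \<open>Bases of maximal determinant\<close>

lemma norm_le_sum_components: "norm (x :: 'a::real_normed_vector ^ 'n) \<le> (\<Sum>i\<in>UNIV. norm (x $ i))"
  by (simp add: norm_vec_def L2_set_le_sum)

lemma norm_axis: "norm (axis j c :: complex ^ 'd) = cmod c"
proof -
  have "(\<Sum>i\<in>UNIV. (norm ((axis j c :: complex ^ 'd) $ i))\<^sup>2) = (\<Sum>i\<in>UNIV. if i = j then (cmod c)\<^sup>2 else 0)"
    by (intro sum.cong) (auto simp: axis_def)
  then show ?thesis by (simp add: norm_vec_def L2_set_def)
qed

lemma matrix_vector_mult_axis: "(M :: complex ^ 'd ^ 'd) *v axis j 1 = column j M"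
proof -
  have "(\<Sum>k\<in>UNIV. M $ i $ k * (axis j 1 :: complex ^ 'd) $ k) = (\<Sum>k\<in>UNIV. if k = j then M $ i $ k else 0)" for i
    by (intro sum.cong) (auto simp: axis_def)
  then show ?thesis by (simp add: vec_eq_iff matrix_vector_mult_def column_def)
qed

lemma compact_matrices_with_columns:
  assumes "compact (S :: (complex ^ 'd) set)"
  shows "compact {M :: complex ^ 'd ^ 'd. \<forall>j. column j M \<in> S}"
proof -
  have "continuous_on UNIV (\<lambda>M :: complex ^ 'd ^ 'd. column j M)" for j
    unfolding column_def by (intro continuous_intros)
  then have "closed ((\<lambda>M :: complex ^ 'd ^ 'd. column j M) -` S)" for j
    using compact_imp_closed[OF assms] by (intro closed_vimage)
  then have "closed (\<Inter>j. (\<lambda>M :: complex ^ 'd ^ 'd. column j M) -` S)" by blast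
  moreover have "(\<Inter>j. (\<lambda>M :: complex ^ 'd ^ 'd. column j M) -` S) = {M. \<forall>j. column j M \<in> S}" by auto
  moreover have "bounded {M :: complex ^ 'd ^ 'd. \<forall>j. column j M \<in> S}"
  proof -
    obtain b where b: "\<And>x. x \<in> S \<Longrightarrow> norm x \<le> b" using compact_imp_bounded[OF assms] bounded_iff by blast
    have "norm M \<le> (\<Sum>i\<in>(UNIV :: 'd set). \<Sum>j\<in>(UNIV :: 'd set). b)"
      if M: "\<forall>j. column j M \<in> S" for M :: "complex ^ 'd ^ 'd"
    proof -
      have "norm (M $ i $ j) \<le> b" for i j
        using Finite_Cartesian_Product.norm_nth_le[of "column j M" i] b[of "column j M"] M by (simp add: column_def)
      then have "norm (M $ i) \<le> (\<Sum>j\<in>(UNIV :: 'd set). b)" for i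
        using norm_le_sum_components[of "M $ i"] by (meson order_trans sum_mono)
      then show ?thesis using norm_le_sum_components[of M] by (meson order_trans sum_mono)
    qed
    then show ?thesis unfolding bounded_iff by blast
  qed
  ultimately show ?thesis by (simp add: compact_eq_bounded_closed)
qed

lemma continuous_on_det: "continuous_on S (det :: complex ^ 'd ^ 'd \<Rightarrow> complex)"
  unfolding det_def by (intro continuous_intros)

text \<open>By Cramer's rule the coordinates of a vector \<open>x\<close> in a basis from \<open>S\<close> are quotients of determinants of vectors from \<open>S\<close>; so they
  are bounded by \<open>1\<close> if the determinant of the basis is maximal.\<close>

lemma max_det_basis:
  fixes S :: "(complex ^ 'd) set"
  assumes "compact S" "0 < r" "ball 0 r \<subseteq> S"
  obtains A B where "complex_linear_map A" "complex_linear_map B"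
    and "\<And>x. A (B x) = x" "\<And>x. B (A x) = x"
    and "\<And>j. B (axis j 1) \<in> S" "\<And>x j. x \<in> S \<Longrightarrow> cmod (A x $ j) \<le> 1"
proof -
  define K where "K = {M :: complex ^ 'd ^ 'd. \<forall>j. column j M \<in> S}"
  define M0 where "M0 = (\<chi> i j. if i = j then of_real (r / 2) else 0 :: complex ^ 'd ^ 'd)"
  have "column j M0 = axis j (of_real (r / 2))" for j
    by (auto simp: column_def M0_def axis_def vec_eq_iff)
  then have "M0 \<in> K" using assms(2,3) by (auto simp: K_def subset_iff norm_axis)
  have "det M0 = (\<Prod>i\<in>(UNIV :: 'd set). M0 $ i $ i)" by (intro det_diagonal) (simp add: M0_def)
  then have "det M0 \<noteq> 0" using assms(2) by (simp add: M0_def)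
  have "compact K" unfolding K_def by (rule compact_matrices_with_columns[OF assms(1)])
  moreover have "continuous_on K (\<lambda>M. cmod (det M))" by (intro continuous_intros continuous_on_det)
  ultimately obtain M where M: "M \<in> K" "\<And>M'. M' \<in> K \<Longrightarrow> cmod (det M') \<le> cmod (det M)"
    using continuous_attains_sup[of K] \<open>M0 \<in> K\<close> by blast
  have d: "0 < cmod (det M)" using M(2)[OF \<open>M0 \<in> K\<close>] \<open>det M0 \<noteq> 0\<close> by (meson zero_less_norm_iff less_le_trans)
  then obtain N where N: "M ** N = mat 1" "N ** M = mat 1"
    using invertible_det_nz[of M] unfolding invertible_def by auto
  have lin: "complex_linear_map ((*v) X)" for X :: "complex ^ 'd ^ 'd"
    unfolding complex_linear_map_def
    by (auto intro!: linearI simp: matrix_vector_right_distrib vector_scalar_commute scaleR_eq_smult)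
  show ?thesis
  proof (rule that[of "(*v) N" "(*v) M"])
    show "N *v (M *v x) = x" "M *v (N *v x) = x" for x
      by (simp_all add: matrix_vector_mul_assoc N)
    show "M *v axis j 1 \<in> S" for j
      using M(1) by (simp add: K_def matrix_vector_mult_axis)
    show "cmod ((N *v x) $ k) \<le> 1" if x: "x \<in> S" for x k
    proof -
      define M' where "M' = (\<chi> i j. if j = k then (M *v (N *v x)) $ i else M $ i $ j :: complex ^ 'd ^ 'd)"
      have "column j M' = (if j = k then x else column j M)" for j
        by (simp add: M'_def column_def vec_eq_iff matrix_vector_mul_assoc N)
      then have "M' \<in> K" using M(1) x by (auto simp: K_def)
      then have "cmod (det M') \<le> cmod (det M)" by (rule M(2))
      moreover have "det M' = (N *v x) $ k * det M" unfolding M'_def by (rule cramer_lemma)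
      ultimately show ?thesis using d by (simp add: norm_mult)
    qed
  qed (rule lin)+
qed

lemma basis_expansion_map:
  assumes "complex_linear_map B" shows "B y = (\<Sum>j\<in>UNIV. (y $ j) *s B (axis j 1))"
proof -
  have "B y = B (\<Sum>j\<in>UNIV. (y $ j) *s axis j 1)" by (simp add: basis_expansion)
  also have "\<dots> = (\<Sum>j\<in>UNIV. (y $ j) *s B (axis j 1))"
    by (simp add: linear_sum[OF complex_linear_map_linear[OF assms]] complex_linear_map_smult[OF assms])
  finally show ?thesis .
qed

text \<open>Every bounded convex domain with a marked point looks, after an affine change of coordinates,
  like one of bounded geometry: it contains the unit ball around the marked point, and the complex
  discs centred at the marked point have bounded radius. The coordinates are those of a basis of
  maximal determinant from the closure of the largest circled subset around that point. The factor
  \<open>2 * d\<close> below consists of \<open>d\<close>, to compare the convex hull of the basis with the ball, and \<open>2\<close>, to pass from the closure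
  to the interior.\<close>

lemma affine_normalization:
  fixes \<Omega> :: "(complex ^ 'd) set"
  assumes "open \<Omega>" "convex \<Omega>" "bounded \<Omega>" "z \<in> \<Omega>"
  obtains A B where "complex_linear_map A" "complex_linear_map B"
    and "\<And>x. A (B x) = x" "\<And>x. B (A x) = x"
    and "\<And>y. norm y < 1 \<Longrightarrow> z + B y \<in> \<Omega>"
    and "\<And>y. (\<And>c. cmod c \<le> 1 \<Longrightarrow> z + c *s B y \<in> \<Omega>) \<Longrightarrow> norm y \<le> 2 * (real CARD('d))\<^sup>2"
proof -
  define S where "S = {y. \<forall>c. cmod c \<le> 1 \<longrightarrow> z + c *s y \<in> \<Omega>}"
  obtain r where r: "0 < r" "ball z r \<subseteq> \<Omega>"
    using open_contains_ball_eq[OF assms(1)] assms(4) by blast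
  have "ball 0 r \<subseteq> S"
  proof
    fix y :: "complex ^ 'd" assume y: "y \<in> ball 0 r"
    have "z + c *s y \<in> ball z r" if "cmod c \<le> 1" for c
      using y mult_right_mono[OF that, of "norm y"] by (simp add: dist_norm norm_smult)
    then show "y \<in> S" using r(2) by (auto simp: S_def)
  qed
  then have sub: "ball 0 r \<subseteq> closure S" using closure_subset by blast
  have "S \<subseteq> (\<lambda>x. x - z) ` \<Omega>"
  proof
    fix y assume "y \<in> S"
    then have "\<forall>c. cmod c \<le> 1 \<longrightarrow> z + c *s y \<in> \<Omega>" by (simp add: S_def)
    then have "z + 1 *s y \<in> \<Omega>" by (metis norm_one order_refl)
    then show "y \<in> (\<lambda>x. x - z) ` \<Omega>" by (intro image_eqI[of _ _ "z + 1 *s y"]) auto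
  qed
  moreover have "bounded ((\<lambda>x. x - z) ` \<Omega>)" using assms(3) by (rule bounded_translation_minus)
  ultimately have "bounded S" using bounded_subset by blast
  then have "compact (closure S)" by simp
  from max_det_basis[OF this r(1) sub] obtain A B
    where lin: "complex_linear_map A" "complex_linear_map B"
      and inv: "\<And>x. A (B x) = x" "\<And>x. B (A x) = x"
      and B: "\<And>j. B (axis j 1) \<in> closure S"
      and A: "\<And>x j. x \<in> closure S \<Longrightarrow> cmod (A x $ j) \<le> 1" by blast
  define d where "d = real CARD('d)"
  have d: "1 \<le> d" unfolding d_def by (simp add: Suc_leI)
  have cl: "z + c *s y \<in> closure \<Omega>" if y: "y \<in> closure S" and c: "cmod c \<le> 1" for c y
  proof -
    have "continuous_on (closure S) (\<lambda>y. z + c *s y)" by (intro continuous_intros)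
    moreover have "(\<lambda>y. z + c *s y) ` S \<subseteq> closure \<Omega>" using c closure_subset[of \<Omega>] by (auto simp: S_def)
    ultimately have "(\<lambda>y. z + c *s y) ` closure S \<subseteq> closure \<Omega>" by (rule image_closure_subset[OF _ closed_closure])
    then show ?thesis using y by auto
  qed
  have lin2: "complex_linear_map (\<lambda>x. of_real t *s L x)" if "complex_linear_map L" for L t
    unfolding complex_linear_map_def
    by (auto intro!: linearI simp: complex_linear_map_add[OF that] complex_linear_map_smult[OF that]
        scaleR_eq_smult vector_add_ldistrib vector_smult_assoc mult_ac)
  show ?thesis
  proof (rule that[of "\<lambda>x. of_real (2 * d) *s A x" "\<lambda>x. of_real (1 / (2 * d)) *s B x"])
    have dd: "complex_of_real (2 * d) * of_real (1 / (2 * d)) = 1"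
      using d by (simp only: of_real_mult[symmetric]) simp
    show "of_real (2 * d) *s A (of_real (1 / (2 * d)) *s B x) = x"
      and "of_real (1 / (2 * d)) *s B (of_real (2 * d) *s A x) = x" for x
      unfolding complex_linear_map_smult[OF lin(1)] complex_linear_map_smult[OF lin(2)] inv
        vector_smult_assoc using dd by (simp_all only: mult.commute vector_smult_lid)
    show "z + of_real (1 / (2 * d)) *s B y \<in> \<Omega>" if y: "norm y < 1" for y
    proof -
      have "cmod (y $ j) \<le> 1" for j using Finite_Cartesian_Product.norm_nth_le[of y j] y by simp
      then have "z + (y $ j) *s B (axis j 1) \<in> closure \<Omega>" for j using cl[OF B] by blast
      then have "(\<Sum>j\<in>(UNIV :: 'd set). (1 / d) *\<^sub>R (z + (y $ j) *s B (axis j 1))) \<in> closure \<Omega>"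
        using d by (intro convex_sum convex_closure assms(2)) (auto simp: d_def)
      also have "(\<Sum>j\<in>(UNIV :: 'd set). (1 / d) *\<^sub>R (z + (y $ j) *s B (axis j 1)))
          = z + (1 / d) *\<^sub>R B y"
        unfolding basis_expansion_map[OF lin(2), of y]
        by (simp add: scaleR_add_right sum.distrib scaleR_sum_right d_def sum_constant_scaleR del: sum_constant)
      finally have "z + (1 / d) *\<^sub>R B y \<in> closure \<Omega>" .
      from mem_interior_closure_convex_shrink[OF assms(2) _ this, of z "1/2"] assms(1,4)
      have "z + (1 / d) *\<^sub>R B y - (1/2) *\<^sub>R (z + (1 / d) *\<^sub>R B y - z) \<in> \<Omega>"
        by (simp add: interior_open)
      moreover have "z + (1 / d) *\<^sub>R B y - (1/2) *\<^sub>R (z + (1 / d) *\<^sub>R B y - z)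
          = z + (1 / (2 * d)) *\<^sub>R B y"
        by (simp add: algebra_simps flip: scaleR_left_distrib)
      ultimately show ?thesis by (simp only: scaleR_eq_smult)
    qed
    show "norm y \<le> 2 * (real CARD('d))\<^sup>2"
      if y: "\<And>c. cmod c \<le> 1 \<Longrightarrow> z + c *s (of_real (1 / (2 * d)) *s B y) \<in> \<Omega>" for y
    proof -
      have "of_real (1 / (2 * d)) *s B y \<in> S" using y by (simp add: S_def)
      then have "of_real (1 / (2 * d)) *s B y \<in> closure S" using closure_subset by blast
      from A[OF this] have "cmod (of_real (1 / (2 * d)) * y $ j) \<le> 1" for j
        unfolding complex_linear_map_smult[OF lin(1)] inv by simp
      then have "cmod (y $ j) \<le> 2 * d" for j using d unfolding norm_mult norm_of_real by (simp add: divide_simps)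
      then have "norm y \<le> (\<Sum>j\<in>(UNIV :: 'd set). 2 * d)"
        using norm_le_sum_components[of y] by (meson order_trans sum_mono)
      then show ?thesis by (simp add: d_def power2_eq_square)
    qed
  qed (intro lin2 lin)+
qed

text \<open>For the unit ball of a Hermitian norm, a basis of maximal determinant is orthonormal:
  subtracting from one vector its component along another keeps the determinant and shortens it.\<close>

lemma hermitian_diagonalization:
  fixes h :: "complex ^ 'd \<Rightarrow> complex ^ 'd \<Rightarrow> complex"
  assumes add: "\<And>x y z. h (x + y) z = h x z + h y z"
    and smult: "\<And>c x z. h (c *s x) z = c * h x z"
    and herm: "\<And>x y. cnj (h x y) = h y x"
    and pos: "\<And>x. x \<noteq> 0 \<Longrightarrow> 0 < Re (h x x)"
  obtains A B where "complex_linear_map A" "complex_linear_map B"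
    and "\<And>x. A (B x) = x" "\<And>x. B (A x) = x" and "\<And>x y. h x y = cinner (A x) (A y)"
proof -
  have add2: "h z (x + y) = h z x + h z y" for x y z
    using add[of x y z] herm by (metis complex_cnj_add)
  have smult2: "h z (c *s x) = cnj c * h z x" for c x z
    using smult[of c x z] herm by (metis complex_cnj_mult)
  have zero: "h 0 z = 0" "h z 0 = 0" for z using smult[of 0 0 z] smult2[of z 0 0] by auto
  have sum1: "h (\<Sum>i\<in>I. f i) z = (\<Sum>i\<in>I. h (f i) z)" for f :: "'d \<Rightarrow> complex ^ 'd" and I z
    by (induction I rule: infinite_finite_induct) (auto simp: zero add)
  have sum2: "h z (\<Sum>i\<in>I. f i) = (\<Sum>i\<in>I. h z (f i))" for f :: "'d \<Rightarrow> complex ^ 'd" and I z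
    by (induction I rule: infinite_finite_induct) (auto simp: zero add2)
  have diff: "h (x - y) z = h x z - h y z" for x y z using add[of "x - y" y z] by simp
  have diff2: "h z (x - y) = h z x - h z y" for x y z using add2[of z "x - y" y] by simp
  have real: "h x x = of_real (Re (h x x))" for x
  proof -
    have "Im (h x x) = - Im (h x x)" using herm[of x x] by (metis cnj.simps(2))
    then show ?thesis by (simp add: complex_eq_iff)
  qed
  have cont: "continuous_on T (\<lambda>x. Re (h x x))" for T
  proof -
    have "Re (h x x) = Re (\<Sum>i\<in>UNIV. \<Sum>j\<in>UNIV. x $ i * (cnj (x $ j) * h (axis i 1) (axis j 1)))" for x
    proof (rule arg_cong[of _ _ Re])
      have "h x x = h (\<Sum>i\<in>UNIV. (x $ i) *s axis i 1) (\<Sum>j\<in>UNIV. (x $ j) *s axis j 1)"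
        by (simp add: basis_expansion)
      then show "h x x = (\<Sum>i\<in>UNIV. \<Sum>j\<in>UNIV. x $ i * (cnj (x $ j) * h (axis i 1) (axis j 1)))"
        unfolding sum1 smult unfolding sum2 smult2 sum_distrib_left .
    qed
    then show ?thesis by (simp only:) (intro continuous_intros)
  qed
  define S where "S = {x. Re (h x x) \<le> 1}"
  have scale: "Re (h (of_real t *s x) (of_real t *s x)) = t\<^sup>2 * Re (h x x)" for t x
    by (simp add: smult smult2 power2_eq_square)
  have "closed S" unfolding S_def by (intro closed_Collect_le continuous_on_const) (use cont in auto)
  moreover have "bounded S"
  proof -
    have "compact (sphere (0 :: complex ^ 'd) 1)" "sphere (0 :: complex ^ 'd) 1 \<noteq> {}"
      by (auto intro!: exI[of _ "axis undefined 1"] simp: norm_axis)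
    from continuous_attains_inf[OF this cont] obtain e where e: "norm e = 1"
      and min: "\<And>y. norm y = 1 \<Longrightarrow> Re (h e e) \<le> Re (h y y)" by auto
    define m where "m = Re (h e e)"
    have m: "0 < m" unfolding m_def using e by (intro pos) auto
    have "norm x \<le> 1 + 1 / m" if x: "x \<in> S" for x
    proof (cases "x = 0")
      case False
      define y where "y = of_real (1 / norm x) *s x"
      have "norm y = 1" using False by (simp add: y_def norm_smult norm_divide)
      then have "m \<le> Re (h y y)" unfolding m_def by (rule min)
      also have "\<dots> = (1 / norm x)\<^sup>2 * Re (h x x)" unfolding y_def by (rule scale)
      also have "\<dots> \<le> (1 / norm x)\<^sup>2 * 1" using x by (intro mult_left_mono) (auto simp: S_def)
      finally have "m * (norm x)\<^sup>2 \<le> 1" using False by (simp add: power_divide divide_simps)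
      then have "(norm x)\<^sup>2 \<le> 1 / m" using m by (simp add: field_simps)
      also have "\<dots> \<le> (1 + 1 / m)\<^sup>2" using m by (simp add: power2_eq_square field_simps)
      finally show ?thesis by (rule power2_le_imp_le) (use m in simp)
    qed (use m in simp)
    then show ?thesis unfolding bounded_iff by blast
  qed
  ultimately have "compact S" by (simp add: compact_eq_bounded_closed)
  have "open {x. Re (h x x) < 1}" by (intro open_Collect_less) (use cont in auto)
  moreover have "0 \<in> {x. Re (h x x) < 1}" by (simp add: zero)
  ultimately obtain r where r: "0 < r" "ball 0 r \<subseteq> {x. Re (h x x) < 1}"
    using open_contains_ball by blast
  then have "ball 0 r \<subseteq> S" by (auto simp: S_def)
  from max_det_basis[OF \<open>compact S\<close> r(1) this] obtain A B
    where lin: "complex_linear_map A" "complex_linear_map B"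
      and inv: "\<And>x. A (B x) = x" "\<And>x. B (A x) = x"
      and B: "\<And>j. B (axis j 1) \<in> S" and A: "\<And>x j. x \<in> S \<Longrightarrow> cmod (A x $ j) \<le> 1" by blast
  define s where "s = (\<lambda>j. B (axis j 1))"
  have ge1: "1 \<le> Re (h x x)" if x: "A x $ k = 1" for x k
  proof (rule ccontr)
    assume n: "\<not> ?thesis"
    have "x \<noteq> 0" using x by (auto simp: complex_linear_map_zero[OF lin(1)])
    then have q: "0 < Re (h x x)" by (rule pos)
    define t where "t = 1 / sqrt (Re (h x x))"
    have t: "1 < t" "t\<^sup>2 * Re (h x x) = 1" using n q by (auto simp: t_def power_divide)
    have "of_real t *s x \<in> S" using scale[of t x] t(2) by (simp add: S_def)
    from A[OF this, of k] have "cmod (of_real t) \<le> 1"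
      unfolding complex_linear_map_smult[OF lin(1)] by (simp add: x)
    then show False using t(1) by simp
  qed
  have As: "A (s j) = axis j 1" for j by (simp add: s_def inv)
  have "Re (h (s j) (s j)) = 1" for j
  proof (rule antisym)
    show "Re (h (s j) (s j)) \<le> 1" using B[of j] by (simp add: S_def s_def)
    show "1 \<le> Re (h (s j) (s j))" by (rule ge1[of _ j]) (simp add: As axis_def)
  qed
  then have n1c: "h (s j) (s j) = 1" for j using real[of "s j"] by simp
  have ortho: "h (s k) (s j) = 0" if "j \<noteq> k" for j k
  proof -
    define m where "m = h (s k) (s j)"
    have "A (s k - m *s s j) $ k = 1"
      using that unfolding complex_linear_map_diff[OF lin(1)] complex_linear_map_smult[OF lin(1)] As
      by (simp add: axis_def)
    then have "1 \<le> Re (h (s k - m *s s j) (s k - m *s s j))" by (rule ge1)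
    also have "h (s k - m *s s j) (s k - m *s s j) = 1 - m * cnj m"
      using herm[of "s k" "s j"]
      by (simp add: diff diff2 smult smult2 n1c m_def[symmetric] algebra_simps)
    also have "Re (1 - m * cnj m) = 1 - (cmod m)\<^sup>2" unfolding complex_norm_square[symmetric] by simp
    finally show ?thesis by (simp add: m_def)
  qed
  have "h x y = cinner (A x) (A y)" for x y
  proof -
    have ex: "x = (\<Sum>j\<in>UNIV. (A x $ j) *s s j)" for x
      using basis_expansion_map[OF lin(2), of "A x"] by (simp add: inv s_def)
    have "h x y = h (\<Sum>j\<in>UNIV. (A x $ j) *s s j) (\<Sum>j\<in>UNIV. (A y $ j) *s s j)"
      using ex[of x] ex[of y] by simp
    also have "\<dots> = (\<Sum>i\<in>UNIV. \<Sum>j\<in>UNIV. A x $ i * (cnj (A y $ j) * h (s i) (s j)))"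
      unfolding sum1 smult unfolding sum2 smult2 sum_distrib_left ..
    also have "\<dots> = (\<Sum>i\<in>UNIV. \<Sum>j\<in>UNIV. if j = i then A x $ i * cnj (A y $ i) else 0)"
      by (intro sum.cong refl) (auto simp: n1c ortho)
    also have "\<dots> = cinner (A x) (A y)" by (simp add: cinner_def)
    finally show ?thesis .
  qed
  with lin inv show ?thesis by (rule that)
qed


section \<open>Minkowski functionals and local Hausdorff convergence\<close>

text \<open>Local Hausdorff convergence is reduced to convergence of Minkowski functionals, which are uniformly
  Lipschitz for sets that contain a common ball.\<close>

definition minkowski :: "'a::real_normed_vector set \<Rightarrow> 'a \<Rightarrow> real"
  where "minkowski D x = Inf {t. 0 < t \<and> (1 / t) *\<^sub>R x \<in> D}"

locale gauge_body =
  fixes D :: "'a::euclidean_space set" and r :: real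
  assumes open_D: "open D" and convex_D: "convex D" and r_pos: "0 < r" and ball_D: "ball 0 r \<subseteq> D"
begin

lemma zero_in: "0 \<in> D" using ball_D r_pos by auto

lemma scale_in: "x \<in> D \<Longrightarrow> 0 \<le> t \<Longrightarrow> t \<le> 1 \<Longrightarrow> t *\<^sub>R x \<in> D"
  using convexD[OF convex_D _ zero_in, of x t "1 - t"] by simp

lemma minkowski_less_iff: "minkowski D x < t \<longleftrightarrow> 0 < t \<and> (1 / t) *\<^sub>R x \<in> D"
proof -
  let ?T = "{t. 0 < t \<and> (1 / t) *\<^sub>R x \<in> D}"
  have ne: "?T \<noteq> {}"
  proof -
    have p: "0 < norm x / r + 1" using r_pos by (simp add: add_nonneg_pos)
    have "norm x < r * (norm x / r + 1)" using r_pos by (simp add: field_simps)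
    then have "norm ((1 / (norm x / r + 1)) *\<^sub>R x) < r" using p by (simp add: pos_divide_less_eq)
    then have "(1 / (norm x / r + 1)) *\<^sub>R x \<in> D" using ball_D by auto
    then show ?thesis using p by blast
  qed
  have bdd: "bdd_below ?T" by (rule bdd_belowI[of _ 0]) auto
  show ?thesis
  proof
    assume "minkowski D x < t"
    then obtain t' where t': "0 < t'" "(1 / t') *\<^sub>R x \<in> D" "t' < t"
      unfolding minkowski_def using cInf_less_iff[OF ne bdd] by auto
    have "(t' / t) *\<^sub>R ((1 / t') *\<^sub>R x) \<in> D"
      by (rule scale_in[OF t'(2)]) (use t' in auto)
    then show "0 < t \<and> (1 / t) *\<^sub>R x \<in> D" using t' by simp
  next
    assume t: "0 < t \<and> (1 / t) *\<^sub>R x \<in> D"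
    have "((\<lambda>s. (1 / s) *\<^sub>R x) \<longlongrightarrow> (1 / t) *\<^sub>R x) (at_left t)"
      using t by (intro tendsto_intros) auto
    then have "\<forall>\<^sub>F s in at_left t. (1 / s) *\<^sub>R x \<in> D" using t open_D by (simp add: tendsto_def)
    moreover have "\<forall>\<^sub>F s in at_left t. s \<in> {0<..<t}" using t by (intro eventually_at_leftI[of 0]) auto
    ultimately have "\<forall>\<^sub>F s in at_left t. (1 / s) *\<^sub>R x \<in> D \<and> s \<in> {0<..<t}" by (rule eventually_conj)
    then obtain s where "(1 / s) *\<^sub>R x \<in> D" "s \<in> {0<..<t}"
      using eventually_happens' trivial_limit_at_left_real by blast
    then show "minkowski D x < t" unfolding minkowski_def using cInf_less_iff[OF ne bdd] by auto
  qed
qed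

lemma minkowski_nonneg: "0 \<le> minkowski D x"
  using minkowski_less_iff[of x "minkowski D x / 2"] minkowski_less_iff[of x 0] by linarith

lemma minkowski_less_one: "minkowski D x < 1 \<longleftrightarrow> x \<in> D"
  using minkowski_less_iff[of x 1] by simp

lemma minkowski_scaleR: "0 \<le> s \<Longrightarrow> minkowski D (s *\<^sub>R x) = s * minkowski D x"
proof (cases "s = 0")
  case True
  have "minkowski D 0 < t" if "0 < t" for t using that by (simp add: minkowski_less_iff zero_in)
  then have "minkowski D 0 = 0" using minkowski_nonneg[of 0] by (meson dual_order.strict_iff_order less_irrefl)
  then show ?thesis using True by simp
next
  case False
  assume "0 \<le> s"
  then have s: "0 < s" using False by simp
  have "minkowski D (s *\<^sub>R x) < t \<longleftrightarrow> s * minkowski D x < t" for t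
  proof -
    have "minkowski D (s *\<^sub>R x) < t \<longleftrightarrow> minkowski D x < t / s"
      unfolding minkowski_less_iff using s by (simp add: zero_less_divide_iff)
    then show ?thesis using s by (simp add: pos_less_divide_eq mult.commute)
  qed
  then show ?thesis by (meson less_irrefl linorder_neqE)
qed

lemma minkowski_triangle: "minkowski D (x + y) \<le> minkowski D x + minkowski D y"
proof (rule field_le_epsilon)
  fix e :: real assume e: "0 < e"
  define s t where "s = minkowski D x + e / 2" and "t = minkowski D y + e / 2"
  have st: "0 < s" "0 < t" "(1 / s) *\<^sub>R x \<in> D" "(1 / t) *\<^sub>R y \<in> D"
    using e minkowski_less_iff[of x s] minkowski_less_iff[of y t] by (auto simp: s_def t_def)
  have "(s / (s + t)) *\<^sub>R ((1 / s) *\<^sub>R x) + (t / (s + t)) *\<^sub>R ((1 / t) *\<^sub>R y) \<in> D"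
    using st by (intro convexD[OF convex_D]) (auto simp: add_divide_distrib[symmetric])
  then have "(1 / (s + t)) *\<^sub>R (x + y) \<in> D" using st by (simp add: scaleR_add_right)
  then have "minkowski D (x + y) < s + t" using st by (simp add: minkowski_less_iff)
  then show "minkowski D (x + y) \<le> minkowski D x + minkowski D y + e" by (simp add: s_def t_def)
qed

lemma minkowski_le_norm: "minkowski D x \<le> norm x / r"
proof (rule dense_ge)
  fix t assume t: "norm x / r < t"
  then have t0: "0 < t" using r_pos by (meson divide_nonneg_pos norm_ge_zero order_le_less_trans)
  have "norm ((1 / t) *\<^sub>R x) < r" using t t0 r_pos by (simp add: field_simps)
  then have "(1 / t) *\<^sub>R x \<in> D" using ball_D by auto
  then show "minkowski D x \<le> t" using t0 minkowski_less_iff[of x t] by simp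
qed

lemma minkowski_lipschitz: "\<bar>minkowski D x - minkowski D y\<bar> \<le> norm (x - y) / r"
  using minkowski_triangle[of y "x - y"] minkowski_triangle[of x "y - x"]
    minkowski_le_norm[of "x - y"] minkowski_le_norm[of "y - x"] by (simp add: norm_minus_commute)

lemma continuous_minkowski: "continuous_on S (minkowski D)"
proof (rule continuous_on_subset[OF _ subset_UNIV])
  show "continuous_on UNIV (minkowski D)"
  proof (rule continuous_onI)
    fix x and e :: real assume "0 < e"
    then show "\<exists>d>0. \<forall>x'\<in>UNIV. dist x' x < d \<longrightarrow> dist (minkowski D x') (minkowski D x) \<le> e"
    proof (intro exI[of _ "e * r"] conjI ballI impI)
      fix y assume "dist y x < e * r"
      then have "norm (y - x) / r \<le> e" using r_pos by (simp add: dist_norm pos_divide_le_eq)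
      then show "dist (minkowski D y) (minkowski D x) \<le> e"
        using minkowski_lipschitz[of y x] by (simp add: dist_real_def)
    qed (use \<open>0 < e\<close> r_pos in simp)
  qed
qed

lemma closure_eq: "closure D = {x. minkowski D x \<le> 1}"
proof
  have "closed {x. minkowski D x \<le> 1}" by (intro closed_Collect_le continuous_minkowski continuous_on_const)
  then show "closure D \<subseteq> {x. minkowski D x \<le> 1}"
    using minkowski_less_one by (intro closure_minimal) (auto intro: less_imp_le)
  show "{x. minkowski D x \<le> 1} \<subseteq> closure D"
  proof
    fix x assume x: "x \<in> {x. minkowski D x \<le> 1}"
    have "(\<lambda>n. (1 - 1 / real (n + 2)) *\<^sub>R x) \<longlonglongrightarrow> 1 *\<^sub>R x" by (intro tendsto_scaleR tendsto_const) real_asymp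
    moreover have "(1 - 1 / real (n + 2)) *\<^sub>R x \<in> D" for n
    proof -
      have "(1 - 1 / real (n + 2)) * minkowski D x \<le> (1 - 1 / real (n + 2)) * 1"
        using x by (intro mult_left_mono) auto
      moreover have "minkowski D ((1 - 1 / real (n + 2)) *\<^sub>R x) = (1 - 1 / real (n + 2)) * minkowski D x"
        by (intro minkowski_scaleR) simp
      ultimately have "minkowski D ((1 - 1 / real (n + 2)) *\<^sub>R x) \<le> 1 - 1 / real (n + 2)"
        by (simp only: mult_1_right)
      also have "\<dots> < 1" by simp
      finally show ?thesis unfolding minkowski_less_one .
    qed
    ultimately have "\<exists>f. (\<forall>n. f n \<in> D) \<and> f \<longlonglongrightarrow> x"
      by (intro exI[of _ "\<lambda>n. (1 - 1 / real (n + 2)) *\<^sub>R x"]) simp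
    then show "x \<in> closure D" by (simp only: closure_sequential)
  qed
qed

end

lemma hausdorff_distance_le:
  assumes "\<And>a. a \<in> A \<Longrightarrow> \<exists>b\<in>B. dist a b \<le> e" "\<And>b. b \<in> B \<Longrightarrow> \<exists>a\<in>A. dist a b \<le> e"
  shows "hausdorff_distance A B \<le> ennreal e"
  unfolding hausdorff_distance_def
proof (intro max.boundedI SUP_least)
  fix a assume "a \<in> A"
  then obtain b where "b \<in> B" "dist a b \<le> e" using assms(1) by blast
  then show "(INF b\<in>B. ennreal (dist a b)) \<le> ennreal e" by (intro INF_lower2[of b]) (auto intro: ennreal_leI)
next
  fix b assume "b \<in> B"
  then obtain a where "a \<in> A" "dist a b \<le> e" using assms(2) by blast
  then show "(INF a\<in>A. ennreal (dist a b)) \<le> ennreal e" by (intro INF_lower2[of a]) (auto intro: ennreal_leI)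
qed

text \<open>Shrinking radially towards \<open>0\<close> does not leave \<open>cball 0 R\<close>; so closeness of the Minkowski
  functionals on that ball bounds the truncated Hausdorff distance.\<close>

lemma radial_shrink:
  assumes "gauge_body D r" "x \<in> cball 0 R" "minkowski D x \<le> 1 + e" "0 \<le> e"
  shows "\<exists>b\<in>closure D \<inter> cball 0 R. dist x b \<le> e * R"
proof -
  interpret gauge_body D r by fact
  define b where "b = (1 / (1 + e)) *\<^sub>R x"
  have "minkowski D b = minkowski D x / (1 + e)" unfolding b_def using assms(4) by (subst minkowski_scaleR) auto
  also have "\<dots> \<le> 1" using assms by simp
  finally have "b \<in> closure D" by (simp add: closure_eq)
  moreover have R: "norm x \<le> R" using assms(2) by simp
  have "norm b \<le> norm x"
  proof -
    have "norm x * 1 \<le> norm x * (1 + e)" using assms(4) by (intro mult_left_mono) auto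
    then show ?thesis using assms(4) by (simp add: b_def divide_simps)
  qed
  moreover have "dist x b \<le> e * R"
  proof -
    have "x - b = (1 - 1 / (1 + e)) *\<^sub>R x" by (simp add: b_def scaleR_left_diff_distrib)
    also have "1 - 1 / (1 + e) = e / (1 + e)" using assms(4) by (simp add: field_simps)
    finally have "dist x b = e / (1 + e) * norm x" using assms(4) by (simp add: dist_norm)
    also have "\<dots> \<le> e * R"
    proof (intro mult_mono)
      have "e * 1 \<le> e * (1 + e)" using assms(4) by (intro mult_left_mono) auto
      then show "e / (1 + e) \<le> e" using assms(4) by (simp add: pos_divide_le_eq)
    qed (use assms(4) R in auto)
    finally show ?thesis .
  qed
  ultimately show ?thesis using R by (intro bexI[of _ b]) auto
qed

text \<open>Pointwise convergence of uniformly Lipschitz functions is uniform on compact sets.\<close>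

lemma minkowski_tendsto_uniform:
  fixes D :: "'a::euclidean_space set"
  assumes Ds: "\<And>n. gauge_body (Ds n) r" and D: "gauge_body D r"
    and lim: "\<And>x. (\<lambda>n. minkowski (Ds n) x) \<longlonglongrightarrow> minkowski D x" and e: "0 < e"
  shows "\<forall>\<^sub>F n in sequentially. \<forall>x\<in>cball 0 R. \<bar>minkowski (Ds n) x - minkowski D x\<bar> < e"
proof -
  have r: "0 < r" using D unfolding gauge_body_def by blast
  define d where "d = e * r / 3"
  have d: "0 < d" using e r by (simp add: d_def)
  obtain k where k: "finite k" "k \<subseteq> cball 0 R" "cball (0 :: 'a) R \<subseteq> (\<Union>x\<in>k. ball x d)"
    using seq_compact_imp_totally_bounded[OF compact_imp_seq_compact[OF compact_cball]] d by metis
  have "\<forall>\<^sub>F n in sequentially. \<forall>y\<in>k. \<bar>minkowski (Ds n) y - minkowski D y\<bar> < e / 3"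
  proof (rule eventually_ball_finite[OF k(1)], rule ballI)
    fix y show "\<forall>\<^sub>F n in sequentially. \<bar>minkowski (Ds n) y - minkowski D y\<bar> < e / 3"
      using tendstoD[OF lim, of "e / 3" y] e by (simp add: dist_real_def)
  qed
  then show ?thesis
  proof eventually_elim
    case (elim n)
    show ?case
    proof
      fix x :: 'a assume "x \<in> cball 0 R"
      then obtain y where y: "y \<in> k" "dist y x < d" using k(3) by auto
      have "norm (x - y) / r < e / 3" using y(2) r by (simp add: d_def dist_norm norm_minus_commute field_simps)
      then show "\<bar>minkowski (Ds n) x - minkowski D x\<bar> < e"
        using gauge_body.minkowski_lipschitz[OF Ds, of n x y] gauge_body.minkowski_lipschitz[OF D, of x y]
          bspec[OF elim y(1)] by linarith
    qed
  qed
qed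

lemma local_hausdorff_convergentI:
  fixes D :: "'a::euclidean_space set"
  assumes Ds: "\<And>n. gauge_body (Ds n) r" and D: "gauge_body D r"
    and lim: "\<And>x. (\<lambda>n. minkowski (Ds n) x) \<longlonglongrightarrow> minkowski D x"
  shows "local_hausdorff_convergent Ds D"
  unfolding local_hausdorff_convergent_def
proof (intro exI[of _ 0] conjI allI impI order_refl)
  fix R :: real assume R: "0 \<le> R"
  show "(\<lambda>n. hausdorff_distance_R R (closure (Ds n)) (closure D)) \<longlonglongrightarrow> 0"
  proof (rule order_tendstoI)
    fix a :: ennreal assume a: "0 < a"
    obtain e where e: "0 < e" "ennreal (e * R) < a"
    proof (cases "a = top")
      case True show ?thesis by (rule that[of 1]) (auto simp: True)
    next
      case False
      then obtain b where b: "a = ennreal b" "0 < b" using a by (cases a) auto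
      show ?thesis
      proof (rule that[of "b / (R + 1) / 2"])
        show "0 < b / (R + 1) / 2" using b R by simp
        have "b / (R + 1) / 2 * R < b" using b(2) R by (simp add: field_simps) (smt (verit) mult_nonneg_nonneg)
        then show "ennreal (b / (R + 1) / 2 * R) < a" using b by (simp add: ennreal_less_iff R)
      qed
    qed
    show "\<forall>\<^sub>F n in sequentially. hausdorff_distance_R R (closure (Ds n)) (closure D) < a"
      using minkowski_tendsto_uniform[OF Ds D lim e(1), of R]
    proof eventually_elim
      case (elim n)
      have "hausdorff_distance_R R (closure (Ds n)) (closure D) \<le> ennreal (e * R)"
        unfolding hausdorff_distance_R_def
      proof (rule hausdorff_distance_le)
        fix x assume x: "x \<in> closure (Ds n) \<inter> cball 0 R"
        then have "minkowski D x \<le> 1 + e"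
          using bspec[OF elim, of x] gauge_body.closure_eq[OF Ds, of n] by auto
        then show "\<exists>b\<in>closure D \<inter> cball 0 R. dist x b \<le> e * R"
          using radial_shrink[OF D] x e(1) by auto
      next
        fix x assume x: "x \<in> closure D \<inter> cball 0 R"
        then have "minkowski (Ds n) x \<le> 1 + e"
          using bspec[OF elim, of x] gauge_body.closure_eq[OF D] by auto
        then show "\<exists>a\<in>closure (Ds n) \<inter> cball 0 R. dist a x \<le> e * R"
          using radial_shrink[OF Ds, of x R n e] x e(1) by (auto simp: dist_commute)
      qed
      then show ?case using e(2) by (rule le_less_trans)
    qed
  qed simp
qed

lemma minkowski_tendsto_moving:
  fixes D :: "'a::euclidean_space set"
  assumes Ds: "\<And>n. gauge_body (Ds n) r"
    and lim: "\<And>x. (\<lambda>n. minkowski (Ds n) x) \<longlonglongrightarrow> minkowski D x" and x: "xs \<longlonglongrightarrow> x"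
  shows "(\<lambda>n. minkowski (Ds n) (xs n)) \<longlonglongrightarrow> minkowski D x"
proof -
  have "(\<lambda>n. norm (xs n - x) / r) \<longlonglongrightarrow> norm (x - x) / r" using x by (intro tendsto_intros) (use Ds in \<open>auto simp: gauge_body_def\<close>)
  then have "(\<lambda>n. norm (xs n - x) / r) \<longlonglongrightarrow> 0" by simp
  then have "(\<lambda>n. minkowski (Ds n) (xs n) - minkowski (Ds n) x) \<longlonglongrightarrow> 0"
    by (rule Lim_null_comparison[rotated]) (use gauge_body.minkowski_lipschitz[OF Ds] in auto)
  from tendsto_add[OF this lim[of x]] show ?thesis by simp
qed

text \<open>For \<open>t > 0\<close> the inequalities \<open>minkowski D x < t\<close> and \<open>minkowski D x > t\<close> mean that \<open>(1 / t) *\<^sub>R x\<close> lies inside \<open>D\<close> and outside its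
  closure; so convergence can be tested on single points.\<close>

lemma minkowski_tendsto_if_eventually_mem:
  fixes D :: "'a::euclidean_space set"
  assumes Ds: "\<And>n. gauge_body (Ds n) r" and D: "gauge_body D r"
    and "\<And>x. x \<in> D \<Longrightarrow> \<forall>\<^sub>F n in sequentially. x \<in> Ds n"
    and "\<And>x. x \<notin> closure D \<Longrightarrow> \<forall>\<^sub>F n in sequentially. x \<notin> Ds n"
  shows "(\<lambda>n. minkowski (Ds n) x) \<longlonglongrightarrow> minkowski D x"
proof (rule order_tendstoI)
  fix t assume t: "minkowski D x < t"
  then have t0: "0 < t" and "(1 / t) *\<^sub>R x \<in> D" using gauge_body.minkowski_less_iff[OF D] by blast+
  then have "\<forall>\<^sub>F n in sequentially. (1 / t) *\<^sub>R x \<in> Ds n" using assms(3) by blast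
  then show "\<forall>\<^sub>F n in sequentially. minkowski (Ds n) x < t"
    by eventually_elim (simp add: gauge_body.minkowski_less_iff[OF Ds] t0)
next
  fix t assume t: "t < minkowski D x"
  show "\<forall>\<^sub>F n in sequentially. t < minkowski (Ds n) x"
  proof (cases "t < 0")
    case True then show ?thesis using gauge_body.minkowski_nonneg[OF Ds] by (auto intro: always_eventually less_le_trans)
  next
    case False
    obtain s where s: "t < s" "s < minkowski D x" using t dense by blast
    then have s0: "0 < s" using False by simp
    have "minkowski D ((1 / s) *\<^sub>R x) = (1 / s) * minkowski D x" using s0 by (intro gauge_body.minkowski_scaleR[OF D]) simp
    also have "\<dots> > 1" using s s0 by simp
    finally have "(1 / s) *\<^sub>R x \<notin> closure D" by (simp add: gauge_body.closure_eq[OF D])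
    then have "\<forall>\<^sub>F n in sequentially. (1 / s) *\<^sub>R x \<notin> Ds n" using assms(4) by blast
    then show ?thesis
    proof eventually_elim
      case (elim n)
      then have "\<not> minkowski (Ds n) x < s" by (simp add: gauge_body.minkowski_less_iff[OF Ds])
      then show ?case using s by simp
    qed
  qed
qed

text \<open>The theorem of Arzela and Ascoli gives a limit on the unit ball, and homogeneity extends it. The limit \<open>G\<close> is sublinear and
  therefore the Minkowski functional of \<open>{x. G x < 1}\<close>.\<close>

lemma minkowski_selection:
  fixes Ds :: "nat \<Rightarrow> 'a::euclidean_space set"
  assumes Ds: "\<And>n. gauge_body (Ds n) r"
  obtains k D where "strict_mono (k :: nat \<Rightarrow> nat)" "gauge_body D r"
    and "\<And>x. (\<lambda>n. minkowski (Ds (k n)) x) \<longlonglongrightarrow> minkowski D x"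
proof -
  have r: "0 < r" using Ds unfolding gauge_body_def by blast
  obtain g k where k: "strict_mono (k :: nat \<Rightarrow> nat)"
    and g: "\<And>e. 0 < e \<Longrightarrow> \<exists>N. \<forall>n x. n \<ge> N \<and> x \<in> cball 0 1 \<longrightarrow> norm (minkowski (Ds (k n)) x - g x) < e"
  proof (rule Arzela_Ascoli[of "cball (0 :: 'a) 1" "\<lambda>n. minkowski (Ds n)" "1 / r"])
    show "norm (minkowski (Ds n) x) \<le> 1 / r" if "x \<in> cball 0 1" for n x
      using that gauge_body.minkowski_nonneg[OF Ds, of n x] gauge_body.minkowski_le_norm[OF Ds, of n x] r
        divide_right_mono[of "norm x" 1 r] by simp
    show "\<exists>d>0. \<forall>n y. y \<in> cball 0 1 \<and> norm (x - y) < d \<longrightarrow> norm (minkowski (Ds n) x - minkowski (Ds n) y) < e"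
      if "x \<in> cball 0 1" "0 < e" for x :: 'a and e
    proof (intro exI[of _ "e * r"] conjI allI impI)
      show "0 < e * r" using that r by simp
      fix n y assume "y \<in> cball 0 1 \<and> norm (x - y) < e * r"
      then have "norm (x - y) / r < e" using r by (simp add: pos_divide_less_eq)
      then show "norm (minkowski (Ds n) x - minkowski (Ds n) y) < e"
        using gauge_body.minkowski_lipschitz[OF Ds, of n x y] by simp
    qed
  qed auto
  have conv1: "(\<lambda>n. minkowski (Ds (k n)) x) \<longlonglongrightarrow> g x" if "x \<in> cball 0 1" for x
    using g that by (intro LIMSEQ_I) blast
  have "\<exists>l. (\<lambda>n. minkowski (Ds (k n)) x) \<longlonglongrightarrow> l" for x
  proof -
    define t where "t = norm x + 1"
    have t: "0 < t" by (simp add: t_def add_nonneg_pos)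
    have "(1 / t) *\<^sub>R x \<in> cball 0 1" using t by (simp add: t_def)
    from tendsto_mult_left[OF conv1[OF this], of t]
    have "(\<lambda>n. t * minkowski (Ds (k n)) ((1 / t) *\<^sub>R x)) \<longlonglongrightarrow> t * g ((1 / t) *\<^sub>R x)" .
    moreover have "t * minkowski (Ds (k n)) ((1 / t) *\<^sub>R x) = minkowski (Ds (k n)) x" for n
      using t by (subst gauge_body.minkowski_scaleR[OF Ds]) auto
    ultimately show ?thesis by auto
  qed
  then obtain G where G: "\<And>x. (\<lambda>n. minkowski (Ds (k n)) x) \<longlonglongrightarrow> G x" by metis
  have G_nonneg: "0 \<le> G x" for x
    by (rule LIMSEQ_le_const[OF G]) (use gauge_body.minkowski_nonneg[OF Ds] in blast)
  have G_norm: "G x \<le> norm x / r" for x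
    by (rule LIMSEQ_le_const2[OF G]) (use gauge_body.minkowski_le_norm[OF Ds] in blast)
  have G_add: "G (x + y) \<le> G x + G y" for x y
    by (rule LIMSEQ_le[OF G tendsto_add[OF G G]]) (use gauge_body.minkowski_triangle[OF Ds] in blast)
  have G_scale: "G (s *\<^sub>R x) = s * G x" if "0 \<le> s" for s x
  proof (rule LIMSEQ_unique[OF G])
    show "(\<lambda>n. minkowski (Ds (k n)) (s *\<^sub>R x)) \<longlonglongrightarrow> s * G x"
      using tendsto_mult_left[OF G, of s x] by (simp add: gauge_body.minkowski_scaleR[OF Ds that])
  qed
  define D where "D = {x. G x < 1}"
  have body: "gauge_body D r"
  proof
    show "0 < r" by (rule r)
    show "ball 0 r \<subseteq> D"
    proof
      fix x :: 'a assume "x \<in> ball 0 r"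
      then have "norm x / r < 1" using r by simp
      then show "x \<in> D" using G_norm[of x] by (simp add: D_def)
    qed
    show "convex D"
    proof (rule convexI)
      fix x y :: 'a and u v :: real
      assume xy: "x \<in> D" "y \<in> D" and uv: "0 \<le> u" "0 \<le> v" "u + v = 1"
      have "G (u *\<^sub>R x + v *\<^sub>R y) \<le> u * G x + v * G y"
        using G_add[of "u *\<^sub>R x" "v *\<^sub>R y"] uv by (simp add: G_scale)
      also have "\<dots> < 1" using xy uv convex_bound_lt[of "G x" 1 "G y" u v] by (simp add: D_def)
      finally show "u *\<^sub>R x + v *\<^sub>R y \<in> D" by (simp add: D_def)
    qed
    show "open D" unfolding open_contains_ball
    proof
      fix x assume x: "x \<in> D"
      define e where "e = r * (1 - G x)"
      have "ball x e \<subseteq> D"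
      proof
        fix y assume "y \<in> ball x e"
        then have "norm (y - x) / r < 1 - G x" using r by (simp add: e_def dist_norm norm_minus_commute field_simps)
        then show "y \<in> D" using G_add[of x "y - x"] G_norm[of "y - x"] by (simp add: D_def)
      qed
      moreover have "0 < e" using x r by (simp add: e_def D_def)
      ultimately show "\<exists>e>0. ball x e \<subseteq> D" by blast
    qed
  qed
  have "minkowski D x = G x" for x
  proof -
    have "minkowski D x < t \<longleftrightarrow> G x < t" for t
    proof (cases "0 < t")
      case True
      then have "(1 / t) *\<^sub>R x \<in> D \<longleftrightarrow> G x < t"
        unfolding D_def mem_Collect_eq by (subst G_scale) auto
      then show ?thesis using True gauge_body.minkowski_less_iff[OF body, of x t] by simp
    next
      case False
      then show ?thesis using G_nonneg[of x] gauge_body.minkowski_nonneg[OF body, of x] by linarith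
    qed
    then show ?thesis by (meson less_irrefl linorder_neqE)
  qed
  with G show ?thesis using k body by (intro that) auto
qed


section \<open>Defining functions: directional derivatives, convexity, Levi form\<close>

definition D1 :: "('a::euclidean_space \<Rightarrow> real) \<Rightarrow> 'a \<Rightarrow> 'a \<Rightarrow> real"
  where "D1 r q v = frechet_derivative r (at q) v"

definition D2 :: "('a::euclidean_space \<Rightarrow> real) \<Rightarrow> 'a \<Rightarrow> 'a \<Rightarrow> 'a \<Rightarrow> real"
  where "D2 r q v w = D1 (\<lambda>p. D1 r p v) q w"

lemma Ck_on_Suc_iff:
  "Ck_on (Suc k) U r \<longleftrightarrow> (\<forall>x\<in>U. r differentiable (at x)) \<and> (\<forall>v. Ck_on k U (\<lambda>x. D1 r x v))"
  by (simp add: D1_def)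

lemma has_derivative_D1: "r differentiable (at q) \<Longrightarrow> (r has_derivative D1 r q) (at q)"
  unfolding D1_def[abs_def] using frechet_derivative_works by (metis eta_contract_eq)

lemma D1_eqI: "(r has_derivative L) (at q) \<Longrightarrow> D1 r q v = L v"
  unfolding D1_def using frechet_derivative_at by metis

lemma linear_D1: "r differentiable (at q) \<Longrightarrow> linear (D1 r q)"
  using has_derivative_D1 has_derivative_linear by blast

lemma has_derivative_along_line:
  assumes "r differentiable (at (q + t *\<^sub>R x))"
  shows "((\<lambda>t. r (q + t *\<^sub>R x)) has_real_derivative D1 r (q + t *\<^sub>R x) x) (at t)"
proof -
  have "((\<lambda>t. q + t *\<^sub>R x) has_derivative (\<lambda>h. h *\<^sub>R x)) (at t)"
    by (auto intro!: derivative_eq_intros)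
  from has_derivative_compose[OF this has_derivative_D1[OF assms]]
  have "((\<lambda>t. r (q + t *\<^sub>R x)) has_derivative (\<lambda>h. D1 r (q + t *\<^sub>R x) (h *\<^sub>R x))) (at t)" .
  moreover have "(\<lambda>h. D1 r (q + t *\<^sub>R x) (h *\<^sub>R x)) = (*) (D1 r (q + t *\<^sub>R x) x)"
    using linear_D1[OF assms] by (simp add: linear_scale fun_eq_iff)
  ultimately show ?thesis unfolding has_field_derivative_def by simp
qed

locale C2_fun =
  fixes U :: "'a::euclidean_space set" and r :: "'a \<Rightarrow> real"
  assumes open_U: "open U" and C2: "Ck_on 2 U r"
begin

lemma diff1: "q \<in> U \<Longrightarrow> r differentiable (at q)"
  and diff2: "q \<in> U \<Longrightarrow> (\<lambda>p. D1 r p v) differentiable (at q)"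
  and continuous_D2: "continuous_on U (\<lambda>q. D2 r q v w)"
  using C2 unfolding numeral_2_eq_2 Ck_on_Suc_iff by (auto simp: D2_def)

lemma linear1: "q \<in> U \<Longrightarrow> linear (D1 r q)" and linear2: "q \<in> U \<Longrightarrow> linear (D2 r q v)"
  unfolding D2_def using linear_D1 diff1 diff2 by blast+

lemma continuous_r: "continuous_on U r"
  using diff1 by (meson continuous_at_imp_continuous_on differentiable_imp_continuous_within)

lemma continuous_D1: "continuous_on U (\<lambda>q. D1 r q v)"
  using diff2 by (meson continuous_at_imp_continuous_on differentiable_imp_continuous_within)

lemma D2_add_left: assumes q: "q \<in> U" shows "D2 r q (v + w) x = D2 r q v x + D2 r q w x"
proof -
  have "((\<lambda>p. D1 r p v + D1 r p w) has_derivative (\<lambda>x. D2 r q v x + D2 r q w x)) (at q)"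
    unfolding D2_def using q by (intro has_derivative_add has_derivative_D1 diff2)
  then have "((\<lambda>p. D1 r p (v + w)) has_derivative (\<lambda>x. D2 r q v x + D2 r q w x)) (at q)"
    by (rule has_derivative_transform_within_open[OF _ open_U q]) (simp add: linear1 linear_add)
  then show ?thesis unfolding D2_def[of r q "v + w"] by (rule D1_eqI)
qed

lemma D2_scaleR_left: assumes q: "q \<in> U" shows "D2 r q (c *\<^sub>R v) x = c * D2 r q v x"
proof -
  have "((\<lambda>p. c * D1 r p v) has_derivative (\<lambda>x. c * D2 r q v x)) (at q)"
    unfolding D2_def using q by (intro has_derivative_mult_right has_derivative_D1 diff2)
  then have "((\<lambda>p. D1 r p (c *\<^sub>R v)) has_derivative (\<lambda>x. c * D2 r q v x)) (at q)"
    by (rule has_derivative_transform_within_open[OF _ open_U q]) (simp add: linear1 linear_scale)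
  then show ?thesis unfolding D2_def[of r q "c *\<^sub>R v"] by (rule D1_eqI)
qed

lemma linear2_left: "q \<in> U \<Longrightarrow> linear (\<lambda>v. D2 r q v w)"
  by (rule linearI) (simp_all add: D2_add_left D2_scaleR_left)

lemma D1_expand: "q \<in> U \<Longrightarrow> D1 r q v = (\<Sum>b\<in>Basis. (v \<bullet> b) * D1 r q b)"
proof -
  assume q: "q \<in> U"
  have "D1 r q v = D1 r q (\<Sum>b\<in>Basis. (v \<bullet> b) *\<^sub>R b)" by (simp add: euclidean_representation)
  also have "\<dots> = (\<Sum>b\<in>Basis. (v \<bullet> b) * D1 r q b)"
    using linear1[OF q] by (simp add: linear_sum linear_scale)
  finally show ?thesis .
qed

lemma D2_expand:
  assumes q: "q \<in> U"
  shows "D2 r q v w = (\<Sum>b\<in>Basis. \<Sum>c\<in>Basis. (v \<bullet> b) * ((w \<bullet> c) * D2 r q b c))"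
proof -
  have "D2 r q v w = D2 r q (\<Sum>b\<in>Basis. (v \<bullet> b) *\<^sub>R b) w" by (simp add: euclidean_representation)
  also have "\<dots> = (\<Sum>b\<in>Basis. (v \<bullet> b) * D2 r q b w)"
    unfolding linear_sum[OF linear2_left[OF q]] linear_scale[OF linear2_left[OF q]] real_scaleR_def ..
  also have "\<dots> = (\<Sum>b\<in>Basis. (v \<bullet> b) * D2 r q b (\<Sum>c\<in>Basis. (w \<bullet> c) *\<^sub>R c))"
    by (simp add: euclidean_representation)
  also have "\<dots> = (\<Sum>b\<in>Basis. \<Sum>c\<in>Basis. (v \<bullet> b) * ((w \<bullet> c) * D2 r q b c))"
    using linear2[OF q] by (simp add: linear_sum linear_scale sum_distrib_left)
  finally show ?thesis .
qed

lemma tendsto_D1: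
  assumes "(qs \<longlongrightarrow> q) F" "(vs \<longlongrightarrow> v) F" "q \<in> U" "\<forall>\<^sub>F n in F. qs n \<in> U"
  shows "((\<lambda>n. D1 r (qs n) (vs n)) \<longlongrightarrow> D1 r q v) F"
proof -
  have "((\<lambda>n. D1 r (qs n) b) \<longlongrightarrow> D1 r q b) F" for b
    by (rule continuous_on_tendsto_compose[OF continuous_D1 assms(1,3,4)])
  then have "((\<lambda>n. \<Sum>b\<in>Basis. (vs n \<bullet> b) * D1 r (qs n) b) \<longlongrightarrow> (\<Sum>b\<in>Basis. (v \<bullet> b) * D1 r q b)) F"
    using assms(2) by (intro tendsto_intros)
  then have "((\<lambda>n. \<Sum>b\<in>Basis. (vs n \<bullet> b) * D1 r (qs n) b) \<longlongrightarrow> D1 r q v) F"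
    unfolding D1_expand[OF assms(3), of v] .
  moreover have "\<forall>\<^sub>F n in F. (\<Sum>b\<in>Basis. (vs n \<bullet> b) * D1 r (qs n) b) = D1 r (qs n) (vs n)"
    using assms(4) by eventually_elim (rule D1_expand[symmetric])
  ultimately show ?thesis by (rule Lim_transform_eventually)
qed

lemma tendsto_D2:
  assumes "(qs \<longlongrightarrow> q) F" "(vs \<longlongrightarrow> v) F" "q \<in> U" "\<forall>\<^sub>F n in F. qs n \<in> U"
  shows "((\<lambda>n. D2 r (qs n) (vs n) (vs n)) \<longlongrightarrow> D2 r q v v) F"
proof -
  have "((\<lambda>n. D2 r (qs n) b c) \<longlongrightarrow> D2 r q b c) F" for b c
    by (rule continuous_on_tendsto_compose[OF continuous_D2 assms(1,3,4)])
  then have "((\<lambda>n. \<Sum>b\<in>Basis. \<Sum>c\<in>Basis. (vs n \<bullet> b) * ((vs n \<bullet> c) * D2 r (qs n) b c))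
      \<longlongrightarrow> (\<Sum>b\<in>Basis. \<Sum>c\<in>Basis. (v \<bullet> b) * ((v \<bullet> c) * D2 r q b c))) F"
    using assms(2) by (intro tendsto_intros)
  then have "((\<lambda>n. \<Sum>b\<in>Basis. \<Sum>c\<in>Basis. (vs n \<bullet> b) * ((vs n \<bullet> c) * D2 r (qs n) b c)) \<longlongrightarrow> D2 r q v v) F"
    unfolding D2_expand[OF assms(3), of v v] .
  moreover have "\<forall>\<^sub>F n in F. (\<Sum>b\<in>Basis. \<Sum>c\<in>Basis. (vs n \<bullet> b) * ((vs n \<bullet> c) * D2 r (qs n) b c))
      = D2 r (qs n) (vs n) (vs n)"
    using assms(4) by eventually_elim (rule D2_expand[symmetric])
  ultimately show ?thesis by (rule Lim_transform_eventually)
qed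

lemma Taylor2:
  assumes "\<And>t. 0 \<le> t \<Longrightarrow> t \<le> 1 \<Longrightarrow> q + t *\<^sub>R x \<in> U"
  obtains t where "0 < t" "t < 1" "r (q + x) = r q + D1 r q x + D2 r (q + t *\<^sub>R x) x x / 2"
proof -
  define d where "d = (\<lambda>(m::nat) t. if m = 0 then r (q + t *\<^sub>R x) else if m = 1 then D1 r (q + t *\<^sub>R x) x
      else D2 r (q + t *\<^sub>R x) x x)"
  have "DERIV (d m) t :> d (Suc m) t" if "m < 2" "0 \<le> t" "t \<le> 1" for m t
  proof -
    have "q + t *\<^sub>R x \<in> U" using assms that by blast
    then have "((\<lambda>t. r (q + t *\<^sub>R x)) has_real_derivative D1 r (q + t *\<^sub>R x) x) (at t)"
      and "((\<lambda>t. D1 r (q + t *\<^sub>R x) x) has_real_derivative D2 r (q + t *\<^sub>R x) x x) (at t)"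
      unfolding D2_def by (intro has_derivative_along_line diff1 diff2; assumption)+
    then show ?thesis using that(1) by (cases "m = 0") (auto simp: d_def)
  qed
  then obtain t where "0 < t" "t < 1" "r (q + 1 *\<^sub>R x) = (\<Sum>m<2. d m 0 / fact m * 1 ^ m) + d 2 t / fact 2 * 1 ^ 2"
    using Maclaurin[of 1 2 d "\<lambda>t. r (q + t *\<^sub>R x)"] by (auto simp: d_def)
  then show ?thesis by (intro that[of t]) (auto simp: d_def numeral_2_eq_2)
qed

end

text \<open>At a boundary point a convex domain lies on one side of the tangent hyperplane, and the real
  Hessian of a defining function is positive semidefinite on it.\<close>

locale convex_boundary_point = C2_fun U r for U and r :: "'a::euclidean_space \<Rightarrow> real" +
  fixes \<Omega> p
  assumes open_\<Omega>: "open \<Omega>" and convex_\<Omega>: "convex \<Omega>" and p: "p \<in> frontier \<Omega>"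
    and ldf: "local_defining_function \<Omega> p U r"
begin

lemma p_U: "p \<in> U" using ldf by (simp add: local_defining_function_def)

lemma in_U: "z \<in> U \<Longrightarrow> z \<in> \<Omega> \<longleftrightarrow> r z < 0"
  using ldf unfolding local_defining_function_def by blast

lemma p_notin: "p \<notin> \<Omega>" using p open_\<Omega> by (simp add: frontier_def interior_open)

lemma p_closure: "p \<in> closure \<Omega>" using p by (simp add: frontier_def)

lemma r_p: "r p = 0"
proof (rule antisym)
  obtain z where z: "\<And>n. z n \<in> \<Omega>" "z \<longlonglongrightarrow> p" using p_closure closure_sequential by blast
  have U: "\<forall>\<^sub>F n in sequentially. z n \<in> U" using z(2) open_U p_U by (simp add: tendsto_def)
  have "(\<lambda>n. r (z n)) \<longlonglongrightarrow> r p"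
    by (rule continuous_on_tendsto_compose[OF continuous_r z(2) p_U U])
  moreover have "\<forall>\<^sub>F n in sequentially. r (z n) \<le> 0"
    using U by eventually_elim (use in_U z(1) in force)
  ultimately show "r p \<le> 0" by (simp add: tendsto_upperbound)
  show "0 \<le> r p" using in_U[OF p_U] p_notin by simp
qed

lemma eventually_in_U: "\<forall>\<^sub>F s in at_right 0. \<forall>t. 0 \<le> t \<longrightarrow> t \<le> s \<longrightarrow> p + t *\<^sub>R x \<in> U"
proof -
  obtain e where e: "0 < e" "ball p e \<subseteq> U" using open_contains_ball_eq[OF open_U] p_U by blast
  have n: "0 < norm x + 1" by (simp add: add_nonneg_pos)
  have "\<forall>\<^sub>F s in at_right 0. s < e / (norm x + 1)"
    using e n by (intro eventually_at_rightI[of 0 "e / (norm x + 1)"]) auto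
  then show ?thesis
  proof eventually_elim
    case (elim s)
    show ?case
    proof (intro allI impI)
      fix t assume t: "0 \<le> t" "t \<le> s"
      have "t * norm x \<le> t * (norm x + 1)" using t by (intro mult_left_mono) auto
      also have "\<dots> \<le> s * (norm x + 1)" using t n by (intro mult_right_mono) auto
      also have "\<dots> < e" using elim n by (simp add: pos_less_divide_eq)
      finally have "p + t *\<^sub>R x \<in> ball p e" using t by (simp add: dist_norm)
      then show "p + t *\<^sub>R x \<in> U" using e(2) by blast
    qed
  qed
qed

text \<open>Moving from \<open>p\<close> towards a point of \<open>\<Omega>\<close> decreases \<open>r\<close> at least weakly. If the derivative were \<open>0\<close>, it would be positive
  in the direction of some nearby point of \<open>\<Omega>\<close>.\<close>

lemma D1_neg: assumes z: "z \<in> \<Omega>" shows "D1 r p (z - p) < 0"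
proof -
  have le: "D1 r p (z - p) \<le> 0" if z: "z \<in> \<Omega>" for z
  proof (rule tendsto_upperbound)
    have "((\<lambda>t. r (p + t *\<^sub>R (z - p))) has_real_derivative D1 r (p + 0 *\<^sub>R (z - p)) (z - p)) (at 0)"
      using p_U by (intro has_derivative_along_line diff1) simp
    then have "((\<lambda>t. (r (p + t *\<^sub>R (z - p)) - r p) / t) \<longlongrightarrow> D1 r p (z - p)) (at 0)"
      by (simp add: DERIV_def)
    then show "((\<lambda>t. (r (p + t *\<^sub>R (z - p)) - r p) / t) \<longlongrightarrow> D1 r p (z - p)) (at_right 0)"
      by (rule tendsto_mono[rotated]) (simp add: at_le)
    have "\<forall>\<^sub>F t in at_right 0. t \<in> {0::real<..<1}" by (intro eventually_at_rightI[of 0 1]) auto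
    then show "\<forall>\<^sub>F t in at_right 0. (r (p + t *\<^sub>R (z - p)) - r p) / t \<le> 0"
      using eventually_in_U[of "z - p"]
    proof eventually_elim
      case (elim t)
      have "p - t *\<^sub>R (p - z) \<in> interior \<Omega>"
        using elim z open_\<Omega> by (intro mem_interior_closure_convex_shrink[OF convex_\<Omega> _ p_closure])
          (auto simp: interior_open)
      then have "p + t *\<^sub>R (z - p) \<in> \<Omega>" using interior_subset by (auto simp: algebra_simps)
      moreover have "p + t *\<^sub>R (z - p) \<in> U" using elim by simp
      ultimately have "r (p + t *\<^sub>R (z - p)) < 0" using in_U by blast
      then show ?case using elim by (simp add: r_p divide_nonpos_pos)
    qed
  qed simp
  obtain w where w: "D1 r p w \<noteq> 0"
    using ldf p_U unfolding local_defining_function_def D1_def by fastforce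
  define w' where "w' = sgn (D1 r p w) *\<^sub>R w"
  have w': "0 < D1 r p w'" using w by (simp add: w'_def linear_scale[OF linear1[OF p_U]] sgn_mult_self_eq abs_sgn_eq sgn_if)
  have "((\<lambda>t. z + t *\<^sub>R w') \<longlongrightarrow> z + 0 *\<^sub>R w') (at_right 0)" by (intro tendsto_intros)
  then have "\<forall>\<^sub>F t in at_right (0::real). z + t *\<^sub>R w' \<in> \<Omega>" using z open_\<Omega> by (simp add: tendsto_def)
  moreover have "\<forall>\<^sub>F t in at_right 0. t \<in> {0::real<..<1}" by (intro eventually_at_rightI[of 0 1]) auto
  ultimately have "\<forall>\<^sub>F t in at_right (0::real). z + t *\<^sub>R w' \<in> \<Omega> \<and> t \<in> {0<..<1}" by (rule eventually_conj)
  then obtain t where t: "z + t *\<^sub>R w' \<in> \<Omega>" "0 < t" using eventually_happens' trivial_limit_at_right_real by fastforce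
  have "D1 r p (z + t *\<^sub>R w' - p) = D1 r p ((z - p) + t *\<^sub>R w')" by (simp add: algebra_simps)
  also have "\<dots> = D1 r p (z - p) + t * D1 r p w'"
    by (simp add: linear_add[OF linear1[OF p_U]] linear_scale[OF linear1[OF p_U]])
  finally show ?thesis using le[OF t(1)] mult_pos_pos[OF t(2) w'] by linarith
qed

text \<open>Otherwise \<open>r\<close> is negative at \<open>p + s *\<^sub>R v\<close> and at \<open>p - s *\<^sub>R v\<close> for small \<open>s\<close>, and the midpoint \<open>p\<close> lies in \<open>\<Omega>\<close>.\<close>

lemma D2_nonneg: assumes v: "D1 r p v = 0" shows "0 \<le> D2 r p v v"
proof (rule ccontr)
  assume neg: "\<not> ?thesis"
  have *: "\<forall>\<^sub>F s in at_right 0. p + s *\<^sub>R w \<in> \<Omega>" if w: "D1 r p w = 0" "D2 r p w w < 0" for w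
  proof -
    have "open (U \<inter> (\<lambda>q. D2 r q w w) -` {..<0})"
      by (intro continuous_open_preimage continuous_D2 open_U) simp
    moreover have "p \<in> U \<inter> (\<lambda>q. D2 r q w w) -` {..<0}" using p_U w(2) by simp
    ultimately obtain e where e: "0 < e" "ball p e \<subseteq> U \<inter> (\<lambda>q. D2 r q w w) -` {..<0}"
      using open_contains_ball_eq by blast
    have n: "0 < norm w + 1" by (simp add: add_nonneg_pos)
    have "\<forall>\<^sub>F s in at_right 0. s \<in> {0<..<e / (norm w + 1)}"
      using e n by (intro eventually_at_rightI[of 0 "e / (norm w + 1)"]) auto
    then show ?thesis
    proof eventually_elim
      case (elim s)
      have B: "p + t *\<^sub>R (s *\<^sub>R w) \<in> ball p e" if "0 \<le> t" "t \<le> 1" for t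
      proof -
        have "t * (s * norm w) \<le> 1 * (s * (norm w + 1))"
          using elim that by (intro mult_mono) auto
        also have "\<dots> < e" using elim n by (simp add: pos_less_divide_eq)
        finally show ?thesis using that elim by (simp add: dist_norm)
      qed
      obtain t where t: "0 < t" "t < 1"
        "r (p + s *\<^sub>R w) = r p + D1 r p (s *\<^sub>R w) + D2 r (p + t *\<^sub>R (s *\<^sub>R w)) (s *\<^sub>R w) (s *\<^sub>R w) / 2"
        using Taylor2[of p "s *\<^sub>R w"] B e(2) by blast
      have q: "p + t *\<^sub>R (s *\<^sub>R w) \<in> U" "D2 r (p + t *\<^sub>R (s *\<^sub>R w)) w w < 0"
        using B[of t] t e(2) by auto
      have "D2 r (p + t *\<^sub>R (s *\<^sub>R w)) (s *\<^sub>R w) (s *\<^sub>R w) = s * (s * D2 r (p + t *\<^sub>R (s *\<^sub>R w)) w w)"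
        by (simp only: linear_scale[OF linear2_left[OF q(1)]] linear_scale[OF linear2[OF q(1)]] real_scaleR_def)
      also have "\<dots> < 0" using q(2) elim by (simp add: mult_less_0_iff)
      finally have "r (p + s *\<^sub>R w) < 0"
        using t(3) w(1) by (simp add: r_p linear_scale[OF linear1[OF p_U]])
      moreover have "p + s *\<^sub>R w \<in> U" using B[of 1] e(2) by auto
      ultimately show ?case using in_U by blast
    qed
  qed
  have m: "D1 r p (- v) = 0" "D2 r p (- v) (- v) = D2 r p v v"
    using v by (simp_all add: linear_neg[OF linear1[OF p_U]] linear_neg[OF linear2[OF p_U]] linear_neg[OF linear2_left[OF p_U]])
  have "\<forall>\<^sub>F s in at_right 0. p + s *\<^sub>R v \<in> \<Omega>" "\<forall>\<^sub>F s in at_right 0. p + s *\<^sub>R (- v) \<in> \<Omega>"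
    using *[of v] *[of "- v"] neg v m by auto
  then have "\<forall>\<^sub>F s in at_right 0. p + s *\<^sub>R v \<in> \<Omega> \<and> p + s *\<^sub>R (- v) \<in> \<Omega>" by (rule eventually_conj)
  then obtain s where "p + s *\<^sub>R v \<in> \<Omega>" "p + s *\<^sub>R (- v) \<in> \<Omega>"
    using eventually_happens' trivial_limit_at_right_real by fastforce
  then have "(1/2) *\<^sub>R (p + s *\<^sub>R v) + (1/2) *\<^sub>R (p + s *\<^sub>R (- v)) \<in> \<Omega>"
    by (intro convexD[OF convex_\<Omega>]) auto
  then show False using p_notin by (simp add: algebra_simps flip: scaleR_left_distrib)
qed

end

text \<open>Twice the complex linear part of the differential of \<open>r\<close>. The real part is the differential itself, the
  kernel is the complex tangent space.\<close>

definition complex_gradient :: "(complex ^ 'd \<Rightarrow> real) \<Rightarrow> complex ^ 'd \<Rightarrow> complex ^ 'd \<Rightarrow> complex"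
  where "complex_gradient r q x = of_real (D1 r q x) - \<i> * of_real (D1 r q (\<i> *s x))"

lemma real_coordinates: "(v :: complex ^ 'd) = (\<Sum>j\<in>UNIV. Re (v $ j) *\<^sub>R axis j 1 + Im (v $ j) *\<^sub>R axis j \<i>)"
proof -
  have "Re (v $ j) *\<^sub>R axis j 1 + Im (v $ j) *\<^sub>R axis j \<i> = (v $ j) *s axis j (1::complex)" for j
    by (simp add: vec_eq_iff axis_def complex_eq_iff)
  then show ?thesis by (simp add: basis_expansion)
qed

lemma sum_add_mult: "(\<Sum>j\<in>I. a j + c * b j) = sum a I + c * sum b I" for c :: complex
  by (simp add: sum.distrib sum_distrib_left)

lemma
  fixes F :: "complex ^ 'd \<Rightarrow> complex"
  assumes "linear F"
  shows sum_wirtinger: "(\<Sum>j\<in>UNIV. (F (axis j 1) - \<i> * F (axis j \<i>)) * v $ j) = F v - \<i> * F (\<i> *s v)"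
    and sum_wirtinger_bar: "(\<Sum>j\<in>UNIV. (F (axis j 1) + \<i> * F (axis j \<i>)) * cnj (v $ j)) = F v + \<i> * F (\<i> *s v)"
proof -
  have ex: "F v = (\<Sum>j\<in>UNIV. of_real (Re (v $ j)) * F (axis j 1) + of_real (Im (v $ j)) * F (axis j \<i>))" for v
    by (subst real_coordinates) (simp add: linear_sum[OF assms] linear_add[OF assms] linear_scale[OF assms] scaleR_conv_of_real[where 'a = complex])
  have iv: "F (\<i> *s v) = (\<Sum>j\<in>UNIV. - of_real (Im (v $ j)) * F (axis j 1) + of_real (Re (v $ j)) * F (axis j \<i>))"
    by (subst ex) simp
  have "F v - \<i> * F (\<i> *s v) = (\<Sum>j\<in>UNIV. of_real (Re (v $ j)) * F (axis j 1) + of_real (Im (v $ j)) * F (axis j \<i>)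
      - \<i> * (- of_real (Im (v $ j)) * F (axis j 1) + of_real (Re (v $ j)) * F (axis j \<i>)))"
    unfolding ex[of v] iv by (simp only: sum_distrib_left sum_subtractf)
  also have "\<dots> = (\<Sum>j\<in>UNIV. (F (axis j 1) - \<i> * F (axis j \<i>)) * v $ j)"
    by (intro sum.cong refl) (simp add: complex_eq_iff algebra_simps)
  finally show "(\<Sum>j\<in>UNIV. (F (axis j 1) - \<i> * F (axis j \<i>)) * v $ j) = F v - \<i> * F (\<i> *s v)" by simp
  have "F v + \<i> * F (\<i> *s v) = (\<Sum>j\<in>UNIV. of_real (Re (v $ j)) * F (axis j 1) + of_real (Im (v $ j)) * F (axis j \<i>)
      + \<i> * (- of_real (Im (v $ j)) * F (axis j 1) + of_real (Re (v $ j)) * F (axis j \<i>)))"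
    unfolding ex[of v] iv by (rule sum_add_mult[symmetric])
  also have "\<dots> = (\<Sum>j\<in>UNIV. (F (axis j 1) + \<i> * F (axis j \<i>)) * cnj (v $ j))"
    by (intro sum.cong refl) (simp add: complex_eq_iff algebra_simps)
  finally show "(\<Sum>j\<in>UNIV. (F (axis j 1) + \<i> * F (axis j \<i>)) * cnj (v $ j)) = F v + \<i> * F (\<i> *s v)" by simp
qed

lemma i_smult_i: "\<i> *s (\<i> *s v) = - (v :: complex ^ 'd)"
  by (simp add: vector_smult_assoc vector_sneg_minus1[symmetric])

lemma complex_functional_complex_gradient:
  assumes "r differentiable (at q)" shows "complex_functional (complex_gradient r q)"
proof -
  have l: "linear (D1 r q)" by (rule linear_D1[OF assms])
  have li: "D1 r q (\<i> *s (a *\<^sub>R x + y)) = a * D1 r q (\<i> *s x) + D1 r q (\<i> *s y)" for a x y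
  proof -
    have "\<i> *s (a *\<^sub>R x + y) = a *\<^sub>R (\<i> *s x) + \<i> *s y"
      by (simp add: scaleR_eq_smult vec_eq_iff algebra_simps)
    then show ?thesis by (simp add: linear_add[OF l] linear_scale[OF l])
  qed
  have lin: "linear (complex_gradient r q)"
    using li[of 1] li[of _ _ 0]
    by (intro linearI) (auto simp: complex_gradient_def linear_add[OF l] linear_scale[OF l] linear_0[OF l] scaleR_conv_of_real[where 'a = complex] algebra_simps)
  have i: "complex_gradient r q (\<i> *s x) = \<i> * complex_gradient r q x" for x
    by (simp add: complex_gradient_def i_smult_i linear_neg[OF l] complex_eq_iff)
  have "complex_gradient r q (c *s x) = c * complex_gradient r q x" for c x
  proof -
    have "c *s x = Re c *\<^sub>R x + Im c *\<^sub>R (\<i> *s x)"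
      by (simp add: vec_eq_iff complex_eq_iff)
    then have "complex_gradient r q (c *s x) = of_real (Re c) * complex_gradient r q x + of_real (Im c) * (\<i> * complex_gradient r q x)"
      by (simp add: linear_add[OF lin] linear_scale[OF lin] i scaleR_conv_of_real[where 'a = complex])
    also have "\<dots> = (of_real (Re c) + \<i> * of_real (Im c)) * complex_gradient r q x" by (simp add: algebra_simps)
    finally show ?thesis by (simp add: complex_eq[symmetric])
  qed
  then show ?thesis using lin unfolding complex_functional_def by blast
qed

lemma Re_complex_gradient: "Re (complex_gradient r q x) = D1 r q x" by (simp add: complex_gradient_def)

lemma has_derivative_of_real:
  "(g has_derivative g') F \<Longrightarrow> ((\<lambda>z. complex_of_real (g z)) has_derivative (\<lambda>v. of_real (g' v))) F"
  by (rule bounded_linear.has_derivative[OF bounded_linear_of_real])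

lemma complex_tangent_space_iff:
  assumes "r differentiable (at p)"
  shows "v \<in> complex_tangent_space r p \<longleftrightarrow> complex_gradient r p v = 0"
proof -
  have *: "frechet_derivative (\<lambda>z. complex_of_real (r z)) (at p) w = of_real (D1 r p w)" for w
    using frechet_derivative_at[OF has_derivative_of_real[OF has_derivative_D1[OF assms]]] by metis
  have "linear (\<lambda>w. complex_of_real (D1 r p w))"
    using linear_D1[OF assms] by (intro linearI) (simp_all add: linear_add linear_scale scaleR_conv_of_real[where 'a = complex])
  from sum_wirtinger[OF this, of v]
  have "(\<Sum>j\<in>UNIV. dz j (\<lambda>z. complex_of_real (r z)) p * v $ j) = complex_gradient r p v / 2"
    unfolding dz_def * by (simp add: complex_gradient_def sum_divide_distrib[symmetric])
  then show ?thesis by (simp only: complex_tangent_space_def mem_Collect_eq divide_eq_0_iff) simp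
qed

text \<open>The two mixed second derivatives carry a factor \<open>\<i>\<close> and drop out of the real part.\<close>

lemma levi_form_eq:
  fixes p :: "complex ^ 'd"
  assumes "C2_fun U r" and p: "p \<in> U"
  shows "levi_form r p v = (D2 r p v v + D2 r p (\<i> *s v) (\<i> *s v)) / 4"
proof -
  interpret C2_fun U r by fact
  let ?c = "\<lambda>z. complex_of_real (r z)"
  have 1: "dzbar k ?c q = (of_real (D1 r q (axis k 1)) + \<i> * of_real (D1 r q (axis k \<i>))) / 2" if "q \<in> U" for k q
    unfolding dzbar_def
    using frechet_derivative_at[OF has_derivative_of_real[OF has_derivative_D1[OF diff1[OF that]]]] by metis
  have 2: "frechet_derivative (dzbar k ?c) (at p) w
      = (of_real (D2 r p (axis k 1) w) + \<i> * of_real (D2 r p (axis k \<i>) w)) / 2" for k w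
  proof -
    have a: "((\<lambda>q. D1 r q x) has_derivative D2 r p x) (at p)" for x
      unfolding D2_def by (rule has_derivative_D1[OF diff2[OF p]])
    have "((\<lambda>q. (of_real (D1 r q (axis k 1)) + \<i> * of_real (D1 r q (axis k \<i>))) / 2) has_derivative
        (\<lambda>w. (of_real (D2 r p (axis k 1) w) + \<i> * of_real (D2 r p (axis k \<i>) w)) / 2)) (at p)"
      by (intro bounded_linear.has_derivative[OF bounded_linear_divide] has_derivative_add has_derivative_mult_right has_derivative_of_real a)
    then have d: "(dzbar k ?c has_derivative
        (\<lambda>w. (of_real (D2 r p (axis k 1) w) + \<i> * of_real (D2 r p (axis k \<i>) w)) / 2)) (at p)"
      by (rule has_derivative_transform_within_open[OF _ open_U p]) (simp add: 1)
    show ?thesis unfolding frechet_derivative_at[OF d, symmetric] ..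
  qed
  define F where "F = (\<lambda>w. complex_of_real (D2 r p v w) + \<i> * of_real (D2 r p (\<i> *s v) w))"
  have 3: "(\<Sum>k\<in>UNIV. frechet_derivative (dzbar k ?c) (at p) w * cnj (v $ k)) = F w / 2" for w
  proof -
    have "linear (\<lambda>x. complex_of_real (D2 r p x w))"
      by (intro linearI) (simp_all add: D2_add_left[OF p] D2_scaleR_left[OF p] scaleR_conv_of_real[where 'a = complex])
    from sum_wirtinger_bar[OF this, of v] show ?thesis
      unfolding 2 F_def by (simp add: sum_divide_distrib[symmetric])
  qed
  have linF: "linear F"
    unfolding F_def
    by (intro linearI) (simp_all add: linear_add[OF linear2[OF p]] linear_scale[OF linear2[OF p]] scaleR_conv_of_real[where 'a = complex] algebra_simps)
  have "(\<Sum>j\<in>UNIV. \<Sum>k\<in>UNIV. dz j (dzbar k ?c) p * v $ j * cnj (v $ k))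
      = (\<Sum>j\<in>UNIV. ((F (axis j 1) - \<i> * F (axis j \<i>)) / 4) * v $ j)"
  proof (rule sum.cong[OF refl])
    fix j
    have "(\<Sum>k\<in>UNIV. dz j (dzbar k ?c) p * v $ j * cnj (v $ k))
        = ((\<Sum>k\<in>UNIV. frechet_derivative (dzbar k ?c) (at p) (axis j 1) * cnj (v $ k))
          - \<i> * (\<Sum>k\<in>UNIV. frechet_derivative (dzbar k ?c) (at p) (axis j \<i>) * cnj (v $ k))) / 2 * v $ j"
      unfolding dz_def sum_distrib_left sum_subtractf[symmetric] sum_divide_distrib sum_distrib_right
      by (intro sum.cong refl) (simp add: algebra_simps)
    then show "(\<Sum>k\<in>UNIV. dz j (dzbar k ?c) p * v $ j * cnj (v $ k))
      = ((F (axis j 1) - \<i> * F (axis j \<i>)) / 4) * v $ j"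
      unfolding 3 by (simp add: algebra_simps)
  qed
  also have "\<dots> = (F v - \<i> * F (\<i> *s v)) / 4"
    using sum_wirtinger[OF linF, of v] by (simp add: sum_divide_distrib[symmetric])
  finally have "levi_form r p v = Re ((F v - \<i> * F (\<i> *s v)) / 4)"
    unfolding levi_form_def by (simp only:)
  then show ?thesis by (simp add: F_def)
qed



section \<open>Quadratic model domains\<close>

text \<open>The unbounded realization of the ball: with \<open>a = cinner X u\<close> and \<open>X' = X - a *s u\<close> for a unit vector \<open>u\<close>, the
  inequality says \<open>Re a + (norm X')\<^sup>2 < 0\<close>.\<close>

definition siegel :: "complex ^ 'd \<Rightarrow> (complex ^ 'd) set"
  where "siegel u = {X. Re (cinner X u) + (norm X)\<^sup>2 - (cmod (cinner X u))\<^sup>2 < 0}"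

text \<open>This is the Cayley transform \<open>(a, X') \<mapsto> ((1 + a) / (1 - a), 2 * X' / (1 - a))\<close>, written without splitting \<open>X\<close>.\<close>

lemma siegel_biholomorphic_ball:
  assumes u: "norm u = 1"
  shows "biholomorphism (\<lambda>X. (2 / (1 - cinner X u)) *s X + u) (siegel u) (ball 0 1)"
proof -
  have uu: "cinner u u = 1" by (simp add: cinner_self u)
  define C where "C = (\<lambda>X. (2 / (1 - cinner X u)) *s X + u)"
  define E where "E = (\<lambda>Y. (1 / (1 + cinner Y u)) *s (Y - u))"
  have Re_neg: "Re (cinner X u) < 0" if "X \<in> siegel u" for X
  proof -
    have "(cmod (cinner X u))\<^sup>2 \<le> (norm X)\<^sup>2" using norm_cinner_le[of X u] u by (intro power_mono) auto
    moreover have "Re (cinner X u) + (norm X)\<^sup>2 - (cmod (cinner X u))\<^sup>2 < 0"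
      using that by (simp only: siegel_def mem_Collect_eq)
    ultimately show ?thesis by linarith
  qed
  have ne1: "1 - cinner X u \<noteq> 0" if "X \<in> siegel u" for X
  proof
    assume "1 - cinner X u = 0"
    then have "cinner X u = 1" by simp
    then show False using Re_neg[OF that] by simp
  qed
  have ne2: "1 + cinner Y u \<noteq> 0" if "Y \<in> ball 0 1" for Y
  proof
    assume "1 + cinner Y u = 0"
    then have "cinner Y u = -1" by (simp add: add_eq_0_iff)
    then show False using norm_cinner_le[of Y u] that u by simp
  qed
  have norm_eq: "(norm (2 *s X + (1 - a) *s u))\<^sup>2 - (cmod (1 - a))\<^sup>2 = 4 * (Re a + (norm X)\<^sup>2 - (cmod a)\<^sup>2)"
    if a: "a = cinner X u" for X a
  proof -
    have ux: "cinner u X = cnj a" using cnj_cinner[of X u] a by simp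
    have "cinner (2 *s X + (1 - a) *s u) (2 *s X + (1 - a) *s u)
        = 4 * cinner X X + 2 * (a * cnj (1 - a) + cnj a * (1 - a)) + (1 - a) * cnj (1 - a)"
      unfolding cinner_simps ux a[symmetric] uu by (simp add: algebra_simps)
    then have "of_real ((norm (2 *s X + (1 - a) *s u))\<^sup>2)
        = of_real (4 * (norm X)\<^sup>2) + 2 * (a * cnj (1 - a) + cnj a * (1 - a)) + of_real ((cmod (1 - a))\<^sup>2)"
      unfolding cinner_self complex_norm_square[symmetric] by simp
    then have "(norm (2 *s X + (1 - a) *s u))\<^sup>2
        = 4 * (norm X)\<^sup>2 + Re (2 * (a * cnj (1 - a) + cnj a * (1 - a))) + (cmod (1 - a))\<^sup>2"
      by (metis Re_complex_of_real plus_complex.simps(1))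
    also have "Re (2 * (a * cnj (1 - a) + cnj a * (1 - a))) = 4 * Re a - 4 * (cmod a)\<^sup>2"
      unfolding cmod_power2 by (simp add: power2_eq_square algebra_simps)
    finally show ?thesis by simp
  qed
  have C_in: "C X \<in> ball 0 1 \<longleftrightarrow> X \<in> siegel u" if "1 - cinner X u \<noteq> 0" for X
  proof -
    define a where "a = cinner X u"
    have a: "1 - a \<noteq> 0" using that by (simp add: a_def)
    have "C X = (1 / (1 - a)) *s (2 *s X + (1 - a) *s u)"
    proof -
      have "1 / (1 - a) * 2 = 2 / (1 - a)" "1 / (1 - a) * (1 - a) = 1" using a by simp_all
      then show ?thesis
        by (simp only: C_def a_def[symmetric] vector_add_ldistrib vector_smult_assoc vector_smult_lid)
    qed
    then have "norm (C X) = norm (2 *s X + (1 - a) *s u) / cmod (1 - a)"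
      by (simp only: norm_smult norm_divide norm_one) simp
    moreover have "0 < cmod (1 - a)" using a by simp
    ultimately have "norm (C X) < 1 \<longleftrightarrow> norm (2 *s X + (1 - a) *s u) < cmod (1 - a)"
      by (simp only: pos_divide_less_eq mult_1)
    also have "\<dots> \<longleftrightarrow> (norm (2 *s X + (1 - a) *s u))\<^sup>2 < (cmod (1 - a))\<^sup>2"
      by (meson norm_ge_zero power2_less_imp_less power_strict_mono zero_less_numeral)
    also have "\<dots> \<longleftrightarrow> X \<in> siegel u" using norm_eq[OF a_def] by (auto simp: siegel_def a_def)
    finally show ?thesis by simp
  qed
  have cC: "cinner (C X) u = 2 * cinner X u / (1 - cinner X u) + 1" for X
    by (simp add: C_def cinner_simps uu)
  have cE: "cinner (E Y) u = (cinner Y u - 1) / (1 + cinner Y u)" for Y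
    by (simp add: E_def cinner_simps uu diff_divide_distrib)
  have EC: "E (C X) = X" if "1 - cinner X u \<noteq> 0" for X
  proof -
    have "1 + cinner (C X) u = 2 / (1 - cinner X u)" using that by (simp add: cC field_simps)
    then have "E (C X) = (1 / (2 / (1 - cinner X u))) *s (C X - u)" unfolding E_def by (simp only:)
    also have "C X - u = (2 / (1 - cinner X u)) *s X" by (simp add: C_def)
    also have "(1 / (2 / (1 - cinner X u))) *s ((2 / (1 - cinner X u)) *s X) = X"
    proof -
      have "1 / (2 / (1 - cinner X u)) * (2 / (1 - cinner X u)) = 1" using that by simp
      then show ?thesis by (simp only: vector_smult_assoc vector_smult_lid)
    qed
    finally show ?thesis .
  qed
  have CE: "C (E Y) = Y" if "1 + cinner Y u \<noteq> 0" for Y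
  proof -
    have "1 - cinner (E Y) u = 2 / (1 + cinner Y u)" using that by (simp add: cE field_simps)
    then have "2 / (1 - cinner (E Y) u) = 1 + cinner Y u" using that by simp
    then have "C (E Y) = (1 + cinner Y u) *s E Y + u" unfolding C_def by (simp only:)
    also have "(1 + cinner Y u) *s E Y = Y - u"
    proof -
      have "(1 + cinner Y u) * (1 / (1 + cinner Y u)) = 1" using that by simp
      then show ?thesis unfolding E_def by (simp only: vector_smult_assoc vector_smult_lid)
    qed
    finally show ?thesis by simp
  qed
  have neE: "1 - cinner (E Y) u \<noteq> 0" if "1 + cinner Y u \<noteq> 0" for Y
  proof -
    have "1 - cinner (E Y) u = 2 / (1 + cinner Y u)" using that by (simp add: cE field_simps)
    then show ?thesis using that by simp
  qed
  note lin = holomorphic_fun_functional[OF complex_functional_cinner]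
  have "biholomorphism C (siegel u) (ball 0 1)"
  proof (rule biholomorphismI[of _ _ _ E])
    have "holomorphic_fun (\<lambda>X. 1 + (-1) * cinner X u) (siegel u)"
      by (intro holomorphic_fun_add holomorphic_fun_mult holomorphic_fun_const lin)
    then have "holomorphic_fun (\<lambda>X. 2 * (1 / (1 + (-1) * cinner X u))) (siegel u)"
      using ne1 by (intro holomorphic_fun_mult holomorphic_fun_const holomorphic_fun_inverse) auto
    then have "holomorphic_fun (\<lambda>X. 2 / (1 - cinner X u)) (siegel u)" by simp
    then show "holomorphic_map C (siegel u)" unfolding C_def
      by (intro holomorphic_map_add holomorphic_map_smult holomorphic_map_id holomorphic_map_const)
    have "holomorphic_fun (\<lambda>X. 1 + cinner X u) (ball 0 1)"
      by (intro holomorphic_fun_add holomorphic_fun_const lin)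
    then have "holomorphic_fun (\<lambda>X. 1 / (1 + cinner X u)) (ball 0 1)"
      using ne2 by (intro holomorphic_fun_inverse) auto
    moreover have "holomorphic_map (\<lambda>Y. Y + (- u)) (ball 0 1)"
      by (intro holomorphic_map_add holomorphic_map_id holomorphic_map_const)
    then have "holomorphic_map (\<lambda>Y. Y - u) (ball 0 1)" by simp
    ultimately show "holomorphic_map E (ball 0 1)" unfolding E_def by (intro holomorphic_map_smult)
    show "C X \<in> ball 0 1 \<and> E (C X) = X" if "X \<in> siegel u" for X
      using C_in[OF ne1[OF that]] EC[OF ne1[OF that]] that by simp
    show "E Y \<in> siegel u \<and> C (E Y) = Y" if "Y \<in> ball 0 1" for Y
      using C_in[OF neE[OF ne2[OF that]]] CE[OF ne2[OF that]] that by simp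
  qed simp
  then show ?thesis by (simp add: C_def)
qed

lemma open_siegel: "open (siegel u)"
proof -
  have "continuous_on UNIV (\<lambda>X. cinner X u)"
    by (intro linear_continuous_on complex_functional_bounded_linear complex_functional_cinner)
  then show ?thesis unfolding siegel_def
    by (intro open_Collect_less continuous_intros)
qed

text \<open>The limits of the rescalings at a strongly pseudoconvex point: \<open>\<beta>\<close> is the real Hessian and \<open>l\<close> the complex
  gradient of a defining function. The constant is normalized such that \<open>0\<close> is an interior point.\<close>

locale quadratic_model =
  fixes \<beta> :: "complex ^ 'd \<Rightarrow> complex ^ 'd \<Rightarrow> real" and l :: "complex ^ 'd \<Rightarrow> complex" and \<nu> :: "complex ^ 'd"
  assumes lin1: "\<And>y. linear (\<lambda>x. \<beta> x y)" and lin2: "\<And>x. linear (\<beta> x)"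
    and l: "complex_functional l" and l\<nu>: "l \<nu> = 1"
    and nonneg: "\<And>x. l x = 0 \<Longrightarrow> 0 \<le> \<beta> x x"
    and levi: "\<And>x. l x = 0 \<Longrightarrow> x \<noteq> 0 \<Longrightarrow> 0 < \<beta> x x + \<beta> (\<i> *s x) (\<i> *s x)"
begin

definition P where "P x = x - l x *s \<nu>"

definition F where "F x = Re (l x) + \<beta> (P x) (P x) / 2"

definition D where "D = {x. F x < 1}"

lemma l_P: "l (P x) = 0"
  by (simp add: P_def complex_functional_diff[OF l] complex_functional_smult[OF l] l\<nu>)

lemma P_linear: "complex_linear_map P"
  unfolding complex_linear_map_def P_def
  by (auto intro!: linearI simp: complex_functional_add[OF l] complex_functional_smult[OF l]
      complex_functional_scaleR[OF l] scaleR_eq_smult scaleR_conv_of_real[where 'a = complex] vec_eq_iff algebra_simps)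

lemma P_\<nu>: "P \<nu> = 0" by (simp add: P_def l\<nu>)

lemma F_convex: assumes "0 \<le> s" "0 \<le> t" "s + t = 1"
  shows "F (s *\<^sub>R x + t *\<^sub>R y) \<le> s * F x + t * F y"
proof -
  define X Y where "X = P x" and "Y = P y"
  have P: "P (s *\<^sub>R x + t *\<^sub>R y) = s *\<^sub>R X + t *\<^sub>R Y"
    by (simp add: X_def Y_def complex_linear_map_add[OF P_linear] complex_linear_map_scaleR[OF P_linear])
  have "l (X - Y) = 0" by (simp add: X_def Y_def complex_functional_diff[OF l] l_P)
  then have n: "0 \<le> \<beta> (X - Y) (X - Y)" by (rule nonneg)
  have e: "\<beta> (X - Y) (X - Y) = \<beta> X X - \<beta> X Y - \<beta> Y X + \<beta> Y Y"
    by (simp add: linear_diff[OF lin1] linear_diff[OF lin2])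
  have "\<beta> (s *\<^sub>R X + t *\<^sub>R Y) (s *\<^sub>R X + t *\<^sub>R Y)
      = s * s * \<beta> X X + s * t * \<beta> X Y + t * s * \<beta> Y X + t * t * \<beta> Y Y"
    by (simp add: linear_add[OF lin1] linear_add[OF lin2] linear_scale[OF lin1] linear_scale[OF lin2] algebra_simps)
  also have "\<dots> = s * (s + t) * \<beta> X X + t * (s + t) * \<beta> Y Y - s * t * \<beta> (X - Y) (X - Y)"
    unfolding e by (simp add: algebra_simps)
  also have "\<dots> \<le> s * \<beta> X X + t * \<beta> Y Y" using assms n by simp
  finally show ?thesis
    unfolding F_def P X_def[symmetric] Y_def[symmetric]
    by (simp add: complex_functional_add[OF l] complex_functional_scaleR[OF l] algebra_simps)
qed

lemma F_zero: "F 0 = 0"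
  by (simp add: F_def complex_linear_map_zero[OF P_linear] complex_functional_zero[OF l] linear_0[OF lin2])

lemma zero_in_D: "0 \<in> D" by (simp add: D_def F_zero)

lemma convex_D: "convex D"
proof (rule convexI)
  fix x y :: "complex ^ 'd" and s t :: real
  assume xy: "x \<in> D" "y \<in> D" and st: "0 \<le> s" "0 \<le> t" "s + t = 1"
  have "s * F x + t * F y < 1" using xy st convex_bound_lt[of "F x" 1 "F y" s t] by (simp add: D_def)
  then show "s *\<^sub>R x + t *\<^sub>R y \<in> D" using F_convex[OF st, of x y] by (simp add: D_def)
qed

text \<open>As \<open>F\<close> is convex with \<open>F 0 = 0\<close>, shrinking \<open>x\<close> makes \<open>F\<close> less than \<open>1\<close>.\<close>

lemma le_one_closure: assumes "F x \<le> 1" shows "x \<in> closure D"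
proof -
  have "(\<lambda>n. (1 - 1 / real (n + 2)) *\<^sub>R x) \<longlonglongrightarrow> 1 *\<^sub>R x" by (intro tendsto_scaleR tendsto_const) real_asymp
  moreover have "(1 - 1 / real (n + 2)) *\<^sub>R x \<in> D" for n
  proof -
    have "F ((1 - 1 / real (n + 2)) *\<^sub>R x + (1 / real (n + 2)) *\<^sub>R 0) \<le> (1 - 1 / real (n + 2)) * F x + 1 / real (n + 2) * F 0"
      by (rule F_convex) auto
    also have "\<dots> \<le> (1 - 1 / real (n + 2)) * 1 + 1 / real (n + 2) * 0"
      using assms by (intro add_mono mult_left_mono) (auto simp: F_zero)
    also have "\<dots> < 1" by simp
    finally show ?thesis by (simp add: D_def)
  qed
  ultimately have "\<exists>f. (\<forall>n. f n \<in> D) \<and> f \<longlonglongrightarrow> x"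
    by (intro exI[of _ "\<lambda>n. (1 - 1 / real (n + 2)) *\<^sub>R x"]) simp
  then show "x \<in> closure D" by (simp only: closure_sequential)
qed

lemma continuous_F: "continuous_on S F"
proof -
  have lc: "continuous_on T g" if "linear g" for g :: "complex ^ 'd \<Rightarrow> real" and T
    using that by (intro linear_continuous_on) (simp add: linear_linear)
  have "\<beta> x x = (\<Sum>b\<in>Basis. (x \<bullet> b) * \<beta> b x)" for x
  proof -
    have "\<beta> x x = \<beta> (\<Sum>b\<in>Basis. (x \<bullet> b) *\<^sub>R b) x" by (simp add: euclidean_representation)
    then show ?thesis unfolding linear_sum[OF lin1] linear_scale[OF lin1] by simp
  qed
  then have "continuous_on T (\<lambda>x. \<beta> x x)" for T
    by (simp only:) (intro continuous_intros lc lin2)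
  then have "continuous_on S (\<lambda>x. \<beta> (P x) (P x))"
    using linear_continuous_on[OF complex_linear_map_bounded_linear[OF P_linear]]
    by (rule continuous_on_compose2[of UNIV]) auto
  then show ?thesis unfolding F_def
    by (intro continuous_intros linear_continuous_on[OF complex_functional_bounded_linear[OF l]]) auto
qed

lemma open_D: "open D"
  unfolding D_def by (intro open_Collect_less continuous_F continuous_on_const)

text \<open>Splitting the real quadratic form \<open>\<beta>\<close> into a Hermitian form \<open>herm\<close> and the real part of a
  holomorphic quadratic form \<open>quad\<close>, the latter is absorbed by a shear, which leaves the Siegel domain of the
  former.\<close>

definition sym where "sym x y = (\<beta> x y + \<beta> y x) / 2"

definition herm where "herm x y = Complex
  ((sym x y + sym (\<i> *s x) (\<i> *s y)) / 2) ((sym x (\<i> *s y) - sym (\<i> *s x) y) / 2)"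

definition quad where "quad x y = Complex
  ((sym x y - sym (\<i> *s x) (\<i> *s y)) / 2) (- (sym x (\<i> *s y) + sym (\<i> *s x) y) / 2)"

lemma sym_comm: "sym x y = sym y x" by (simp add: sym_def)

lemma sym_add: "sym (x + y) z = sym x z + sym y z"
  by (simp add: sym_def linear_add[OF lin1] linear_add[OF lin2] add_divide_distrib)

lemma sym_scale: "sym (c *\<^sub>R x) z = c * sym x z"
  by (simp add: sym_def linear_scale[OF lin1] linear_scale[OF lin2] algebra_simps)

lemma sym_neg: "sym (- x) z = - sym x z" "sym x (- z) = - sym x z"
proof -
  show *: "sym (- x) z = - sym x z" for x z using sym_scale[of "-1" x z] by simp
  show "sym x (- z) = - sym x z" using *[of z x] sym_comm by metis
qed

lemma complex_homogeneous:
  fixes g :: "complex ^ 'd \<Rightarrow> complex"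
  assumes add: "\<And>x y. g (x + y) = g x + g y" and scale: "\<And>t x. g (t *\<^sub>R x) = of_real t * g x"
    and i: "\<And>x. g (\<i> *s x) = \<i> * g x"
  shows "g (c *s x) = c * g x"
proof -
  have "c *s x = Re c *\<^sub>R x + Im c *\<^sub>R (\<i> *s x)" by (simp add: vec_eq_iff complex_eq_iff)
  then have "g (c *s x) = (of_real (Re c) + \<i> * of_real (Im c)) * g x"
    by (simp only: add scale i) (simp add: algebra_simps)
  then show ?thesis by (simp add: complex_eq[symmetric])
qed

lemma i_add: "\<i> *s (x + y) = \<i> *s x + \<i> *s (y :: complex ^ 'd)" by (rule vector_add_ldistrib)

lemma i_scale: "\<i> *s (t *\<^sub>R x) = t *\<^sub>R (\<i> *s (x :: complex ^ 'd))"
  by (simp add: scaleR_eq_smult vector_smult_assoc mult.commute)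

lemma herm_add: "herm (x + y) z = herm x z + herm y z"
  by (simp add: herm_def i_add sym_add complex_eq_iff field_simps)

lemma herm_smult: "herm (c *s x) z = c * herm x z"
proof (rule complex_homogeneous[of "\<lambda>x. herm x z"])
  show "herm (\<i> *s x) z = \<i> * herm x z" for x
    by (simp add: herm_def i_smult_i sym_neg complex_eq_iff field_simps)
  show "herm (t *\<^sub>R x) z = of_real t * herm x z" for t x
    by (simp add: herm_def i_scale sym_scale complex_eq_iff algebra_simps)
qed (rule herm_add)

lemma cnj_herm: "cnj (herm x y) = herm y x"
  by (simp add: herm_def complex_eq_iff sym_comm[of y] field_simps) (simp add: sym_comm[of "\<i> *s y"])

lemma herm_self: "herm x x = of_real ((\<beta> x x + \<beta> (\<i> *s x) (\<i> *s x)) / 2)"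
  by (simp add: herm_def sym_def complex_eq_iff)

lemma quad_comm: "quad x y = quad y x"
  by (simp add: quad_def complex_eq_iff sym_comm)

lemma quad_add: "quad (x + y) z = quad x z + quad y z"
  by (simp add: quad_def i_add sym_add complex_eq_iff field_simps)

lemma quad_smult: "quad (c *s x) z = c * quad x z"
proof (rule complex_homogeneous[of "\<lambda>x. quad x z"])
  show "quad (\<i> *s x) z = \<i> * quad x z" for x
    by (simp add: quad_def i_smult_i sym_neg complex_eq_iff field_simps)
  show "quad (t *\<^sub>R x) z = of_real t * quad x z" for t x
    by (simp add: quad_def i_scale sym_scale complex_eq_iff field_simps)
qed (rule quad_add)

lemma \<beta>_split: "\<beta> x x = Re (herm x x) + Re (quad x x)"
  by (simp add: herm_self quad_def sym_def field_simps)

lemma holomorphic_quad: "holomorphic_fun (\<lambda>y. quad (P y) (P y)) S"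
proof -
  have zero: "quad 0 z = 0" for z using quad_smult[of 0 0 z] by simp
  have sum1: "quad (\<Sum>i\<in>I. f i) z = (\<Sum>i\<in>I. quad (f i) z)" for f :: "'d \<Rightarrow> complex ^ 'd" and I z
    by (induction I rule: infinite_finite_induct) (auto simp: zero quad_add)
  have ex: "quad x z = (\<Sum>i\<in>UNIV. x $ i * quad (axis i 1) z)" for x z
  proof -
    have "quad x z = quad (\<Sum>i\<in>UNIV. (x $ i) *s axis i 1) z" by (simp add: basis_expansion)
    then show ?thesis unfolding sum1 quad_smult .
  qed
  have ex2: "quad x x = (\<Sum>i\<in>UNIV. x $ i * (\<Sum>j\<in>UNIV. x $ j * quad (axis j 1) (axis i 1)))" for x
    unfolding ex[of x x] quad_comm[of "axis _ 1" x] ex[of x "axis _ 1"] ..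
  have nth: "holomorphic_fun (\<lambda>y. P y $ i) S" for i
  proof (intro holomorphic_fun_functional)
    have "complex_functional (\<lambda>x. x $ i)" unfolding complex_functional_def by (auto intro!: linearI)
    from complex_functional_compose[OF this P_linear] show "complex_functional (\<lambda>y. P y $ i)" .
  qed
  show ?thesis unfolding ex2
    by (intro holomorphic_fun_sum holomorphic_fun_mult holomorphic_fun_const nth finite)
qed

text \<open>The Hermitian form \<open>h\<close> becomes the standard one in suitable linear coordinates; there \<open>\<nu>\<close> is a unit vector \<open>u\<close>, \<open>l\<close> is
  the product with \<open>u\<close>, and the sheared domain is \<open>siegel u\<close>.\<close>

lemma biholomorphic_ball: "\<exists>\<phi>. biholomorphism \<phi> D (ball 0 1) \<and> \<phi> 0 = 0"
proof -
  define h where "h = (\<lambda>x y. l x * cnj (l y) + herm (P x) (P y) / 2)"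
  have "\<exists>A B. complex_linear_map A \<and> complex_linear_map B \<and> (\<forall>x. A (B x) = x) \<and> (\<forall>x. B (A x) = x)
      \<and> (\<forall>x y. h x y = cinner (A x) (A y))"
  proof (rule hermitian_diagonalization[of h])
    show "h (x + y) z = h x z + h y z" for x y z
      by (simp add: h_def complex_functional_add[OF l] complex_linear_map_add[OF P_linear] herm_add algebra_simps add_divide_distrib)
    show "h (c *s x) z = c * h x z" for c x z
      by (simp add: h_def complex_functional_smult[OF l] complex_linear_map_smult[OF P_linear] herm_smult algebra_simps)
    show "cnj (h x y) = h y x" for x y by (simp add: h_def cnj_herm)
    show "0 < Re (h x x)" if "x \<noteq> 0" for x
    proof -
      have e: "Re (h x x) = (cmod (l x))\<^sup>2 + (\<beta> (P x) (P x) + \<beta> (\<i> *s P x) (\<i> *s P x)) / 4"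
        unfolding h_def complex_norm_square[symmetric] herm_self by simp
      have il: "l (\<i> *s P x) = 0" by (simp add: complex_functional_smult[OF l] l_P)
      have nn: "0 \<le> \<beta> (P x) (P x)" "0 \<le> \<beta> (\<i> *s P x) (\<i> *s P x)" using nonneg l_P il by auto
      show ?thesis
      proof (cases "l x = 0")
        case True
        then have "P x = x" by (simp add: P_def)
        then show ?thesis using levi[OF True that] unfolding e by (simp add: True)
      next
        case False
        then have "0 < (cmod (l x))\<^sup>2" by simp
        then show ?thesis using nn unfolding e by (intro add_pos_nonneg) auto
      qed
    qed
  qed blast
  then obtain A B where lin: "complex_linear_map A" "complex_linear_map B"
    and inv: "\<And>x. A (B x) = x" "\<And>x. B (A x) = x" and h: "\<And>x y. h x y = cinner (A x) (A y)" by blast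
  define u where "u = A \<nu>"
  have hz: "herm x 0 = 0" for x using cnj_herm[of 0 x] herm_smult[of 0 0 x] by simp
  have lu: "cinner (A x) u = l x" for x
    by (simp add: u_def h[symmetric] h_def l\<nu> P_\<nu> hz)
  have "cinner u u = 1" using lu[of \<nu>] by (simp add: u_def l\<nu>)
  then have "complex_of_real ((norm u)\<^sup>2) = of_real 1" unfolding cinner_self by simp
  then have "(norm u)\<^sup>2 = 1" by (simp only: of_real_eq_iff)
  then have u: "norm u = 1" using norm_ge_zero[of u] by (simp add: power2_eq_1_iff)
  have nA: "(norm (A x))\<^sup>2 - (cmod (cinner (A x) u))\<^sup>2 = Re (herm (P x) (P x)) / 2" for x
  proof -
    have "complex_of_real ((norm (A x))\<^sup>2) = l x * cnj (l x) + herm (P x) (P x) / 2"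
      unfolding cinner_self[symmetric] h[symmetric] h_def ..
    also have "l x * cnj (l x) = of_real ((cmod (l x))\<^sup>2)" by (rule complex_norm_square[symmetric])
    finally have "(norm (A x))\<^sup>2 = (cmod (l x))\<^sup>2 + Re (herm (P x) (P x)) / 2"
      by (metis Re_complex_of_real Re_divide_numeral plus_complex.simps(1))
    then show ?thesis by (simp add: lu)
  qed
  define g where "g = (\<lambda>y. quad (P y) (P y) / 2 - 1)"
  define \<Psi> where "\<Psi> = (\<lambda>y. A (y + g y *s \<nu>))"
  define \<Theta> where "\<Theta> = (\<lambda>X. B X + (- g (B X)) *s \<nu>)"
  have Pg: "P (y + c *s \<nu>) = P y" for y c
    by (simp add: complex_linear_map_add[OF P_linear] complex_linear_map_smult[OF P_linear] P_\<nu>)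
  then have gg: "g (y + c *s \<nu>) = g y" for y c by (simp add: g_def)
  have mem: "\<Psi> y \<in> siegel u \<longleftrightarrow> y \<in> D" for y
  proof -
    have "l (y + g y *s \<nu>) = l y + g y"
      by (simp add: complex_functional_add[OF l] complex_functional_smult[OF l] l\<nu>)
    moreover have "\<Psi> y \<in> siegel u \<longleftrightarrow> Re (l (y + g y *s \<nu>))
        + ((norm (A (y + g y *s \<nu>)))\<^sup>2 - (cmod (cinner (A (y + g y *s \<nu>)) u))\<^sup>2) < 0"
      by (simp add: siegel_def \<Psi>_def lu algebra_simps)
    ultimately have "\<Psi> y \<in> siegel u \<longleftrightarrow> Re (l y + g y) + Re (herm (P y) (P y)) / 2 < 0"
      unfolding nA Pg by simp
    also have "\<dots> \<longleftrightarrow> y \<in> D" by (simp add: D_def F_def \<beta>_split g_def) argo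
    finally show ?thesis .
  qed
  have TP: "\<Theta> (\<Psi> y) = y" for y
    by (simp add: \<Theta>_def \<Psi>_def inv gg vec_eq_iff)
  have PT: "\<Psi> (\<Theta> X) = X" for X
  proof -
    have "g (\<Theta> X) = g (B X)" unfolding \<Theta>_def by (rule gg)
    then have "\<Theta> X + g (\<Theta> X) *s \<nu> = B X" by (simp add: \<Theta>_def vec_eq_iff)
    then show ?thesis by (simp add: \<Psi>_def inv)
  qed
  have g_hol: "holomorphic_fun g S" for S
  proof -
    have "holomorphic_fun (\<lambda>y. (1/2) * quad (P y) (P y) + (-1)) S"
      by (intro holomorphic_fun_add holomorphic_fun_mult holomorphic_fun_const holomorphic_quad)
    then show ?thesis by (simp add: g_def)
  qed
  have hol1: "holomorphic_map (\<lambda>y. y + g y *s \<nu>) S" "holomorphic_map (\<lambda>y. y + (- g y) *s \<nu>) S" for S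
  proof -
    show "holomorphic_map (\<lambda>y. y + g y *s \<nu>) S"
      by (intro holomorphic_map_add holomorphic_map_id holomorphic_map_smult holomorphic_map_const g_hol)
    have "holomorphic_fun (\<lambda>y. (-1) * g y) S" by (intro holomorphic_fun_mult holomorphic_fun_const g_hol)
    then have "holomorphic_fun (\<lambda>y. - g y) S" by simp
    then show "holomorphic_map (\<lambda>y. y + (- g y) *s \<nu>) S"
      by (intro holomorphic_map_add holomorphic_map_id holomorphic_map_smult holomorphic_map_const)
  qed
  have hol2: "holomorphic_map A S" "holomorphic_map B S" for S
    using holomorphic_map_complex_linear_map[OF lin(1), of 0] holomorphic_map_complex_linear_map[OF lin(2), of 0] by auto
  have "biholomorphism \<Psi> D (siegel u)"
  proof (rule biholomorphismI[of _ _ _ \<Theta>])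
    show "holomorphic_map \<Psi> D" unfolding \<Psi>_def by (rule holomorphic_map_compose[OF hol1(1) hol2(1)[of UNIV]]) simp
    show "holomorphic_map \<Theta> (siegel u)" unfolding \<Theta>_def by (rule holomorphic_map_compose[OF hol2(2) hol1(2)[of UNIV]]) simp
    show "\<Psi> x \<in> siegel u \<and> \<Theta> (\<Psi> x) = x" if "x \<in> D" for x using that mem TP by simp
    show "\<Theta> y \<in> D \<and> \<Psi> (\<Theta> y) = y" if "y \<in> siegel u" for y using that mem[of "\<Theta> y"] PT by simp
  qed (rule open_siegel)
  from biholomorphism_compose[OF this siegel_biholomorphic_ball[OF u] open_ball]
  have "biholomorphism (\<lambda>x. (2 / (1 - cinner (\<Psi> x) u)) *s \<Psi> x + u) D (ball 0 1)" .
  moreover have "(2 / (1 - cinner (\<Psi> 0) u)) *s \<Psi> 0 + u = 0"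
  proof -
    have "quad 0 0 = 0" using quad_smult[of 0 0 0] by simp
    then have "g 0 = -1" by (simp add: g_def complex_linear_map_zero[OF P_linear])
    then have "\<Psi> 0 = - u"
      by (simp add: \<Psi>_def u_def complex_linear_map_minus[OF lin(1)] vector_sneg_minus1[symmetric])
    moreover have "cinner (- u) u = -1" using lu[of "- \<nu>"]
      by (simp add: u_def complex_linear_map_minus[OF lin(1)] complex_functional_minus[OF l] l\<nu>)
    ultimately show ?thesis by simp
  qed
  ultimately show ?thesis by blast
qed

end


section \<open>Affine changes of coordinates and kernel convergence\<close>

lemma complex_functional_nth: "complex_functional (\<lambda>x. x $ i)"
  unfolding complex_functional_def by (auto intro!: linearI)

text \<open>By Liouville a bounded holomorphic map is constant on complex lines.\<close>

lemma no_complex_line_if_bounded_image: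
  assumes "holomorphic_map g S" "inj_on g S" "bounded (g ` S)"
  shows "\<not> (\<exists>l. complex_affine_line l \<and> l \<subseteq> S)"
proof
  assume "\<exists>l. complex_affine_line l \<and> l \<subseteq> S"
  then obtain a v where v: "v \<noteq> 0" and sub: "\<And>c. a + c *s v \<in> S"
    unfolding complex_affine_line_def by blast
  obtain b where b: "\<And>x. x \<in> S \<Longrightarrow> norm (g x) \<le> b" using assms(3) unfolding bounded_iff by blast
  have "g (a + 0 *s v) $ i = g (a + 1 *s v) $ i" for i
  proof -
    have "(\<lambda>c. g (a + c *s v) $ i) holomorphic_on UNIV"
      using sub by (intro holomorphic_on_slice[OF assms(1) complex_functional_nth])
    moreover have "cmod (g (a + c *s v) $ i) \<le> b" for c
      using Finite_Cartesian_Product.norm_nth_le[of "g (a + c *s v)" i] b[OF sub[of c]] by simp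
    then have "bounded (range (\<lambda>c. g (a + c *s v) $ i))" unfolding bounded_iff by blast
    ultimately have "(\<lambda>c. g (a + c *s v) $ i) constant_on UNIV" by (rule Liouville_theorem)
    then show ?thesis unfolding constant_on_def by (metis UNIV_I)
  qed
  then have "g (a + 0 *s v) = g (a + 1 *s v)" by (simp add: vec_eq_iff)
  then have "a + 0 *s v = a + 1 *s v" using inj_onD[OF assms(2)] sub by blast
  then show False using v by simp
qed

lemma XX_bounded:
  assumes "convex_domain \<Omega>" "bounded \<Omega>" shows "\<Omega> \<in> XX"
  using no_complex_line_if_bounded_image[OF holomorphic_map_id, of \<Omega>] assms by (simp add: XX_def)

lemma ball_in_XX: "ball 0 1 \<in> XX"
  by (rule XX_bounded) (auto simp: convex_domain_def)

lemma XX_biholomorphic_ball: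
  assumes "convex_domain \<Omega>" "biholomorphism \<phi> \<Omega> (ball 0 1)" shows "\<Omega> \<in> XX"
proof -
  have "holomorphic_map \<phi> \<Omega>" "inj_on \<phi> \<Omega>" "\<phi> ` \<Omega> = ball 0 1"
    using assms(2) by (auto simp: biholomorphism_def bij_betw_def)
  then show ?thesis using no_complex_line_if_bounded_image[of \<phi> \<Omega>] assms(1) by (simp add: XX_def)
qed

lemma XX_affine:
  assumes \<Omega>: "\<Omega> \<in> XX" and lin: "complex_linear_map A" "complex_linear_map B"
    and inv: "\<And>x. A (B x) = x" "\<And>x. B (A x) = x" and D: "D = {y. a + B y \<in> \<Omega>}"
  shows "D \<in> XX"
proof -
  have op: "open \<Omega>" "convex \<Omega>" "\<Omega> \<noteq> {}" using \<Omega> by (auto simp: XX_def convex_domain_def)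
  have "continuous_on UNIV (\<lambda>y. a + B y)"
    using complex_linear_map_bounded_linear[OF lin(2)] by (intro continuous_intros linear_continuous_on)
  then have "open D" using open_vimage[OF op(1), of "\<lambda>y. a + B y"] by (simp add: D vimage_def)
  moreover have "convex D"
  proof (rule convexI)
    fix x y :: "complex ^ 'a" and s t :: real
    assume xy: "x \<in> D" "y \<in> D" and st: "0 \<le> s" "0 \<le> t" "s + t = 1"
    have "s *\<^sub>R (a + B x) + t *\<^sub>R (a + B y) \<in> \<Omega>" using xy st by (intro convexD[OF op(2)]) (auto simp: D)
    moreover have "s *\<^sub>R (a + B x) + t *\<^sub>R (a + B y) = (s + t) *\<^sub>R a + B (s *\<^sub>R x + t *\<^sub>R y)"
      by (simp add: complex_linear_map_add[OF lin(2)] complex_linear_map_scaleR[OF lin(2)] algebra_simps)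
    ultimately show "s *\<^sub>R x + t *\<^sub>R y \<in> D" using st by (simp add: D)
  qed
  moreover have "D \<noteq> {}"
  proof -
    obtain z where "z \<in> \<Omega>" using op(3) by blast
    then have "A (z - a) \<in> D" by (simp add: D inv)
    then show ?thesis by blast
  qed
  moreover have "\<not> (\<exists>L. complex_affine_line L \<and> L \<subseteq> D)"
  proof
    assume "\<exists>L. complex_affine_line L \<and> L \<subseteq> D"
    then obtain b v where v: "v \<noteq> 0" and sub: "\<And>c. b + c *s v \<in> D"
      unfolding complex_affine_line_def by blast
    have "B v \<noteq> 0" using inv(1)[of v] v complex_linear_map_zero[OF lin(1)] by metis
    then have "complex_affine_line (range (\<lambda>c. (a + B b) + c *s B v))"
      unfolding complex_affine_line_def by blast
    moreover have "(a + B b) + c *s B v \<in> \<Omega>" for c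
      using sub[of c] by (simp add: D complex_linear_map_add[OF lin(2)] complex_linear_map_smult[OF lin(2)] add.assoc)
    then have "range (\<lambda>c. (a + B b) + c *s B v) \<subseteq> \<Omega>" by blast
    ultimately show False using \<Omega> by (auto simp: XX_def)
  qed
  ultimately show ?thesis by (simp add: XX_def convex_domain_def)
qed

lemma intrinsic_affine:
  assumes f: "intrinsic f" and \<Omega>: "\<Omega> \<in> XX"
    and lin: "complex_linear_map A" "complex_linear_map B"
    and inv: "\<And>x. A (B x) = x" "\<And>x. B (A x) = x" and D: "D = {y. a + B y \<in> \<Omega>}"
    and y: "y \<in> D"
  shows "f (D, y) = f (\<Omega>, a + B y)"
proof -
  have "biholomorphism (\<lambda>x. A (x - a)) \<Omega> D"
    unfolding D using \<Omega> by (intro biholomorphism_affine lin inv) (simp add: XX_def convex_domain_def)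
  moreover have "D \<in> XX" by (rule XX_affine[OF \<Omega> lin inv D])
  moreover have "A (a + B y - a) = y" by (simp add: inv)
  ultimately have "f (\<Omega>, a + B y) = f (D, y)"
    using f \<Omega> y unfolding intrinsic_def XX0_def D by blast
  then show ?thesis by simp
qed

lemma ball_subset_if_cross_polytope:
  fixes S :: "'a::euclidean_space set"
  assumes S: "convex S" and s: "0 < s"
    and b: "\<And>b. b \<in> Basis \<Longrightarrow> s *\<^sub>R b \<in> S" "\<And>b. b \<in> Basis \<Longrightarrow> (- s) *\<^sub>R b \<in> S"
  shows "ball 0 (s / real DIM('a)) \<subseteq> S"
proof
  fix x :: 'a assume x: "x \<in> ball 0 (s / real DIM('a))"
  define d where "d = real DIM('a)"
  have d: "0 < d" by (simp add: d_def)
  have "(d * (x \<bullet> b)) *\<^sub>R b \<in> S" if B: "b \<in> Basis" for b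
  proof -
    define t where "t = d * (x \<bullet> b) / s"
    have "\<bar>x \<bullet> b\<bar> \<le> s / d" using x Basis_le_norm[OF B, of x] by (simp add: d_def)
    then have t: "-1 \<le> t" "t \<le> 1" using d s by (auto simp: t_def abs_le_iff field_simps)
    have "((1 + t) / 2) *\<^sub>R (s *\<^sub>R b) + ((1 - t) / 2) *\<^sub>R ((- s) *\<^sub>R b) \<in> S"
      using t b[OF B] by (intro convexD[OF S]) (auto simp: field_simps)
    moreover have "((1 + t) / 2) *\<^sub>R (s *\<^sub>R b) + ((1 - t) / 2) *\<^sub>R ((- s) *\<^sub>R b) = (t * s) *\<^sub>R b"
      by (simp flip: scaleR_left_diff_distrib) (simp add: field_simps)
    ultimately show ?thesis using s by (simp add: t_def)
  qed
  then have "(\<Sum>b\<in>Basis. (1 / d) *\<^sub>R ((d * (x \<bullet> b)) *\<^sub>R b)) \<in> S"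
    using d by (intro convex_sum S) (auto simp: d_def)
  then show "x \<in> S" using d by (simp add: euclidean_representation)
qed

text \<open>Eventually the domains contain the vertices of a small cross-polytope, hence a common ball around \<open>0\<close>, and
  the Minkowski functionals converge.\<close>

lemma tendsto_if_kernel_convergence:
  fixes f :: "(complex ^ 'd) set \<times> (complex ^ 'd) \<Rightarrow> real"
  assumes f: "continuous_on_XX0 f" and Ds: "\<And>n. (Ds n, 0) \<in> XX0" and D: "(D, 0) \<in> XX0"
    and mem: "\<And>x. x \<in> D \<Longrightarrow> \<forall>\<^sub>F n in sequentially. x \<in> Ds n"
    and nmem: "\<And>x. x \<notin> closure D \<Longrightarrow> \<forall>\<^sub>F n in sequentially. x \<notin> Ds n"
  shows "(\<lambda>n. f (Ds n, 0)) \<longlonglongrightarrow> f (D, 0)"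
proof -
  have op: "open D" "convex D" "0 \<in> D" "\<And>n. open (Ds n)" "\<And>n. convex (Ds n)"
    using Ds D by (auto simp: XX0_def XX_def convex_domain_def)
  obtain e where e: "0 < e" "ball 0 e \<subseteq> D" using open_contains_ball_eq[OF op(1)] op(3) by blast
  define r where "r = e / 2 / real DIM(complex ^ 'd)"
  have in_D: "(e / 2) *\<^sub>R b \<in> D" "(- (e / 2)) *\<^sub>R b \<in> D" if "b \<in> Basis" for b
    using e that by (auto simp: subset_iff)
  have "\<forall>\<^sub>F n in sequentially. \<forall>b\<in>Basis. (e / 2) *\<^sub>R b \<in> Ds n \<and> (- (e / 2)) *\<^sub>R b \<in> Ds n"
    using in_D by (intro eventually_ball_finite ballI eventually_conj mem) auto
  then have "\<forall>\<^sub>F n in sequentially. ball 0 r \<subseteq> Ds n"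
  proof eventually_elim
    case (elim n)
    then show ?case unfolding r_def
      using e(1) op(5) by (intro ball_subset_if_cross_polytope) auto
  qed
  then obtain N where N: "\<And>n. N \<le> n \<Longrightarrow> ball 0 r \<subseteq> Ds n" unfolding eventually_sequentially by blast
  have r: "0 < r" "r \<le> e"
  proof -
    define d where "d = real DIM(complex ^ 'd)"
    have d: "1 \<le> d" unfolding d_def by (simp add: Suc_leI DIM_positive del: DIM_cart)
    have rd: "r = e / 2 / d" by (simp add: r_def d_def)
    show "0 < r" using d e(1) by (simp add: rd)
    have "e * 1 \<le> e * d" using d e(1) by (intro mult_left_mono) auto
    then show "r \<le> e" using d e(1) by (simp add: rd pos_divide_le_eq mult.commute)
  qed
  have body: "gauge_body (Ds (n + N)) r" for n
    using N r(1) op by unfold_locales auto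
  have bodyD: "gauge_body D r"
    using e r op by unfold_locales auto
  have "(\<lambda>n. minkowski (Ds (n + N)) x) \<longlonglongrightarrow> minkowski D x" for x
  proof (rule minkowski_tendsto_if_eventually_mem[OF body bodyD])
    fix x
    show "\<forall>\<^sub>F n in sequentially. x \<in> Ds (n + N)" if "x \<in> D"
      using mem[OF that] sequentially_offset by fast
    show "\<forall>\<^sub>F n in sequentially. x \<notin> Ds (n + N)" if "x \<notin> closure D"
      using sequentially_offset[OF nmem[OF that]] .
  qed
  then have "local_hausdorff_convergent (\<lambda>n. Ds (n + N)) D"
    by (rule local_hausdorff_convergentI[OF body bodyD])
  then have "(\<lambda>n. f (Ds (n + N), 0)) \<longlonglongrightarrow> f (D, 0)"
    using f[unfolded continuous_on_XX0_def, rule_format, of "\<lambda>n. Ds (n + N)" "\<lambda>n. 0" D 0] Ds D by simp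
  then show ?thesis by (rule LIMSEQ_offset)
qed


section \<open>Strongly pseudoconvex points rescale to the ball\<close>

text \<open>For \<open>k v = 1\<close> this is multiplication by \<open>c\<close> on the line of \<open>v\<close> and by \<open>d\<close> on the kernel of \<open>k\<close>.\<close>

definition dilation :: "(complex ^ 'd \<Rightarrow> complex) \<Rightarrow> complex ^ 'd \<Rightarrow> complex \<Rightarrow> complex \<Rightarrow> complex ^ 'd \<Rightarrow> complex ^ 'd"
  where "dilation k v c d x = (c * k x) *s v + d *s (x - k x *s v)"

lemma complex_linear_map_dilation:
  assumes "complex_functional k" shows "complex_linear_map (dilation k v c d)"
  unfolding complex_linear_map_def
proof (intro conjI linearI allI)
  show "dilation k v c d (x + y) = dilation k v c d x + dilation k v c d y" for x y
    by (simp add: dilation_def complex_functional_add[OF assms] vec_eq_iff algebra_simps)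
  show "dilation k v c d (e *s x) = e *s dilation k v c d x" for e x
    by (simp add: dilation_def complex_functional_smult[OF assms] vec_eq_iff algebra_simps)
  then show "dilation k v c d (t *\<^sub>R x) = t *\<^sub>R dilation k v c d x" for t x
    by (simp only: scaleR_eq_smult)
qed

lemma functional_dilation:
  assumes "complex_functional k" "k v = 1" shows "k (dilation k v c d x) = c * k x"
  by (simp add: dilation_def complex_functional_add[OF assms(1)] complex_functional_diff[OF assms(1)]
      complex_functional_smult[OF assms(1)] assms(2))

lemma dilation_dilation:
  assumes "complex_functional k" "k v = 1"
  shows "dilation k v c d (dilation k v c' d' x) = dilation k v (c * c') (d * d') x"
  unfolding dilation_def[of k v c d] functional_dilation[OF assms]
  by (simp add: dilation_def vec_eq_iff algebra_simps)

lemma dilation_1: "dilation k v 1 1 x = x"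
  by (simp add: dilation_def)

text \<open>Rescale at \<open>z n\<close> by \<open>\<tau> n = - r (z n)\<close> in a fixed transversal direction and by \<open>sqrt (\<tau> n)\<close> in the kernel of the complex
  gradient of \<open>r\<close> at \<open>z n\<close>. In the Taylor formula for \<open>r\<close> at \<open>z n\<close>, divided by \<open>\<tau> n\<close>, the constant term is \<open>-1\<close>, the
  linear term is the real part of the gradient, and of the quadratic term only the Hessian on the kernel
  survives. So the rescaled domains converge to a quadratic model, on which \<open>f\<close> has at \<open>0\<close> the same value as at the
  centre of the ball.\<close>

lemma strongly_pseudoconvex_point_limit:
  fixes f :: "(complex ^ 'd) set \<times> (complex ^ 'd) \<Rightarrow> real"
  assumes f: "continuous_on_XX0 f" "intrinsic f"
    and \<Omega>: "convex_domain \<Omega>" "bounded \<Omega>" and p: "p \<in> frontier \<Omega>"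
    and ldf: "local_defining_function \<Omega> p U r" and C2: "Ck_on 2 U r"
    and levi: "\<And>v. v \<in> complex_tangent_space r p \<Longrightarrow> v \<noteq> 0 \<Longrightarrow> levi_form r p v > 0"
    and zs: "\<And>n. zs n \<in> \<Omega>" "zs \<longlonglongrightarrow> p"
  shows "(\<lambda>n. f (\<Omega>, zs n)) \<longlonglongrightarrow> f (ball 0 1, 0)"
proof -
  have \<Omega>XX: "\<Omega> \<in> XX" using \<Omega> by (rule XX_bounded)
  interpret C: convex_boundary_point U r \<Omega> p
    using \<Omega>(1) p ldf C2 by unfold_locales (auto simp: convex_domain_def local_defining_function_def)
  note diff1 = C.diff1 and p_U = C.p_U
  define l where "l = complex_gradient r p"
  have l: "complex_functional l" unfolding l_def by (rule complex_functional_complex_gradient[OF diff1[OF p_U]])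
  obtain w where "D1 r p w \<noteq> 0"
    using ldf p_U unfolding local_defining_function_def D1_def by fastforce
  then have lw: "l w \<noteq> 0" using Re_complex_gradient[of r p w] by (auto simp: l_def)
  define \<nu> where "\<nu> = (1 / l w) *s w"
  have l\<nu>: "l \<nu> = 1" using lw by (simp add: \<nu>_def complex_functional_smult[OF l])
  interpret M: quadratic_model "D2 r p" l \<nu>
  proof (rule quadratic_model.intro)
    show "linear (\<lambda>x. D2 r p x y)" "linear (D2 r p x)" for x y
      using C.linear2_left[OF p_U] C.linear2[OF p_U] by auto
    show "0 \<le> D2 r p x x" if "l x = 0" for x
      using Re_complex_gradient[of r p x] that by (intro C.D2_nonneg) (simp add: l_def)
    show "0 < D2 r p x x + D2 r p (\<i> *s x) (\<i> *s x)" if "l x = 0" "x \<noteq> 0" for x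
    proof -
      have "x \<in> complex_tangent_space r p"
        using that(1) complex_tangent_space_iff[OF diff1[OF p_U]] by (simp add: l_def)
      from levi[OF this that(2)] show ?thesis
        using levi_form_eq[OF C.C2_fun_axioms p_U, of x] by simp
    qed
  qed (use l l\<nu> in auto)
  have zU: "\<forall>\<^sub>F n in sequentially. zs n \<in> U" using zs(2) C.open_U p_U by (simp add: tendsto_def)
  have lim0: "(\<lambda>n. complex_gradient r (zs n) x) \<longlonglongrightarrow> l x" for x
    unfolding complex_gradient_def l_def by (intro tendsto_intros C.tendsto_D1 zs zU p_U)
  have "\<forall>\<^sub>F n in sequentially. complex_gradient r (zs n) \<nu> \<noteq> 0"
    using lim0[of \<nu>] l\<nu> by (intro tendsto_imp_eventually_ne[of _ 1]) auto
  with zU have "\<forall>\<^sub>F n in sequentially. zs n \<in> U \<and> complex_gradient r (zs n) \<nu> \<noteq> 0" by (rule eventually_conj)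
  then obtain N where N: "\<And>n. N \<le> n \<Longrightarrow> zs n \<in> U \<and> complex_gradient r (zs n) \<nu> \<noteq> 0"
    unfolding eventually_sequentially by blast
  define z where "z = (\<lambda>n. zs (n + N))"
  have z: "z n \<in> \<Omega>" "z n \<in> U" "complex_gradient r (z n) \<nu> \<noteq> 0" for n using N zs(1) by (auto simp: z_def)
  have z_lim: "z \<longlonglongrightarrow> p" unfolding z_def using zs(2) by (rule LIMSEQ_ignore_initial_segment)
  define k where "k = (\<lambda>n. complex_gradient r (z n))"
  have k: "complex_functional (k n)" for n unfolding k_def by (rule complex_functional_complex_gradient[OF diff1[OF z(2)]])
  have k_lim: "(\<lambda>n. k n x) \<longlonglongrightarrow> l x" for x
    unfolding k_def z_def using lim0 by (rule LIMSEQ_ignore_initial_segment)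
  define v where "v = (\<lambda>n. (1 / k n \<nu>) *s \<nu>)"
  have kv: "k n (v n) = 1" for n 
    unfolding v_def complex_functional_smult[OF k] using z(3)[of n] by (simp add: k_def)
  have "v \<longlonglongrightarrow> (1 / l \<nu>) *s \<nu>" unfolding v_def using l\<nu> by (intro tendsto_intros k_lim) auto
  then have v_lim: "v \<longlonglongrightarrow> \<nu>" by (simp add: l\<nu>)
  define \<tau> where "\<tau> = (\<lambda>n. - r (z n))"
  have \<tau>: "0 < \<tau> n" for n using C.in_U[OF z(2)] z(1) by (simp add: \<tau>_def)
  have "(\<lambda>n. r (z n)) \<longlonglongrightarrow> r p"
    using z(2) by (intro continuous_on_tendsto_compose[OF C.continuous_r z_lim p_U]) simp
  then have \<tau>_lim: "\<tau> \<longlonglongrightarrow> 0" using C.r_p tendsto_minus unfolding \<tau>_def by fastforce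
  have sq_lim: "(\<lambda>n. sqrt (\<tau> n)) \<longlonglongrightarrow> 0" using tendsto_real_sqrt[OF \<tau>_lim] by simp
  define G where "G = (\<lambda>n. dilation (k n) (v n) (of_real (\<tau> n)) (of_real (sqrt (\<tau> n))))"
  define Gi where "Gi = (\<lambda>n. dilation (k n) (v n) (of_real (1 / \<tau> n)) (of_real (1 / sqrt (\<tau> n))))"
  have lin: "complex_linear_map (G n)" "complex_linear_map (Gi n)" for n
    unfolding G_def Gi_def by (intro complex_linear_map_dilation k)+
  have inv: "G n (Gi n x) = x" "Gi n (G n x) = x" for n x
    unfolding G_def Gi_def dilation_dilation[OF k kv] using \<tau>[of n] by (simp_all add: dilation_1 flip: of_real_mult)
  define Ds where "Ds = (\<lambda>n. {y. z n + G n y \<in> \<Omega>})"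
  have Ds_XX: "Ds n \<in> XX" for n
    by (rule XX_affine[OF \<Omega>XX lin(2,1) inv(2,1)]) (simp add: Ds_def)
  have Ds0: "0 \<in> Ds n" for n by (simp add: Ds_def complex_linear_map_zero[OF lin(1)] z(1))
  have f_eq: "f (Ds n, 0) = f (\<Omega>, z n)" for n
    using intrinsic_affine[OF f(2) \<Omega>XX lin(2,1) inv(2,1) _ Ds0, of n "z n"]
    by (simp add: Ds_def complex_linear_map_zero[OF lin(1)])
  obtain e where e: "0 < e" "ball p e \<subseteq> U" using open_contains_ball_eq[OF C.open_U] p_U by blast
  have rescaled: "(\<forall>\<^sub>F n in sequentially. z n + G n y \<in> U) \<and> (\<lambda>n. r (z n + G n y) / \<tau> n) \<longlonglongrightarrow> M.F y - 1" for y
  proof -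
    \<comment> \<open>The displacement divided by \<open>sqrt (\<tau> n)\<close>; it converges to the tangential part of \<open>y\<close>.\<close>
    define W where "W = (\<lambda>n. dilation (k n) (v n) (of_real (sqrt (\<tau> n))) 1 y)"
    have GW: "G n y = sqrt (\<tau> n) *\<^sub>R W n" for n
    proof -
      have "complex_of_real (\<tau> n) = of_real (sqrt (\<tau> n)) * of_real (sqrt (\<tau> n))"
        using \<tau>[of n] by (simp flip: of_real_mult)
      then show ?thesis
        by (simp add: G_def W_def dilation_def scaleR_eq_smult vec_eq_iff algebra_simps)
    qed
    have "W \<longlonglongrightarrow> (of_real 0 * l y) *s \<nu> + 1 *s (y - l y *s \<nu>)"
      unfolding W_def dilation_def by (intro tendsto_intros sq_lim k_lim v_lim)
    then have W_lim: "W \<longlonglongrightarrow> M.P y" by (simp add: M.P_def)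
    have G_lim: "(\<lambda>n. G n y) \<longlonglongrightarrow> 0"
      unfolding GW using tendsto_scaleR[OF sq_lim W_lim] by simp
    have ev: "\<forall>\<^sub>F n in sequentially. dist (z n) p < e / 2 \<and> norm (G n y) < e / 2"
      using tendstoD[OF z_lim, of "e / 2"] tendstoD[OF G_lim, of "e / 2"] e(1)
      by (intro eventually_conj) (auto simp: dist_norm)
    have seg: "z n + t *\<^sub>R G n y \<in> U" if "dist (z n) p < e / 2 \<and> norm (G n y) < e / 2" "0 \<le> t" "t \<le> 1" for n t
    proof -
      have "t * norm (G n y) \<le> 1 * norm (G n y)" using that by (intro mult_right_mono) auto
      then have "norm (t *\<^sub>R G n y) < e / 2" using that by simp
      then have "norm ((z n - p) + t *\<^sub>R G n y) < e"
        using that norm_triangle_ineq[of "z n - p" "t *\<^sub>R G n y"] by (simp add: dist_norm)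
      then have "z n + t *\<^sub>R G n y \<in> ball p e"
        by (simp add: dist_norm norm_minus_commute[of p] algebra_simps)
      then show ?thesis using e(2) by blast
    qed
    have "\<exists>t. 0 \<le> t \<and> t \<le> 1 \<and> (dist (z n) p < e / 2 \<and> norm (G n y) < e / 2 \<longrightarrow>
        r (z n + G n y) = r (z n) + D1 r (z n) (G n y) + D2 r (z n + t *\<^sub>R G n y) (G n y) (G n y) / 2)" for n
    proof (cases "dist (z n) p < e / 2 \<and> norm (G n y) < e / 2")
      case True
      from seg[OF True] obtain t where "0 < t" "t < 1"
        "r (z n + G n y) = r (z n) + D1 r (z n) (G n y) + D2 r (z n + t *\<^sub>R G n y) (G n y) (G n y) / 2"
        using C.Taylor2[of "z n" "G n y"] by blast
      then show ?thesis by (intro exI[of _ t]) auto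
    qed auto
    then obtain t where t: "\<And>n. 0 \<le> t n" "\<And>n. t n \<le> 1"
      "\<And>n. dist (z n) p < e / 2 \<and> norm (G n y) < e / 2 \<Longrightarrow>
        r (z n + G n y) = r (z n) + D1 r (z n) (G n y) + D2 r (z n + t n *\<^sub>R G n y) (G n y) (G n y) / 2"
      by metis
    define q where "q = (\<lambda>n. z n + t n *\<^sub>R G n y)"
    have "(\<lambda>n. t n *\<^sub>R G n y) \<longlonglongrightarrow> 0"
    proof (rule Lim_null_comparison[OF _ tendsto_norm_zero[OF G_lim]])
      show "\<forall>\<^sub>F n in sequentially. norm (t n *\<^sub>R G n y) \<le> norm (G n y)"
        using t by (intro always_eventually allI) (simp add: mult_left_le_one_le)
    qed
    from tendsto_add[OF z_lim this] have q_lim: "q \<longlonglongrightarrow> p" by (simp add: q_def)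
    have q_U: "\<forall>\<^sub>F n in sequentially. q n \<in> U" using q_lim C.open_U p_U by (simp add: tendsto_def)
    have "(\<lambda>n. - 1 + Re (k n y) + D2 r (q n) (W n) (W n) / 2)
        \<longlonglongrightarrow> - 1 + Re (l y) + D2 r p (M.P y) (M.P y) / 2"
      by (intro tendsto_intros k_lim C.tendsto_D2 q_lim W_lim q_U p_U) auto
    moreover have "\<forall>\<^sub>F n in sequentially. - 1 + Re (k n y) + D2 r (q n) (W n) (W n) / 2 = r (z n + G n y) / \<tau> n"
      using ev q_U
    proof eventually_elim
      case (elim n)
      have "D1 r (z n) (G n y) = Re (k n (G n y))" by (simp add: k_def Re_complex_gradient)
      also have "\<dots> = \<tau> n * Re (k n y)" unfolding G_def functional_dilation[OF k kv] by simp
      finally have 1: "D1 r (z n) (G n y) = \<tau> n * Re (k n y)" .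
      have "D2 r (q n) (G n y) (G n y) = sqrt (\<tau> n) * (sqrt (\<tau> n) * D2 r (q n) (W n) (W n))"
        unfolding GW by (simp only: linear_scale[OF C.linear2_left[OF elim(2)]] linear_scale[OF C.linear2[OF elim(2)]] real_scaleR_def)
      then have 2: "D2 r (q n) (G n y) (G n y) = \<tau> n * D2 r (q n) (W n) (W n)" using \<tau>[of n] by simp
      have "r (z n + G n y) = - \<tau> n + \<tau> n * Re (k n y) + \<tau> n * D2 r (q n) (W n) (W n) / 2"
        using t(3)[OF elim(1)] 1 2 by (simp add: q_def \<tau>_def)
      then show ?case using \<tau>[of n] by (simp add: field_simps)
    qed
    ultimately have "(\<lambda>n. r (z n + G n y) / \<tau> n) \<longlonglongrightarrow> - 1 + Re (l y) + D2 r p (M.P y) (M.P y) / 2"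
      by (rule Lim_transform_eventually)
    moreover have "\<forall>\<^sub>F n in sequentially. z n + G n y \<in> U"
      using ev by eventually_elim (use seg[of _ 1] in simp)
    ultimately show ?thesis by (simp add: M.F_def algebra_simps)
  qed
  have mem: "\<forall>\<^sub>F n in sequentially. y \<in> Ds n" if "y \<in> M.D" for y
  proof -
    have "M.F y - 1 < 0" using that by (simp add: M.D_def)
    then have "\<forall>\<^sub>F n in sequentially. r (z n + G n y) / \<tau> n < 0"
      using rescaled[of y] order_tendstoD(2) by blast
    with rescaled[of y, THEN conjunct1] show ?thesis
    proof eventually_elim
      case (elim n)
      then have "r (z n + G n y) < 0" using \<tau>[of n] by (simp add: divide_less_0_iff)
      then show ?case using C.in_U[OF elim(1)] by (simp add: Ds_def)
    qed
  qed
  have nmem: "\<forall>\<^sub>F n in sequentially. y \<notin> Ds n" if "y \<notin> closure M.D" for y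
  proof -
    have "\<not> M.F y \<le> 1" using that M.le_one_closure by blast
    then have "0 < M.F y - 1" by simp
    then have "\<forall>\<^sub>F n in sequentially. 0 < r (z n + G n y) / \<tau> n"
      using rescaled[of y] order_tendstoD(1) by blast
    with rescaled[of y, THEN conjunct1] show ?thesis
    proof eventually_elim
      case (elim n)
      then have "0 < r (z n + G n y)" using \<tau>[of n] by (simp add: zero_less_divide_iff)
      then show ?case using C.in_U[OF elim(1)] by (simp add: Ds_def)
    qed
  qed
  obtain \<phi> where \<phi>: "biholomorphism \<phi> M.D (ball 0 1)" "\<phi> 0 = 0" using M.biholomorphic_ball by blast
  have "convex_domain M.D" unfolding convex_domain_def using M.open_D M.convex_D M.zero_in_D by blast
  then have "M.D \<in> XX" using \<phi>(1) by (rule XX_biholomorphic_ball)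
  then have D0: "(M.D, 0) \<in> XX0" using M.zero_in_D by (simp add: XX0_def)
  have "(\<lambda>n. f (Ds n, 0)) \<longlonglongrightarrow> f (M.D, 0)"
    by (rule tendsto_if_kernel_convergence[OF f(1) _ D0 mem nmem]) (use Ds_XX Ds0 in \<open>simp add: XX0_def\<close>)
  moreover have "f (M.D, 0) = f (ball 0 1, 0)"
    using f(2)[unfolded intrinsic_def, rule_format, of M.D 0 "ball 0 1" 0] D0 \<phi> ball_in_XX
    by (auto simp: XX0_def)
  ultimately have "(\<lambda>n. f (\<Omega>, zs (n + N))) \<longlonglongrightarrow> f (ball 0 1, 0)" by (simp add: f_eq z_def)
  then show ?thesis by (rule LIMSEQ_offset)
qed

text \<open>By compactness a failure would be seen along a sequence that converges to a boundary point.\<close>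

lemma strongly_pseudoconvex_limit:
  fixes f :: "(complex ^ 'd) set \<times> (complex ^ 'd) \<Rightarrow> real"
  assumes f: "continuous_on_XX0 f" "intrinsic f"
    and \<Omega>: "convex_domain \<Omega>" "bounded \<Omega>" "strongly_pseudoconvex \<Omega>"
  shows "((\<lambda>z. f (\<Omega>, z)) \<longlongrightarrow> f (ball 0 1, 0)) (to_boundary \<Omega>)"
proof (rule ccontr)
  assume "\<not> ?thesis"
  then obtain e where e: "0 < e" and ne: "\<not> (\<forall>\<^sub>F z in to_boundary \<Omega>. dist (f (\<Omega>, z)) (f (ball 0 1, 0)) < e)"
    unfolding tendsto_iff by blast
  have "\<exists>z\<in>\<Omega>. infdist z (frontier \<Omega>) < 1 / real (Suc n) \<and> e \<le> dist (f (\<Omega>, z)) (f (ball 0 1, 0))" for n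
  proof (rule ccontr)
    assume n: "\<not> ?thesis"
    have "open {..<1 / real (Suc n)}" "0 \<in> {..<1 / real (Suc n)}" by auto
    then have "\<forall>\<^sub>F t in nhds (0::real). t < 1 / real (Suc n)"
      unfolding eventually_nhds by blast
    then have "\<forall>\<^sub>F z in filtercomap (\<lambda>z. infdist z (frontier \<Omega>)) (nhds 0). infdist z (frontier \<Omega>) < 1 / real (Suc n)"
      by (rule eventually_filtercomapI)
    then have "\<forall>\<^sub>F z in to_boundary \<Omega>. dist (f (\<Omega>, z)) (f (ball 0 1, 0)) < e"
      unfolding to_boundary_def going_to_within_def eventually_inf_principal
      by eventually_elim (use n in force)
    then show False using ne by blast
  qed
  then obtain zs where zs: "\<And>n. zs n \<in> \<Omega>" "\<And>n. infdist (zs n) (frontier \<Omega>) < 1 / real (Suc n)"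
    "\<And>n. e \<le> dist (f (\<Omega>, zs n)) (f (ball 0 1, 0))" by metis
  have "compact (closure \<Omega>)" using \<Omega>(2) by simp
  moreover have "\<forall>n. zs n \<in> closure \<Omega>" using zs(1) closure_subset by blast
  ultimately obtain p \<sigma> where \<sigma>: "strict_mono (\<sigma> :: nat \<Rightarrow> nat)" "(zs \<circ> \<sigma>) \<longlonglongrightarrow> p"
    unfolding compact_def by metis
  have "(\<lambda>n. infdist ((zs \<circ> \<sigma>) n) (frontier \<Omega>)) \<longlonglongrightarrow> infdist p (frontier \<Omega>)"
    using \<sigma>(2) by (rule tendsto_infdist)
  moreover have "(\<lambda>n. infdist ((zs \<circ> \<sigma>) n) (frontier \<Omega>)) \<longlonglongrightarrow> 0"
  proof (rule tendsto_sandwich[OF _ _ tendsto_const])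
    show "(\<lambda>n. 1 / real (Suc (\<sigma> n))) \<longlonglongrightarrow> 0"
      using LIMSEQ_subseq_LIMSEQ[OF LIMSEQ_inverse_real_of_nat \<sigma>(1)] by (simp add: o_def inverse_eq_divide)
  qed (auto intro!: always_eventually infdist_nonneg less_imp_le[OF zs(2)] simp del: of_nat_Suc)
  ultimately have "infdist p (frontier \<Omega>) = 0" using LIMSEQ_unique by blast
  moreover have "frontier \<Omega> \<noteq> {}"
  proof -
    have "\<Omega> \<noteq> UNIV" using \<Omega>(2) not_bounded_UNIV by blast
    then show ?thesis using zs(1)[of 0] frontier_eq_empty[of \<Omega>] by blast
  qed
  ultimately have p: "p \<in> frontier \<Omega>" using in_closed_iff_infdist_zero[OF frontier_closed] by blast
  then obtain U r where "local_defining_function \<Omega> p U r" "Ck_on 2 U r"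
    "\<And>v. v \<in> complex_tangent_space r p \<Longrightarrow> v \<noteq> 0 \<Longrightarrow> levi_form r p v > 0"
    using \<Omega>(3) unfolding strongly_pseudoconvex_def by blast
  from strongly_pseudoconvex_point_limit[OF f \<Omega>(1,2) p this _ \<sigma>(2)] zs(1)
  have "(\<lambda>n. f (\<Omega>, (zs \<circ> \<sigma>) n)) \<longlonglongrightarrow> f (ball 0 1, 0)" by simp
  from tendstoD[OF this e] obtain n where "dist (f (\<Omega>, zs (\<sigma> n))) (f (ball 0 1, 0)) < e"
    unfolding eventually_sequentially by auto
  then show False using zs(3)[of "\<sigma> n"] by simp
qed


section \<open>Boundary points that are not strongly pseudoconvex\<close>

text \<open>The functions \<open>d m\<close> are the iterated derivatives of \<open>r\<close> in the direction \<open>x\<close>. If those of order less than \<open>n\<close> vanish at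
  \<open>p\<close>, moving by \<open>s\<close> along \<open>x\<close> increases \<open>r\<close> by at most \<open>K * s ^ n\<close>, while moving back by \<open>\<kappa> * s ^ n\<close> along \<open>\<nu>\<close> decreases it by
  at least half of that number.\<close>

lemma (in convex_boundary_point) curve_inside:
  fixes d :: "nat \<Rightarrow> 'a \<Rightarrow> real"
  assumes d0: "d 0 = r" and diff: "\<And>m q. m < n \<Longrightarrow> q \<in> U \<Longrightarrow> d m differentiable (at q)"
    and dS: "\<And>m q. m < n \<Longrightarrow> q \<in> U \<Longrightarrow> d (Suc m) q = D1 (d m) q x"
    and cont: "continuous_on U (d n)" and zero: "\<And>m. m < n \<Longrightarrow> d m p = 0" and n: "0 < n"
    and \<nu>: "D1 r p \<nu> = 1"
  obtains \<kappa>0 where "0 < \<kappa>0"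
    and "\<And>\<kappa>. \<kappa>0 \<le> \<kappa> \<Longrightarrow> \<forall>\<^sub>F s in at_right 0. p + s *\<^sub>R x - (\<kappa> * s ^ n) *\<^sub>R \<nu> \<in> \<Omega>"
proof -
  define K where "K = \<bar>d n p\<bar> + 1"
  have K: "0 < K" by (simp add: K_def add_nonneg_pos)
  have "open (U \<inter> (\<lambda>q. D1 r q \<nu>) -` {1/2<..})" "open (U \<inter> d n -` {-K<..<K})"
    using open_U continuous_D1 cont by (auto intro!: continuous_open_preimage)
  then have "open ((U \<inter> (\<lambda>q. D1 r q \<nu>) -` {1/2<..}) \<inter> (U \<inter> d n -` {-K<..<K}))" by (rule open_Int)
  moreover have "p \<in> (U \<inter> (\<lambda>q. D1 r q \<nu>) -` {1/2<..}) \<inter> (U \<inter> d n -` {-K<..<K})"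
    using p_U \<nu> by (auto simp: K_def)
  ultimately obtain e where e: "0 < e" "ball p e \<subseteq> (U \<inter> (\<lambda>q. D1 r q \<nu>) -` {1/2<..}) \<inter> (U \<inter> d n -` {-K<..<K})"
    using open_contains_ball_eq by blast
  then have e': "\<And>q. q \<in> ball p e \<Longrightarrow> q \<in> U \<and> 1/2 < D1 r q \<nu> \<and> d n q < K" by auto
  show ?thesis
  proof (rule that[of "2 * K"])
    show "0 < 2 * K" using K by simp
    fix \<kappa> assume \<kappa>: "2 * K \<le> \<kappa>"
    have "((\<lambda>s. s * norm x + \<kappa> * s ^ n * norm \<nu>) \<longlongrightarrow> 0 * norm x + \<kappa> * 0 ^ n * norm \<nu>) (at_right 0)"
      by (intro tendsto_intros)
    then have "((\<lambda>s. s * norm x + \<kappa> * s ^ n * norm \<nu>) \<longlongrightarrow> 0) (at_right 0)" using n by (simp add: power_0_left)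
    then have "\<forall>\<^sub>F s in at_right 0. s * norm x + \<kappa> * s ^ n * norm \<nu> < e"
      using e(1) by (rule order_tendstoD(2))
    moreover have "\<forall>\<^sub>F s in at_right 0. s \<in> {0::real<..<1}" by (intro eventually_at_rightI[of 0 1]) auto
    ultimately show "\<forall>\<^sub>F s in at_right 0. p + s *\<^sub>R x - (\<kappa> * s ^ n) *\<^sub>R \<nu> \<in> \<Omega>"
    proof eventually_elim
      case (elim s)
      then have s: "0 < s" by simp
      define h where "h = \<kappa> * s ^ n"
      have h: "0 < h" using \<kappa> K s by (simp add: h_def)
      have B: "p + t *\<^sub>R x - t' *\<^sub>R \<nu> \<in> ball p e" if "0 \<le> t" "t \<le> s" "0 \<le> t'" "t' \<le> h" for t t'
      proof -
        have "norm (t *\<^sub>R x - t' *\<^sub>R \<nu>) \<le> t * norm x + t' * norm \<nu>"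
          using norm_triangle_ineq4[of "t *\<^sub>R x" "t' *\<^sub>R \<nu>"] that by simp
        also have "\<dots> \<le> s * norm x + h * norm \<nu>" using that by (intro add_mono mult_right_mono) auto
        also have "\<dots> < e" using elim by (simp add: h_def)
        finally have "norm (p - (p + t *\<^sub>R x - t' *\<^sub>R \<nu>)) < e" by (simp add: norm_minus_commute)
        then show ?thesis by (simp add: dist_norm)
      qed
      have "DERIV (\<lambda>t. d m (p + t *\<^sub>R x)) t :> d (Suc m) (p + t *\<^sub>R x)" if "m < n" "0 \<le> t" "t \<le> s" for m t
      proof -
        have "p + t *\<^sub>R x \<in> U" using B[of t 0] h that e' by auto
        then show ?thesis using has_derivative_along_line[OF diff[OF that(1)]] dS[OF that(1)] by simp
      qed
      then obtain t where t: "0 < t" "t < s"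
        "r (p + s *\<^sub>R x) = (\<Sum>m<n. d m (p + 0 *\<^sub>R x) / fact m * s ^ m) + d n (p + t *\<^sub>R x) / fact n * s ^ n"
        using Maclaurin[OF s n, of "\<lambda>m t. d m (p + t *\<^sub>R x)" "\<lambda>t. r (p + t *\<^sub>R x)"] d0 by auto
      have "d n (p + t *\<^sub>R x) \<le> K" using B[of t 0] t h e' by force
      then have "d n (p + t *\<^sub>R x) / fact n \<le> K / 1"
        using K by (intro frac_le) (auto simp: fact_ge_1)
      then have "d n (p + t *\<^sub>R x) / fact n * s ^ n \<le> K * s ^ n" using s by (intro mult_right_mono) auto
      then have r1: "r (p + s *\<^sub>R x) \<le> K * s ^ n" using t(3) zero by simp
      have "\<exists>z. 0 < z \<and> z < h \<and> r (p + s *\<^sub>R x + h *\<^sub>R (- \<nu>)) - r (p + s *\<^sub>R x + 0 *\<^sub>R (- \<nu>))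
          = (h - 0) * D1 r (p + s *\<^sub>R x + z *\<^sub>R (- \<nu>)) (- \<nu>)"
      proof (rule MVT2[OF h])
        fix t assume t: "0 \<le> t" "t \<le> h"
        have "p + s *\<^sub>R x + t *\<^sub>R (- \<nu>) \<in> U" using B[of s t] e' s t by simp
        then show "((\<lambda>t. r (p + s *\<^sub>R x + t *\<^sub>R (- \<nu>))) has_real_derivative
            D1 r (p + s *\<^sub>R x + t *\<^sub>R (- \<nu>)) (- \<nu>)) (at t)"
          by (intro has_derivative_along_line diff1)
      qed
      then obtain z where z: "0 < z" "z < h"
        "r (p + s *\<^sub>R x - h *\<^sub>R \<nu>) - r (p + s *\<^sub>R x) = h * D1 r (p + s *\<^sub>R x - z *\<^sub>R \<nu>) (- \<nu>)" by auto
      have q: "p + s *\<^sub>R x - z *\<^sub>R \<nu> \<in> U" "1/2 < D1 r (p + s *\<^sub>R x - z *\<^sub>R \<nu>) \<nu>"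
        using B[of s z] e' s z by auto
      have "h * D1 r (p + s *\<^sub>R x - z *\<^sub>R \<nu>) (- \<nu>) = - (h * D1 r (p + s *\<^sub>R x - z *\<^sub>R \<nu>) \<nu>)"
        by (simp add: linear_neg[OF linear1[OF q(1)]])
      moreover have "h * (1/2) < h * D1 r (p + s *\<^sub>R x - z *\<^sub>R \<nu>) \<nu>"
        using q(2) h by (rule mult_strict_left_mono)
      moreover have "2 * (K * s ^ n) \<le> h" unfolding h_def using mult_right_mono[OF \<kappa>, of "s ^ n"] s by simp
      ultimately have "r (p + s *\<^sub>R x - h *\<^sub>R \<nu>) < 0" using z(3) r1 by linarith
      moreover have "p + s *\<^sub>R x - h *\<^sub>R \<nu> \<in> U" using B[of s h] e' s h by auto
      ultimately show ?case using in_U by (simp add: h_def)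
    qed
  qed
qed

text \<open>A point \<open>z + c *s v\<close> of the disc is the midpoint of \<open>z + (2 * Re c) *\<^sub>R v\<close> and \<open>z + (2 * Im c) *\<^sub>R (\<i> *s v)\<close>.\<close>

lemma convex_complex_disc:
  assumes S: "convex S" and s: "0 < s" and c: "cmod c \<le> s / 2"
    and "z + s *\<^sub>R v \<in> S" "z - s *\<^sub>R v \<in> S" "z + s *\<^sub>R (\<i> *s v) \<in> S" "z - s *\<^sub>R (\<i> *s v) \<in> S"
  shows "z + c *s v \<in> S"
proof -
  have seg: "z + (2 * a) *\<^sub>R w \<in> S" if "\<bar>a\<bar> \<le> s / 2" "z + s *\<^sub>R w \<in> S" "z - s *\<^sub>R w \<in> S" for a w
  proof -
    define t where "t = 2 * a / s"
    have t: "-1 \<le> t" "t \<le> 1" using that(1) s by (auto simp: t_def field_simps)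
    have "((1 + t) / 2) *\<^sub>R (z + s *\<^sub>R w) + ((1 - t) / 2) *\<^sub>R (z - s *\<^sub>R w) \<in> S"
      using t that by (intro convexD[OF S]) (auto simp: field_simps)
    also have "((1 + t) / 2) *\<^sub>R (z + s *\<^sub>R w) + ((1 - t) / 2) *\<^sub>R (z - s *\<^sub>R w)
        = ((1 + t) / 2 + (1 - t) / 2) *\<^sub>R z + (((1 + t) / 2 - (1 - t) / 2) * s) *\<^sub>R w"
      by (simp only: scaleR_add_right scaleR_diff_right scaleR_left_distrib scaleR_left_diff_distrib
          left_diff_distrib distrib_right scaleR_scaleR) (simp add: algebra_simps)
    also have "(1 + t) / 2 + (1 - t) / 2 = 1" by (simp add: field_simps)
    also have "((1 + t) / 2 - (1 - t) / 2) * s = 2 * a" using s by (simp add: t_def field_simps)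
    finally show ?thesis by simp
  qed
  have "z + (2 * Re c) *\<^sub>R v \<in> S" "z + (2 * Im c) *\<^sub>R (\<i> *s v) \<in> S"
    using abs_Re_le_cmod[of c] abs_Im_le_cmod[of c] assms by (auto intro!: seg)
  then have "(1/2) *\<^sub>R (z + (2 * Re c) *\<^sub>R v) + (1/2) *\<^sub>R (z + (2 * Im c) *\<^sub>R (\<i> *s v)) \<in> S"
    by (intro convexD[OF S]) auto
  moreover have "(1/2) *\<^sub>R (z + (2 * Re c) *\<^sub>R v) + (1/2) *\<^sub>R (z + (2 * Im c) *\<^sub>R (\<i> *s v)) = z + c *s v"
    by (simp add: vec_eq_iff complex_eq_iff field_simps)
  ultimately show ?thesis by simp
qed

text \<open>What is needed of a boundary point that is not strongly pseudoconvex: \<open>l\<close> defines the tangent hyperplane, \<open>\<nu>\<close> is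
  transversal and \<open>v\<close> complex tangential, the slice in the direction \<open>\<nu>\<close> contains a disc that touches the boundary at \<open>p\<close>, and the
  slices in the direction \<open>v\<close> are larger than for a nondegenerate Levi form.\<close>

definition flat_boundary_point ::
  "(complex ^ 'd) set \<Rightarrow> complex ^ 'd \<Rightarrow> (complex ^ 'd \<Rightarrow> complex) \<Rightarrow> complex ^ 'd \<Rightarrow> complex ^ 'd \<Rightarrow> real \<Rightarrow> real \<Rightarrow> real \<Rightarrow> bool"
  where "flat_boundary_point \<Omega> p l \<nu> v \<rho> \<gamma> \<tau>0 \<longleftrightarrow> complex_functional l \<and> l \<nu> = 1 \<and> l v = 0 \<and> v \<noteq> 0 \<and>
    (\<forall>z\<in>\<Omega>. Re (l (z - p)) < 0) \<and>
    0 < \<rho> \<and> (\<forall>\<mu>. cmod (\<mu> + of_real \<rho>) < \<rho> \<longrightarrow> p + \<mu> *s \<nu> \<in> \<Omega>) \<and>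
    0 < \<gamma> \<and> 0 < \<tau>0 \<and>
    (\<forall>\<tau> c. 0 < \<tau> \<longrightarrow> \<tau> < \<tau>0 \<longrightarrow> cmod c < \<gamma> * \<tau> powr (1/3) \<longrightarrow> p - \<tau> *\<^sub>R \<nu> + c *s v \<in> \<Omega>)"

text \<open>Points between the parabola and its chord at height \<open>h\<close> are convex combinations of points on them.\<close>

lemma parabola_contains_disc:
  assumes S: "convex S" and \<kappa>: "0 < \<kappa>" and s0: "0 < s0"
    and par: "\<And>s. 0 < s \<Longrightarrow> s \<le> s0 \<Longrightarrow> p + s *\<^sub>R (\<i> *s \<nu>) - (\<kappa> * s ^ 2) *\<^sub>R \<nu> \<in> S"
      "\<And>s. 0 < s \<Longrightarrow> s \<le> s0 \<Longrightarrow> p - s *\<^sub>R (\<i> *s \<nu>) - (\<kappa> * s ^ 2) *\<^sub>R \<nu> \<in> S"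
  obtains \<rho> where "0 < \<rho>" "\<And>\<mu>. cmod (\<mu> + of_real \<rho>) < \<rho> \<Longrightarrow> p + \<mu> *s \<nu> \<in> S"
proof -
  define h where "h = \<kappa> * s0\<^sup>2"
  have h: "0 < h" using \<kappa> s0 by (simp add: h_def)
  define Q where "Q = (\<lambda>x y. p + y *\<^sub>R (\<i> *s \<nu>) - x *\<^sub>R \<nu>)"
  have Qc: "Q (a * x + b * x') (a * y + b * y') \<in> S"
    if "Q x y \<in> S" "Q x' y' \<in> S" "0 \<le> a" "0 \<le> b" "a + b = 1" for x y x' y' a b
  proof -
    have "a *\<^sub>R Q x y + b *\<^sub>R Q x' y' \<in> S" using that by (intro convexD[OF S]) auto
    moreover have "a *\<^sub>R Q x y + b *\<^sub>R Q x' y' = (a + b) *\<^sub>R p + (a * y + b * y') *\<^sub>R (\<i> *s \<nu>) - (a * x + b * x') *\<^sub>R \<nu>"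
      by (simp add: Q_def algebra_simps)
    ultimately show ?thesis using that(5) by (simp add: Q_def)
  qed
  have par': "Q (\<kappa> * y\<^sup>2) y \<in> S" if "y \<noteq> 0" "\<bar>y\<bar> \<le> s0" for y
  proof (cases "0 < y")
    case True then show ?thesis using par(1)[of y] that by (simp add: Q_def)
  next
    case False then show ?thesis using par(2)[of "- y"] that by (simp add: Q_def)
  qed
  have deep: "Q h y \<in> S" if "\<bar>y\<bar> \<le> s0" for y
  proof -
    define t where "t = y / s0"
    have t: "-1 \<le> t" "t \<le> 1" using that s0 by (auto simp: t_def field_simps)
    have "Q ((1 + t) / 2 * h + (1 - t) / 2 * h) ((1 + t) / 2 * s0 + (1 - t) / 2 * (- s0)) \<in> S"
      using t par'[of s0] par'[of "- s0"] s0 by (intro Qc) (auto simp: h_def field_simps)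
    moreover have "(1 + t) / 2 * h + (1 - t) / 2 * h = h" "(1 + t) / 2 * s0 + (1 - t) / 2 * (- s0) = y"
      using s0 by (simp_all add: t_def field_simps)
    ultimately show ?thesis by simp
  qed
  have in1: "Q x y \<in> S" if "y \<noteq> 0" "\<bar>y\<bar> \<le> s0" "\<kappa> * y\<^sup>2 \<le> x" "x \<le> h" for x y
  proof (cases "x = h")
    case False
    define t where "t = (x - \<kappa> * y\<^sup>2) / (h - \<kappa> * y\<^sup>2)"
    have d: "0 < h - \<kappa> * y\<^sup>2" using that False by simp
    have t: "0 \<le> t" "t \<le> 1" using that d by (auto simp: t_def)
    have "Q ((1 - t) * (\<kappa> * y\<^sup>2) + t * h) ((1 - t) * y + t * y) \<in> S"
      using t par'[OF that(1,2)] deep[OF that(2)] by (intro Qc) auto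
    moreover have "(1 - t) * (\<kappa> * y\<^sup>2) + t * h = \<kappa> * y\<^sup>2 + t * (h - \<kappa> * y\<^sup>2)" by (simp add: algebra_simps)
    moreover have "t * (h - \<kappa> * y\<^sup>2) = x - \<kappa> * y\<^sup>2" using d by (simp add: t_def)
    moreover have "(1 - t) * y + t * y = y" by (simp add: algebra_simps)
    ultimately show ?thesis by simp
  qed (use deep that in auto)
  have in2: "Q x y \<in> S" if "\<bar>y\<bar> \<le> s0" "\<kappa> * y\<^sup>2 < x" "x \<le> h" for x y
  proof (cases "y = 0")
    case True
    then have x: "0 < x" using that by simp
    define w where "w = sqrt (x / \<kappa>)"
    have w: "0 < w" "\<kappa> * w\<^sup>2 = x" using x \<kappa> by (auto simp: w_def)
    have "\<kappa> * w\<^sup>2 \<le> \<kappa> * s0\<^sup>2" using w that(3) by (simp add: h_def)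
    then have "w\<^sup>2 \<le> s0\<^sup>2" using \<kappa> by simp
    then have "w \<le> s0" by (rule power2_le_imp_le) (use s0 in simp)
    then have "Q x w \<in> S" "Q x (- w) \<in> S" using w that by (auto intro!: in1)
    then have "Q (1/2 * x + 1/2 * x) (1/2 * w + 1/2 * (- w)) \<in> S" by (intro Qc) auto
    then show ?thesis using True by simp
  next
    case False then show ?thesis using that by (intro in1) auto
  qed
  define \<rho> where "\<rho> = min (h / 2) (1 / (2 * \<kappa>))"
  have \<rho>: "0 < \<rho>" "2 * \<rho> \<le> h" "2 * \<rho> * \<kappa> \<le> 1"
    using h \<kappa> by (auto simp: \<rho>_def min_def field_simps)
  show ?thesis
  proof (rule that[OF \<rho>(1)])
    fix \<mu> assume \<mu>: "cmod (\<mu> + of_real \<rho>) < \<rho>"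
    define x y where "x = - Re \<mu>" and "y = Im \<mu>"
    have "(cmod (\<mu> + of_real \<rho>))\<^sup>2 < \<rho>\<^sup>2" using \<mu> by (intro power_strict_mono) auto
    then have "x * x + y * y < 2 * \<rho> * x"
      unfolding cmod_power2 by (simp add: x_def y_def power2_eq_square algebra_simps)
    then have xy: "x * x < 2 * \<rho> * x" "y * y < 2 * \<rho> * x" using zero_le_square[of x] zero_le_square[of y] by linarith+
    have x0: "0 < x"
    proof (rule ccontr)
      assume "\<not> 0 < x"
      then have "2 * \<rho> * x \<le> 0" using \<rho>(1) by (simp add: mult_nonneg_nonpos)
      then show False using xy(1) zero_le_square[of x] by linarith
    qed
    have x1: "x < 2 * \<rho>" using xy(1) x0 by simp
    have "\<kappa> * y\<^sup>2 < \<kappa> * (2 * \<rho> * x)" using xy(2) \<kappa> by (simp add: power2_eq_square)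
    also have "\<dots> = (2 * \<rho> * \<kappa>) * x" by simp
    also have "\<dots> \<le> 1 * x" using \<rho>(3) x0 by (intro mult_right_mono) auto
    finally have ky: "\<kappa> * y\<^sup>2 < x" by simp
    then have "\<kappa> * y\<^sup>2 \<le> \<kappa> * s0\<^sup>2" using x1 \<rho>(2) by (simp add: h_def)
    then have "\<bar>y\<bar>\<^sup>2 \<le> s0\<^sup>2" using \<kappa> by simp
    then have "\<bar>y\<bar> \<le> s0" using s0 power2_le_imp_le by (metis less_imp_le)
    then have "Q x y \<in> S" using ky x1 \<rho>(2) by (intro in2) auto
    moreover have "Q x y = p + \<mu> *s \<nu>" by (simp add: Q_def x_def y_def vec_eq_iff complex_eq_iff)
    ultimately show "p + \<mu> *s \<nu> \<in> S" by simp
  qed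
qed

text \<open>A Levi form that is not positive in a direction \<open>v\<close> is the sum of two nonnegative Hessians, in the directions \<open>v\<close> and
  \<open>\<i> *s v\<close>; so both vanish, and \<open>curve_inside\<close> applies with third order in these directions. In the direction \<open>\<i> *s \<nu>\<close> it
  applies with second order and yields the disc in the normal slice.\<close>

lemma flat_boundary_point_exists:
  assumes \<Omega>: "convex_domain \<Omega>" "smooth_boundary \<Omega>" and n: "\<not> strongly_pseudoconvex \<Omega>"
  shows "\<exists>p l \<nu> v \<rho> \<gamma> \<tau>0. flat_boundary_point \<Omega> p l \<nu> v \<rho> \<gamma> \<tau>0"
proof -
  obtain p where p: "p \<in> frontier \<Omega>"
    and np: "\<And>U r. local_defining_function \<Omega> p U r \<Longrightarrow> Ck_on 2 U r \<Longrightarrow>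
      \<exists>v\<in>complex_tangent_space r p. v \<noteq> 0 \<and> levi_form r p v \<le> 0"
    using n unfolding strongly_pseudoconvex_def by (force simp: not_less)
  obtain U r where ldf: "local_defining_function \<Omega> p U r" and Ck: "\<And>k. Ck_on k U r"
    using \<Omega>(2) p unfolding smooth_boundary_def by blast
  interpret C: convex_boundary_point U r \<Omega> p
    using \<Omega>(1) p ldf Ck by unfold_locales (auto simp: convex_domain_def local_defining_function_def)
  obtain v where v: "v \<in> complex_tangent_space r p" "v \<noteq> 0" "levi_form r p v \<le> 0"
    using np[OF ldf Ck] by blast
  define l where "l = complex_gradient r p"
  have l: "complex_functional l" unfolding l_def by (rule complex_functional_complex_gradient[OF C.diff1[OF C.p_U]])
  have Re_l: "Re (l x) = D1 r p x" for x by (simp add: l_def Re_complex_gradient)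
  obtain w where "D1 r p w \<noteq> 0"
    using ldf C.p_U unfolding local_defining_function_def D1_def by fastforce
  then have lw: "l w \<noteq> 0" using Re_l[of w] by auto
  define \<nu> where "\<nu> = (1 / l w) *s w"
  have l\<nu>: "l \<nu> = 1" using lw by (simp add: \<nu>_def complex_functional_smult[OF l])
  have lv: "l v = 0" using v(1) complex_tangent_space_iff[OF C.diff1[OF C.p_U]] by (simp add: l_def)
  have \<nu>1: "D1 r p \<nu> = 1" using Re_l[of \<nu>] l\<nu> by simp
  have i\<nu>: "D1 r p (\<i> *s \<nu>) = 0" using Re_l[of "\<i> *s \<nu>"] by (simp add: complex_functional_smult[OF l] l\<nu>)
  have v1: "D1 r p v = 0" "D1 r p (\<i> *s v) = 0"
    using Re_l[of v] Re_l[of "\<i> *s v"] by (simp_all add: complex_functional_smult[OF l] lv)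
  have "D2 r p v v + D2 r p (\<i> *s v) (\<i> *s v) \<le> 0"
    using v(3) levi_form_eq[OF C.C2_fun_axioms C.p_U, of v] by simp
  then have v2: "D2 r p v v = 0" "D2 r p (\<i> *s v) (\<i> *s v) = 0"
    using C.D2_nonneg[OF v1(1)] C.D2_nonneg[OF v1(2)] by linarith+
  have neg1: "D1 r p (- x) = - D1 r p x" and neg2: "D2 r p (- x) (- x) = D2 r p x x" for x
    by (simp_all add: linear_neg[OF C.linear1[OF C.p_U]] linear_neg[OF C.linear2[OF C.p_U]]
        linear_neg[OF C.linear2_left[OF C.p_U]])
  \<comment> \<open>Second order contact in the tangential directions, third order in the degenerate ones.\<close>
  have order2: "\<exists>\<kappa>0>0. \<forall>\<kappa>\<ge>\<kappa>0. \<forall>\<^sub>F s in at_right 0. p + s *\<^sub>R x - (\<kappa> * s ^ 2) *\<^sub>R \<nu> \<in> \<Omega>"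
    if x: "D1 r p x = 0" for x
  proof -
    let ?d = "\<lambda>m::nat. if m = 0 then r else if m = 1 then (\<lambda>q. D1 r q x) else (\<lambda>q. D2 r q x x)"
    show ?thesis
    proof (rule C.curve_inside[of ?d 2 x \<nu>])
      show "?d m differentiable at q" if "m < 2" "q \<in> U" for m q
        using that C.diff1 C.diff2 by auto
      show "?d (Suc m) q = D1 (?d m) q x" if "m < 2" "q \<in> U" for m q
        using that by (cases "m = 0") (auto simp: D2_def)
      show "continuous_on U (?d 2)" using C.continuous_D2 by simp
      show "?d m p = 0" if "m < 2" for m using that x C.r_p by auto
    qed (use \<nu>1 in auto)
  qed
  have order3: "\<exists>\<kappa>0>0. \<forall>\<kappa>\<ge>\<kappa>0. \<forall>\<^sub>F s in at_right 0. p + s *\<^sub>R x - (\<kappa> * s ^ 3) *\<^sub>R \<nu> \<in> \<Omega>"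
    if x: "D1 r p x = 0" "D2 r p x x = 0" for x
  proof -
    let ?d = "\<lambda>m::nat. if m = 0 then r else if m = 1 then (\<lambda>q. D1 r q x) else if m = 2 then (\<lambda>q. D2 r q x x)
      else (\<lambda>q. D1 (\<lambda>q. D2 r q x x) q x)"
    have C3: "Ck_on (Suc (Suc (Suc 0))) U r" by (rule Ck)
    have d2: "(\<lambda>q. D2 r q x x) differentiable at q" if "q \<in> U" for q
      using C3 that unfolding Ck_on_Suc_iff by (simp add: D2_def)
    have c3: "continuous_on U (\<lambda>q. D1 (\<lambda>q. D2 r q x x) q x)"
      using C3 unfolding Ck_on_Suc_iff by (simp add: D2_def)
    show ?thesis
    proof (rule C.curve_inside[of ?d 3 x \<nu>])
      show "?d m differentiable at q" if "m < 3" "q \<in> U" for m q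
        using that C.diff1 C.diff2 d2 by auto
      show "?d (Suc m) q = D1 (?d m) q x" if "m < 3" "q \<in> U" for m q
      proof -
        consider "m = 0" | "m = 1" | "m = 2" using \<open>m < 3\<close> by linarith
        then show ?thesis by cases (auto simp: D2_def)
      qed
      show "continuous_on U (?d 3)" using c3 by simp
      show "?d m p = 0" if "m < 3" for m using that x C.r_p by auto
    qed (use \<nu>1 in auto)
  qed
  have cvx: "convex \<Omega>" using \<Omega>(1) by (simp add: convex_domain_def)
  obtain \<rho> where \<rho>: "0 < \<rho>" "\<And>\<mu>. cmod (\<mu> + of_real \<rho>) < \<rho> \<Longrightarrow> p + \<mu> *s \<nu> \<in> \<Omega>"
  proof -
    obtain k1 where k1: "0 < k1" "\<And>\<kappa>. k1 \<le> \<kappa> \<Longrightarrow> \<forall>\<^sub>F s in at_right 0. p + s *\<^sub>R (\<i> *s \<nu>) - (\<kappa> * s ^ 2) *\<^sub>R \<nu> \<in> \<Omega>"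
      using order2[OF i\<nu>] by blast
    obtain k2 where k2: "\<And>\<kappa>. k2 \<le> \<kappa> \<Longrightarrow> \<forall>\<^sub>F s in at_right 0. p + s *\<^sub>R (- (\<i> *s \<nu>)) - (\<kappa> * s ^ 2) *\<^sub>R \<nu> \<in> \<Omega>"
      using order2[of "- (\<i> *s \<nu>)"] i\<nu> neg1 by auto
    define \<kappa> where "\<kappa> = max k1 k2"
    have "\<forall>\<^sub>F s in at_right 0. p + s *\<^sub>R (\<i> *s \<nu>) - (\<kappa> * s ^ 2) *\<^sub>R \<nu> \<in> \<Omega> \<and>
        p + s *\<^sub>R (- (\<i> *s \<nu>)) - (\<kappa> * s ^ 2) *\<^sub>R \<nu> \<in> \<Omega>"
      by (intro eventually_conj k1 k2) (auto simp: \<kappa>_def)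
    then obtain b where b: "0 < b" "\<And>s. 0 < s \<Longrightarrow> s < b \<Longrightarrow> p + s *\<^sub>R (\<i> *s \<nu>) - (\<kappa> * s ^ 2) *\<^sub>R \<nu> \<in> \<Omega> \<and>
        p + s *\<^sub>R (- (\<i> *s \<nu>)) - (\<kappa> * s ^ 2) *\<^sub>R \<nu> \<in> \<Omega>"
      unfolding eventually_at_right_field by auto
    have "0 < \<kappa>" using k1(1) by (simp add: \<kappa>_def)
    from parabola_contains_disc[OF cvx this, of "b / 2" p \<nu>] b that show ?thesis
      by (auto simp: algebra_simps)
  qed
  obtain \<gamma> \<tau>0 where g: "0 < \<gamma>" "0 < \<tau>0"
    "\<And>\<tau> c. 0 < \<tau> \<Longrightarrow> \<tau> < \<tau>0 \<Longrightarrow> cmod c < \<gamma> * \<tau> powr (1/3) \<Longrightarrow> p - \<tau> *\<^sub>R \<nu> + c *s v \<in> \<Omega>"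
  proof -
    obtain k1 where k1: "0 < k1" "\<And>\<kappa>. k1 \<le> \<kappa> \<Longrightarrow> \<forall>\<^sub>F s in at_right 0. p + s *\<^sub>R v - (\<kappa> * s ^ 3) *\<^sub>R \<nu> \<in> \<Omega>"
      using order3[OF v1(1) v2(1)] by blast
    obtain k2 where k2: "\<And>\<kappa>. k2 \<le> \<kappa> \<Longrightarrow> \<forall>\<^sub>F s in at_right 0. p + s *\<^sub>R (- v) - (\<kappa> * s ^ 3) *\<^sub>R \<nu> \<in> \<Omega>"
      using order3[of "- v"] v1 v2 neg1 neg2 by auto
    obtain k3 where k3: "\<And>\<kappa>. k3 \<le> \<kappa> \<Longrightarrow> \<forall>\<^sub>F s in at_right 0. p + s *\<^sub>R (\<i> *s v) - (\<kappa> * s ^ 3) *\<^sub>R \<nu> \<in> \<Omega>"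
      using order3[OF v1(2) v2(2)] by blast
    obtain k4 where k4: "\<And>\<kappa>. k4 \<le> \<kappa> \<Longrightarrow> \<forall>\<^sub>F s in at_right 0. p + s *\<^sub>R (- (\<i> *s v)) - (\<kappa> * s ^ 3) *\<^sub>R \<nu> \<in> \<Omega>"
      using order3[of "- (\<i> *s v)"] v1 v2 neg1 neg2 by auto
    define \<kappa> where "\<kappa> = max (max k1 k2) (max k3 k4)"
    have \<kappa>: "0 < \<kappa>" using k1(1) by (simp add: \<kappa>_def)
    have "\<forall>\<^sub>F s in at_right 0. (p + s *\<^sub>R v - (\<kappa> * s ^ 3) *\<^sub>R \<nu> \<in> \<Omega> \<and> p + s *\<^sub>R (- v) - (\<kappa> * s ^ 3) *\<^sub>R \<nu> \<in> \<Omega>) \<and>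
      p + s *\<^sub>R (\<i> *s v) - (\<kappa> * s ^ 3) *\<^sub>R \<nu> \<in> \<Omega> \<and> p + s *\<^sub>R (- (\<i> *s v)) - (\<kappa> * s ^ 3) *\<^sub>R \<nu> \<in> \<Omega>"
      by (intro eventually_conj k1 k2 k3 k4) (auto simp: \<kappa>_def)
    then obtain b where b: "0 < b" "\<And>s. 0 < s \<Longrightarrow> s < b \<Longrightarrow>
      (p + s *\<^sub>R v - (\<kappa> * s ^ 3) *\<^sub>R \<nu> \<in> \<Omega> \<and> p + s *\<^sub>R (- v) - (\<kappa> * s ^ 3) *\<^sub>R \<nu> \<in> \<Omega>) \<and>
      p + s *\<^sub>R (\<i> *s v) - (\<kappa> * s ^ 3) *\<^sub>R \<nu> \<in> \<Omega> \<and> p + s *\<^sub>R (- (\<i> *s v)) - (\<kappa> * s ^ 3) *\<^sub>R \<nu> \<in> \<Omega>"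
      unfolding eventually_at_right_field by auto
    show ?thesis
    proof (rule that[of "(1 / \<kappa>) powr (1/3) / 2" "\<kappa> * b ^ 3"])
      show "0 < (1 / \<kappa>) powr (1/3) / 2" "0 < \<kappa> * b ^ 3" using \<kappa> b(1) by auto
      fix \<tau> c assume \<tau>: "0 < \<tau>" "\<tau> < \<kappa> * b ^ 3" and c: "cmod c < (1 / \<kappa>) powr (1/3) / 2 * \<tau> powr (1/3)"
      define s where "s = (\<tau> / \<kappa>) powr (1/3)"
      have s: "0 < s" using \<tau> \<kappa> by (simp add: s_def)
      have s3: "s ^ 3 = \<tau> / \<kappa>" using \<tau> \<kappa> by (simp add: s_def powr_power)
      then have ks: "\<kappa> * s ^ 3 = \<tau>" using \<kappa> by simp
      have "s ^ 3 < b ^ 3" using s3 \<tau> \<kappa> by (simp add: pos_divide_less_eq mult.commute)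
      then have sb: "s < b" using b(1) by (meson less_imp_le power_less_imp_less_base)
      have "cmod c \<le> s / 2" using c \<tau> \<kappa> by (simp add: s_def powr_divide powr_mult[symmetric])
      moreover have "(p - \<tau> *\<^sub>R \<nu>) + s *\<^sub>R v \<in> \<Omega>" "(p - \<tau> *\<^sub>R \<nu>) - s *\<^sub>R v \<in> \<Omega>"
        "(p - \<tau> *\<^sub>R \<nu>) + s *\<^sub>R (\<i> *s v) \<in> \<Omega>" "(p - \<tau> *\<^sub>R \<nu>) - s *\<^sub>R (\<i> *s v) \<in> \<Omega>"
        using b(2)[OF s sb] unfolding ks by (simp_all add: algebra_simps)
      ultimately show "p - \<tau> *\<^sub>R \<nu> + c *s v \<in> \<Omega>" by (intro convex_complex_disc[OF cvx s])
    qed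
  qed
  have "Re (l (z - p)) < 0" if "z \<in> \<Omega>" for z using C.D1_neg[OF that] by (simp add: Re_l)
  then have "flat_boundary_point \<Omega> p l \<nu> v \<rho> \<gamma> \<tau>0"
    unfolding flat_boundary_point_def using l l\<nu> lv v(2) \<rho> g by blast
  then show ?thesis by blast
qed


section \<open>Rescaling along the normal at selected scales\<close>

text \<open>Because of \<open>a < \<alpha>\<close> the function \<open>g t = R t * t powr (- \<alpha>)\<close> is unbounded near \<open>0\<close>. A point \<open>\<tau>\<close> where it exceeds half of its
  supremum over \<open>{\<sigma>..\<tau>1}\<close>, with \<open>\<sigma>\<close> so small that this supremum is not approached at depth \<open>\<delta>\<close> or more, is as required.\<close>

lemma running_maximum:
  fixes R :: "real \<Rightarrow> real"
  assumes \<tau>1: "0 < \<tau>1" and \<gamma>: "0 < \<gamma>" and ab: "a < \<alpha>"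
    and low: "\<And>t. 0 < t \<Longrightarrow> t \<le> \<tau>1 \<Longrightarrow> \<gamma> * t powr a \<le> R t"
    and up: "\<And>t. 0 < t \<Longrightarrow> t \<le> \<tau>1 \<Longrightarrow> R t \<le> B" and \<alpha>: "0 \<le> \<alpha>" and \<delta>: "0 < \<delta>"
  obtains \<tau> where "0 < \<tau>" "\<tau> < \<delta>" "\<tau> \<le> \<tau>1"
    and "\<And>t. \<tau> \<le> t \<Longrightarrow> t \<le> \<tau>1 \<Longrightarrow> R t \<le> 2 * (t / \<tau>) powr \<alpha> * R \<tau>"
proof -
  define g where "g = (\<lambda>t. R t * t powr (- \<alpha>))"
  define \<delta>1 where "\<delta>1 = min \<delta> \<tau>1"
  have \<delta>1: "0 < \<delta>1" "\<delta>1 \<le> \<delta>" "\<delta>1 \<le> \<tau>1" using \<delta> \<tau>1 by (auto simp: \<delta>1_def)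
  have Rpos: "0 < R t" if "0 < t" "t \<le> \<tau>1" for t
  proof -
    have "0 < \<gamma> * t powr a" using \<gamma> that(1) by simp
    then show ?thesis using low[OF that] by linarith
  qed
  have B: "0 < B" using Rpos[of \<tau>1] up[of \<tau>1] \<tau>1 by linarith
  have gup: "g t \<le> B * s powr (- \<alpha>)" if "0 < s" "s \<le> t" "t \<le> \<tau>1" for s t
  proof -
    have "t powr (- \<alpha>) \<le> s powr (- \<alpha>)" using that \<alpha> by (intro powr_mono2') auto
    then show ?thesis unfolding g_def using that up[of t] B by (intro mult_mono) auto
  qed
  define X where "X = B * \<delta>1 powr (- \<alpha>)"
  have X0: "0 < X" using B \<delta>1 by (simp add: X_def)
  define Y where "Y = (2 * X + 1) / \<gamma>"
  have Y: "0 < Y" using X0 \<gamma> by (simp add: Y_def)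
  define \<sigma> where "\<sigma> = min (\<delta>1 / 2) (Y powr (1 / (a - \<alpha>)))"
  have "(Y powr (1 / (a - \<alpha>))) powr (a - \<alpha>) \<le> \<sigma> powr (a - \<alpha>)"
    using ab Y \<delta>1(1) by (intro powr_mono2') (auto simp: \<sigma>_def)
  then have \<sigma>: "(2 * X + 1) / \<gamma> \<le> \<sigma> powr (a - \<alpha>)" "0 < \<sigma>" "\<sigma> < \<delta>1"
    using ab Y \<delta>1(1) by (auto simp: powr_powr Y_def[symmetric] \<sigma>_def)
  have "2 * X < \<gamma> * \<sigma> powr (a - \<alpha>)" using \<sigma>(1) \<gamma> by (simp add: pos_divide_le_eq mult.commute)
  also have "\<dots> = (\<gamma> * \<sigma> powr a) * \<sigma> powr (- \<alpha>)" by (simp add: powr_add[symmetric])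
  also have "\<dots> \<le> g \<sigma>" unfolding g_def using low[of \<sigma>] \<sigma> \<delta>1 by (intro mult_right_mono) auto
  finally have g\<sigma>: "2 * X < g \<sigma>" .
  define M where "M = (SUP t\<in>{\<sigma>..\<tau>1}. g t)"
  have bdd: "bdd_above (g ` {\<sigma>..\<tau>1})" using gup[OF \<sigma>(2)] by (intro bdd_aboveI2[of _ _ "B * \<sigma> powr (- \<alpha>)"]) auto
  have le: "g t \<le> M" if "\<sigma> \<le> t" "t \<le> \<tau>1" for t unfolding M_def using that bdd by (intro cSUP_upper) auto
  have "2 * X < M" using le[of \<sigma>] g\<sigma> \<sigma> \<delta>1 by linarith
  then have "M / 2 < M" using X0 by linarith
  then obtain \<tau> where \<tau>: "\<sigma> \<le> \<tau>" "\<tau> \<le> \<tau>1" "M / 2 < g \<tau>"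
    unfolding M_def using less_cSUP_iff[OF _ bdd, of "M / 2"] \<sigma> \<delta>1 by (auto simp: M_def)
  show ?thesis
  proof (rule that[of \<tau>])
    show t0: "0 < \<tau>" using \<tau> \<sigma> by simp
    show "\<tau> < \<delta>"
    proof (rule ccontr)
      assume "\<not> \<tau> < \<delta>"
      then have "g \<tau> \<le> X" unfolding X_def using \<tau> \<delta>1 by (intro gup) auto
      then show False using \<tau>(3) \<open>2 * X < M\<close> by linarith
    qed
    show "R t \<le> 2 * (t / \<tau>) powr \<alpha> * R \<tau>" if t: "\<tau> \<le> t" "t \<le> \<tau>1" for t
    proof -
      have "g t \<le> 2 * g \<tau>" using le[of t] \<tau> t by linarith
      then have "g t * t powr \<alpha> \<le> 2 * g \<tau> * t powr \<alpha>" by (intro mult_right_mono) auto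
      moreover have "g t * t powr \<alpha> = R t" using t t0 by (simp add: g_def powr_minus field_simps)
      moreover have "2 * g \<tau> * t powr \<alpha> = 2 * (t / \<tau>) powr \<alpha> * R \<tau>"
        using t t0 by (simp add: g_def powr_minus powr_divide field_simps)
      ultimately show ?thesis by simp
    qed
  qed (use \<tau> in auto)
qed

text \<open>The normalized picture: up to the scale \<open>N\<close>, the slice in the direction \<open>\<xi>\<close> is a half-plane
  on which \<open>k\<close> restricts to the coordinate, and the radius in the direction \<open>v\<close> grows slower than the
  square root of the depth. All further data are bounded independently of \<open>N\<close>.\<close>

definition flat_picture ::
  "((complex ^ 'd) set \<times> (complex ^ 'd) \<Rightarrow> real) \<Rightarrow> real \<Rightarrow> real \<Rightarrow> (complex ^ 'd) set \<Rightarrow> complex ^ 'd \<Rightarrow> complex ^ 'd \<Rightarrow> (complex ^ 'd \<Rightarrow> complex) \<Rightarrow> bool"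
  where "flat_picture f e N D \<xi> v k \<longleftrightarrow> D \<in> XX \<and> ball 0 1 \<subseteq> D \<and>
    (\<forall>y. (\<forall>c. cmod c \<le> 1 \<longrightarrow> c *s y \<in> D) \<longrightarrow> norm y \<le> 2 * (real CARD('d))\<^sup>2) \<and>
    norm \<xi> \<le> 2 * (real CARD('d))\<^sup>2 \<and> norm v \<le> 2 * (real CARD('d))\<^sup>2 \<and>
    complex_functional k \<and> k \<xi> = 1 \<and> k v = 0 \<and> (\<forall>x\<in>D. Re (k x) < 1) \<and>
    (\<forall>x\<in>D. norm x \<le> N \<longrightarrow> \<bar>f (D, x) - f (ball 0 1, 0)\<bar> \<le> e) \<and>
    (\<forall>\<mu>. cmod (\<mu> + of_real N) < N \<longrightarrow> (1 + \<mu>) *s \<xi> \<in> D) \<and>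
    (\<forall>T. 1 \<le> T \<longrightarrow> T \<le> N \<longrightarrow> (\<exists>c. cmod c \<le> 3 * T powr (5/12) \<and> of_real (1 - T) *s \<xi> + c *s v \<notin> D))"

text \<open>The scale \<open>\<tau>\<close> is a running maximum for the radius \<open>R\<close>, and the domain is normalized around \<open>p - \<tau> *\<^sub>R \<nu>\<close>. The
  vectors \<open>\<xi>\<close> and \<open>v'\<close> are the images of \<open>\<tau> *\<^sub>R \<nu>\<close> and \<open>R \<tau> *\<^sub>R v\<close>, which lie in the closure of the circled part
  of the domain. A point of the normalized domain of norm at most \<open>N\<close> comes from a point of depth at most
  \<open>(N + 1) * \<tau>\<close>, hence from outside \<open>K\<close>.\<close>

lemma flat_picture_exists:
  fixes \<Omega> :: "(complex ^ 'd) set"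
  assumes f: "intrinsic f" and \<Omega>: "convex_domain \<Omega>" "bounded \<Omega>"
    and flat: "flat_boundary_point \<Omega> p l \<nu> v \<rho> \<gamma> \<tau>0"
    and K: "compact K" "K \<subseteq> \<Omega>" and fK: "\<And>z. z \<in> \<Omega> - K \<Longrightarrow> \<bar>f (\<Omega>, z) - f (ball 0 1, 0)\<bar> \<le> e"
    and N: "1 \<le> N"
  shows "\<exists>D \<xi> v k. flat_picture f e N D \<xi> v k"
proof -
  have l: "complex_functional l" and l\<nu>: "l \<nu> = 1" and lv: "l v = 0" and v: "v \<noteq> 0"
    and neg: "\<And>z. z \<in> \<Omega> \<Longrightarrow> Re (l (z - p)) < 0"
    and \<rho>: "0 < \<rho>" "\<And>\<mu>. cmod (\<mu> + of_real \<rho>) < \<rho> \<Longrightarrow> p + \<mu> *s \<nu> \<in> \<Omega>"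
    and \<gamma>: "0 < \<gamma>" and \<tau>0: "0 < \<tau>0"
    and disc: "\<And>\<tau> c. 0 < \<tau> \<Longrightarrow> \<tau> < \<tau>0 \<Longrightarrow> cmod c < \<gamma> * \<tau> powr (1/3) \<Longrightarrow> p - \<tau> *\<^sub>R \<nu> + c *s v \<in> \<Omega>"
    using flat unfolding flat_boundary_point_def by blast+
  have op: "open \<Omega>" "convex \<Omega>" using \<Omega>(1) by (auto simp: convex_domain_def)
  have \<Omega>XX: "\<Omega> \<in> XX" using \<Omega> by (rule XX_bounded)
  define \<tau>1 where "\<tau>1 = \<tau>0 / 2"
  have \<tau>1: "0 < \<tau>1" "\<tau>1 < \<tau>0" using \<tau>0 by (auto simp: \<tau>1_def)
  \<comment> \<open>The radius \<open>R \<tau>\<close> is the largest element of \<open>Good \<tau>\<close>.\<close>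
  define Good where "Good = (\<lambda>\<tau>. {s. 0 \<le> s \<and> (\<forall>c. cmod c < s \<longrightarrow> p - \<tau> *\<^sub>R \<nu> + c *s v \<in> \<Omega>)})"
  define R where "R = (\<lambda>\<tau>. Sup (Good \<tau>))"
  obtain b where b: "\<And>x. x \<in> \<Omega> \<Longrightarrow> norm x \<le> b" using \<Omega>(2) unfolding bounded_iff by blast
  define B where "B = 2 * (2 * b / norm v)"
  have Good_le: "s \<le> B" if s: "s \<in> Good \<tau>" for s \<tau>
  proof (cases "s = 0")
    case True
    have "norm (p + (- of_real \<rho>) *s \<nu>) \<le> b" using \<rho>(1) by (intro b \<rho>(2)) simp
    then have "0 \<le> b" by (rule order_trans[OF norm_ge_zero])
    then show ?thesis using True by (simp add: B_def)
  next
    case False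
    then have s0: "0 < s" using s by (simp add: Good_def)
    have in1: "p - \<tau> *\<^sub>R \<nu> + c *s v \<in> \<Omega>" if "cmod c < s" for c using s that by (simp add: Good_def)
    have "norm (p - \<tau> *\<^sub>R \<nu> + of_real (s / 2) *s v) \<le> b" "norm (p - \<tau> *\<^sub>R \<nu> + 0 *s v) \<le> b"
      using s0 by (intro b in1; simp)+
    then have "norm (of_real (s / 2) *s v) \<le> 2 * b"
      using norm_triangle_ineq4[of "p - \<tau> *\<^sub>R \<nu> + of_real (s / 2) *s v" "p - \<tau> *\<^sub>R \<nu>"] by simp
    then have "s / 2 * norm v \<le> 2 * b" using s0 by (simp add: norm_smult)
    then show ?thesis using v by (simp add: B_def field_simps)
  qed
  have bdd: "bdd_above (Good \<tau>)" for \<tau> using Good_le by (rule bdd_aboveI)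
  have R_low: "\<gamma> * t powr (1/3) \<le> R t" if "0 < t" "t \<le> \<tau>1" for t
    unfolding R_def using that \<tau>1 \<gamma> disc by (intro cSup_upper bdd) (auto simp: Good_def)
  have zero_Good: "0 \<in> Good \<tau>" for \<tau> by (simp add: Good_def)
  have R_up: "R t \<le> B" for t
    unfolding R_def
  proof (rule cSup_least)
    show "Good t \<noteq> {}" using zero_Good[of t] by auto
  qed (rule Good_le)
  have R_in: "p - \<tau> *\<^sub>R \<nu> + c *s v \<in> \<Omega>" if c: "cmod c < R \<tau>" for c \<tau>
  proof -
    have "Good \<tau> \<noteq> {}" using zero_Good[of \<tau>] by auto
    from less_cSup_iff[OF this bdd] c obtain s where "s \<in> Good \<tau>" "cmod c < s"
      unfolding R_def by blast
    then show ?thesis by (simp add: Good_def)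
  qed
  have R_out: "\<exists>c. cmod c < s \<and> p - \<tau> *\<^sub>R \<nu> + c *s v \<notin> \<Omega>" if "R \<tau> < s" "0 \<le> s" for s \<tau>
  proof (rule ccontr)
    assume "\<not> ?thesis"
    then have "s \<in> Good \<tau>" using that by (auto simp: Good_def)
    then have "s \<le> R \<tau>" unfolding R_def by (intro cSup_upper bdd)
    then show False using that by simp
  qed
  obtain \<kappa> where \<kappa>: "0 < \<kappa>" "\<And>z. z \<in> K \<Longrightarrow> Re (l (z - p)) \<le> - \<kappa>"
  proof (cases "K = {}")
    case True then show ?thesis using that[of 1] by simp
  next
    case False
    have "continuous_on K (\<lambda>z. l (z - p))"
      by (rule continuous_on_compose2[OF
            linear_continuous_on[OF complex_functional_bounded_linear[OF l]] _ subset_UNIV])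
         (intro continuous_intros)
    then have "continuous_on K (\<lambda>z. Re (l (z - p)))" by (rule continuous_on_Re)
    then obtain z0 where z0: "z0 \<in> K" "\<And>z. z \<in> K \<Longrightarrow> Re (l (z - p)) \<le> Re (l (z0 - p))"
      using continuous_attains_sup[OF K(1) False] by blast
    show ?thesis using that[of "- Re (l (z0 - p))"] z0 neg[of z0] K(2) by auto
  qed
  \<comment> \<open>Up to \<open>N\<close> times the scale, the disc of radius \<open>\<rho>\<close>, the range of the running maximum and the complement of \<open>K\<close> are
    visible.\<close>
  define \<delta> where "\<delta> = min (\<rho> / N) (min (\<tau>1 / N) (\<kappa> / (N + 1)))"
  have \<delta>: "0 < \<delta>" using \<rho>(1) N \<tau>1(1) \<kappa>(1) by (simp add: \<delta>_def)
  obtain \<tau> where \<tau>: "0 < \<tau>" "\<tau> < \<delta>" "\<tau> \<le> \<tau>1"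
    and Rmax: "\<And>t. \<tau> \<le> t \<Longrightarrow> t \<le> \<tau>1 \<Longrightarrow> R t \<le> 2 * (t / \<tau>) powr (5/12) * R \<tau>"
    by (rule running_maximum[OF \<tau>1(1) \<gamma> _ R_low R_up _ \<delta>, of "5/12"]) auto
  have \<tau>': "N * \<tau> < \<rho>" "N * \<tau> < \<tau>1" "(N + 1) * \<tau> < \<kappa>"
    using \<tau>(2) N by (auto simp: \<delta>_def pos_less_divide_eq mult.commute)
  have \<tau>\<rho>: "\<tau> < \<rho>" using \<tau>'(1) N mult_right_mono[OF N, of \<tau>] \<tau>(1) by linarith
  have "0 < \<gamma> * \<tau> powr (1/3)" using \<gamma> \<tau>(1) by simp
  then have R0: "0 < R \<tau>" using R_low[OF \<tau>(1,3)] by linarith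
  define z where "z = p - \<tau> *\<^sub>R \<nu>"
  have z: "z \<in> \<Omega>" using R_in[of 0 \<tau>] R0 by (simp add: z_def)
  from affine_normalization[OF op \<Omega>(2) z] obtain A Bm
    where lin: "complex_linear_map A" "complex_linear_map Bm"
      and inv: "\<And>x. A (Bm x) = x" "\<And>x. Bm (A x) = x"
      and ball: "\<And>y. norm y < 1 \<Longrightarrow> z + Bm y \<in> \<Omega>"
      and core: "\<And>y. (\<And>c. cmod c \<le> 1 \<Longrightarrow> z + c *s Bm y \<in> \<Omega>) \<Longrightarrow> norm y \<le> 2 * (real CARD('d))\<^sup>2"
    by blast
  define D where "D = {y. z + Bm y \<in> \<Omega>}"
  define \<xi> where "\<xi> = A (of_real \<tau> *s \<nu>)"
  define v' where "v' = A (of_real (R \<tau>) *s v)"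
  define k where "k = (\<lambda>y. of_real (1 / \<tau>) * l (Bm y))"
  have B\<xi>: "Bm \<xi> = of_real \<tau> *s \<nu>" and Bv': "Bm v' = of_real (R \<tau>) *s v"
    by (simp_all add: \<xi>_def v'_def inv)
  have DXX: "D \<in> XX" by (rule XX_affine[OF \<Omega>XX lin inv D_def])
  have k: "complex_functional k"
    unfolding complex_functional_def k_def
    by (auto intro!: linearI simp: complex_linear_map_add[OF lin(2)] complex_functional_add[OF l]
        complex_linear_map_scaleR[OF lin(2)] complex_functional_scaleR[OF l] complex_linear_map_smult[OF lin(2)]
        complex_functional_smult[OF l] scaleR_conv_of_real[where 'a = complex] add_divide_distrib algebra_simps)
  have coreD: "norm y \<le> 2 * (real CARD('d))\<^sup>2" if "\<And>c. cmod c \<le> 1 \<Longrightarrow> c *s y \<in> D" for y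
    using that by (intro core) (auto simp: D_def complex_linear_map_smult[OF lin(2)])
  have closed_core: "norm y \<le> 2 * (real CARD('d))\<^sup>2" if y: "\<And>c. cmod c < 1 \<Longrightarrow> c *s y \<in> D" for y
  proof (rule field_le_mult_one_interval)
    fix t :: real assume t: "0 < t" "t < 1"
    have "norm (of_real t *s y) \<le> 2 * (real CARD('d))\<^sup>2"
    proof (rule coreD)
      fix c assume c: "cmod c \<le> 1"
      have "cmod c * t \<le> 1 * t" using c t by (intro mult_right_mono) auto
      then have "cmod c * t < 1" using t by linarith
      then have "cmod (c * of_real t) < 1" using t by (simp add: norm_mult)
      then show "c *s (of_real t *s y) \<in> D" using y by (simp add: vector_smult_assoc)
    qed
    then show "t * norm y \<le> 2 * (real CARD('d))\<^sup>2" using t by (simp add: norm_smult)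
  qed
  have D\<xi>: "\<eta> *s \<xi> + c *s v' \<in> D \<longleftrightarrow> p + (of_real \<tau> * (\<eta> - 1)) *s \<nu> + (c * of_real (R \<tau>)) *s v \<in> \<Omega>" for \<eta> c
  proof -
    have "z + Bm (\<eta> *s \<xi> + c *s v') = p + (of_real \<tau> * (\<eta> - 1)) *s \<nu> + (c * of_real (R \<tau>)) *s v"
      unfolding complex_linear_map_add[OF lin(2)] complex_linear_map_smult[OF lin(2)] B\<xi> Bv' z_def scaleR_eq_smult
      by (simp add: vec_eq_iff algebra_simps)
    then show ?thesis by (simp add: D_def)
  qed
  have n\<xi>: "norm \<xi> \<le> 2 * (real CARD('d))\<^sup>2"
  proof (rule closed_core)
    fix c assume c: "cmod c < 1"
    have "cmod (of_real \<tau> * (c - 1) + of_real \<rho>) = cmod (of_real \<tau> * c + of_real (\<rho> - \<tau>))" by (simp add: algebra_simps)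
    also have "\<dots> \<le> \<tau> * cmod c + (\<rho> - \<tau>)"
    proof -
      have "cmod (of_real (\<rho> - \<tau>)) = \<rho> - \<tau>" unfolding norm_of_real using \<tau>\<rho> by simp
      moreover have "cmod (of_real \<tau> * c) = \<tau> * cmod c" using \<tau>(1) by (simp add: norm_mult)
      ultimately show ?thesis
        using norm_triangle_ineq[of "of_real \<tau> * c" "of_real (\<rho> - \<tau>)"] by (simp only:)
    qed
    also have "\<dots> < \<rho>" using c \<tau>(1) by simp
    finally show "c *s \<xi> \<in> D" using D\<xi>[of c 0] \<rho>(2)[of "of_real \<tau> * (c - 1)"] by simp
  qed
  have nv: "norm v' \<le> 2 * (real CARD('d))\<^sup>2"
  proof (rule closed_core)
    fix c assume c: "cmod c < 1"
    have "cmod (c * of_real (R \<tau>)) < R \<tau>" using c R0 by (simp add: norm_mult)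
    from R_in[OF this] show "c *s v' \<in> D"
      using D\<xi>[of 0 c] by (simp add: scaleR_eq_smult vector_smult_lneg)
  qed
  have Rek: "Re (k x) < 1" if x: "x \<in> D" for x
  proof -
    have "l (z + Bm x - p) = l (Bm x) - of_real \<tau>"
      by (simp add: z_def complex_functional_add[OF l] complex_functional_diff[OF l] complex_functional_scaleR[OF l] l\<nu>
          scaleR_conv_of_real[where 'a = complex])
    then have "Re (l (Bm x)) < \<tau>" using neg[of "z + Bm x"] x by (simp add: D_def)
    then show ?thesis using \<tau>(1) by (simp add: k_def)
  qed
  have outK: "z + Bm x \<notin> K" if x: "x \<in> D" "norm x \<le> N" for x
  proof
    assume "z + Bm x \<in> K"
    then have "Re (l (z + Bm x - p)) \<le> - \<kappa>" by (rule \<kappa>(2))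
    moreover have "l (z + Bm x - p) = l (Bm x) - of_real \<tau>"
      by (simp add: z_def complex_functional_add[OF l] complex_functional_diff[OF l] complex_functional_scaleR[OF l] l\<nu>
          scaleR_conv_of_real[where 'a = complex])
    moreover have "- N \<le> Re (k x)"
    proof (rule ccontr)
      assume n: "\<not> - N \<le> Re (k x)"
      \<comment> \<open>The unit ball lies in \<open>D\<close>, so \<open>k\<close> has norm at most one.\<close>
      define t where "t = - 1 / Re (k x)"
      have t: "0 < t" "t * N < 1" using n N by (auto simp: t_def field_simps)
      have "t * norm x \<le> t * N" using x(2) t(1) by (intro mult_left_mono) auto
      then have "t * norm x < 1" using t(2) by linarith
      then have "norm ((- t) *\<^sub>R x) < 1" using t(1) by simp
      then have "(- t) *\<^sub>R x \<in> D" unfolding D_def using ball by blast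
      then have "Re (k ((- t) *\<^sub>R x)) < 1" by (rule Rek)
      then have "- t * Re (k x) < 1" unfolding complex_functional_scaleR[OF k] by simp
      then show False using n N by (simp add: t_def)
    qed
    then have "- (N * \<tau>) \<le> Re (l (Bm x))" using \<tau>(1) by (simp add: k_def field_simps)
    ultimately have "\<kappa> \<le> (N + 1) * \<tau>" by (simp add: algebra_simps)
    then show False using \<tau>'(3) by simp
  qed
  have "\<bar>f (D, x) - f (ball 0 1, 0)\<bar> \<le> e" if x: "x \<in> D" "norm x \<le> N" for x
  proof -
    have "f (D, x) = f (\<Omega>, z + Bm x)" by (rule intrinsic_affine[OF f \<Omega>XX lin inv D_def x(1)])
    then show ?thesis using fK[of "z + Bm x"] outK[OF x] x(1) by (simp add: D_def)
  qed
  moreover have "(1 + \<mu>) *s \<xi> \<in> D" if \<mu>: "cmod (\<mu> + of_real N) < N" for \<mu>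
  proof -
    have "of_real \<tau> * \<mu> + of_real \<rho> = of_real \<tau> * (\<mu> + of_real N) + of_real (\<rho> - N * \<tau>)"
      by (simp add: algebra_simps)
    then have "cmod (of_real \<tau> * \<mu> + of_real \<rho>) \<le> \<tau> * cmod (\<mu> + of_real N) + (\<rho> - N * \<tau>)"
      using norm_triangle_ineq[of "of_real \<tau> * (\<mu> + of_real N)" "of_real (\<rho> - N * \<tau>)"] \<tau>(1) \<tau>'(1)
      by (simp add: norm_mult del: of_real_diff)
    also have "\<dots> < \<rho>" using \<mu> \<tau>(1) mult_strict_left_mono[OF \<mu> \<tau>(1)] by (simp add: mult.commute)
    finally show ?thesis using D\<xi>[of "1 + \<mu>" 0] \<rho>(2)[of "of_real \<tau> * \<mu>"] by simp
  qed
  moreover have "\<exists>c. cmod c \<le> 3 * T powr (5/12) \<and> of_real (1 - T) *s \<xi> + c *s v' \<notin> D" if T: "1 \<le> T" "T \<le> N" for T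
  proof -
    have "T * \<tau> \<le> N * \<tau>" "1 * \<tau> \<le> T * \<tau>" using T \<tau>(1) by (auto intro: mult_right_mono)
    then have "R (T * \<tau>) \<le> 2 * (T * \<tau> / \<tau>) powr (5/12) * R \<tau>" using \<tau>'(2) by (intro Rmax) auto
    also have "\<dots> < 3 * T powr (5/12) * R \<tau>" using R0 T \<tau>(1) by simp
    finally obtain c where c: "cmod c < 3 * T powr (5/12) * R \<tau>" "p - (T * \<tau>) *\<^sub>R \<nu> + c *s v \<notin> \<Omega>"
      using R_out[of "T * \<tau>" "3 * T powr (5/12) * R \<tau>"] R0 by auto
    show ?thesis
    proof (intro exI[of _ "c / of_real (R \<tau>)"] conjI)
      show "cmod (c / of_real (R \<tau>)) \<le> 3 * T powr (5/12)"
        using c(1) R0 by (simp add: norm_divide pos_divide_le_eq)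
      have "of_real \<tau> * (of_real (1 - T) - 1) = - complex_of_real (T * \<tau>)" by (simp add: algebra_simps)
      moreover have "c / of_real (R \<tau>) * of_real (R \<tau>) = c" using R0 by simp
      ultimately show "of_real (1 - T) *s \<xi> + (c / of_real (R \<tau>)) *s v' \<notin> D"
        using c(2) unfolding D\<xi> by (simp add: scaleR_eq_smult vector_smult_lneg del: of_real_mult of_real_diff)
    qed
  qed
  moreover have "ball 0 1 \<subseteq> D" using ball by (auto simp: D_def)
  moreover have "k \<xi> = 1" using \<tau>(1) by (simp add: k_def B\<xi> complex_functional_smult[OF l] l\<nu>)
  moreover have "k v' = 0" by (simp add: k_def Bv' complex_functional_smult[OF l] lv)
  ultimately have "flat_picture f e N D \<xi> v' k"
    unfolding flat_picture_def using DXX coreD n\<xi> nv k Rek by blast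
  then show ?thesis by blast
qed


lemma functional_expand:
  assumes "complex_functional k" shows "k x = (\<Sum>j\<in>UNIV. x $ j * k (axis j 1))"
proof -
  have "k x = k (\<Sum>j\<in>UNIV. (x $ j) *s axis j 1)" by (simp add: basis_expansion)
  also have "\<dots> = (\<Sum>j\<in>UNIV. k ((x $ j) *s axis j 1))"
    using assms by (intro linear_sum) (simp add: complex_functional_def)
  finally show ?thesis by (simp add: complex_functional_smult[OF assms])
qed

text \<open>Otherwise a multiple of \<open>x\<close> in the unit ball has the value \<open>1\<close>.\<close>

lemma norm_functional_le:
  assumes k: "complex_functional k" and D: "ball 0 1 \<subseteq> D" "\<And>x. x \<in> D \<Longrightarrow> Re (k x) < 1" and x: "norm x \<le> 1"
  shows "cmod (k x) \<le> 1"
proof (rule ccontr)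
  assume n: "\<not> ?thesis"
  define c where "c = 1 / k x"
  have kx: "k x \<noteq> 0" using n by auto
  have "cmod c < 1" using n by (auto simp: c_def norm_divide divide_less_eq)
  then have "norm (c *s x) < 1" unfolding norm_smult using x mult_left_mono[OF x, of "cmod c"] by simp
  then have "Re (k (c *s x)) < 1" using D by auto
  then show False using kx by (simp add: complex_functional_smult[OF k] c_def)
qed

text \<open>After passing to a subsequence the pictures converge to a domain \<open>D\<close> with a half-plane slice, a functional \<open>k\<close> and a
  direction \<open>v\<close>. The bound on circled subsets excludes complex lines in \<open>D\<close>, so \<open>f\<close> is defined there; it is
  constant by continuity. Hence \<open>D\<close> is biholomorphic to the ball, and its radius in the direction \<open>v\<close> grows like \<open>sqrt T\<close>
  and at most like \<open>T powr (5/12)\<close>.\<close>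

lemma flat_pictures_impossible:
  fixes f :: "(complex ^ 'd) set \<times> (complex ^ 'd) \<Rightarrow> real"
  assumes f: "continuous_on_XX0 f"
    and rigid: "\<And>\<Omega>. \<Omega> \<in> XX \<Longrightarrow> (\<forall>x\<in>\<Omega>. f (\<Omega>, x) = f (ball 0 1, 0)) \<Longrightarrow> biholomorphic \<Omega> (ball 0 1)"
    and pic: "\<And>n::nat. flat_picture f (1 / real (Suc n)) (real (Suc n)) (Ds0 n) (\<xi>s0 n) (vs0 n) (ks0 n)"
  shows False
proof -
  define b where "b = 2 * (real CARD('d))\<^sup>2"
  \<comment> \<open>Functionals converge if their coefficients do.\<close>
  define as0 where "as0 = (\<lambda>n. \<chi> j. ks0 n (axis j 1))"
  have ks0: "complex_functional (ks0 n)" "ball 0 1 \<subseteq> Ds0 n" "\<And>x. x \<in> Ds0 n \<Longrightarrow> Re (ks0 n x) < 1" for n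
    using pic[of n] by (auto simp: flat_picture_def)
  have as_b: "norm (as0 n) \<le> real CARD('d)" for n
  proof -
    have "norm (as0 n $ j) \<le> 1" for j
    proof -
      have "cmod (ks0 n (axis j 1)) \<le> 1"
        by (rule norm_functional_le[OF ks0(1,2)]) (use ks0(3) in \<open>auto simp: norm_axis\<close>)
      then show ?thesis by (simp add: as0_def)
    qed
    then have "norm (as0 n) \<le> (\<Sum>j\<in>(UNIV::'d set). 1)"
      using norm_le_sum_components[of "as0 n"] by (meson order_trans sum_mono)
    then show ?thesis by simp
  qed
  have body0: "gauge_body (Ds0 n) 1" for n
    using pic[of n] by unfold_locales (auto simp: flat_picture_def XX_def convex_domain_def)
  obtain \<sigma>1 D where \<sigma>1: "strict_mono (\<sigma>1 :: nat \<Rightarrow> nat)" and body: "gauge_body D 1"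
    and lim1: "\<And>x. (\<lambda>n. minkowski (Ds0 (\<sigma>1 n)) x) \<longlonglongrightarrow> minkowski D x"
    using minkowski_selection[of Ds0 1] body0 by blast
  have cpt: "compact (cball (0::complex^'d) b \<times> cball (0::complex^'d) b \<times> cball (0::complex^'d) (real CARD('d)))"
    by (intro compact_Times compact_cball)
  have seq: "\<forall>n. (\<xi>s0 (\<sigma>1 n), vs0 (\<sigma>1 n), as0 (\<sigma>1 n))
      \<in> cball 0 b \<times> cball 0 b \<times> cball 0 (real CARD('d))"
  proof
    fix n
    have "norm (\<xi>s0 (\<sigma>1 n)) \<le> b" "norm (vs0 (\<sigma>1 n)) \<le> b"
      using pic[of "\<sigma>1 n"] unfolding flat_picture_def b_def by blast+
    then show "(\<xi>s0 (\<sigma>1 n), vs0 (\<sigma>1 n), as0 (\<sigma>1 n)) \<in> cball 0 b \<times> cball 0 b \<times> cball 0 (real CARD('d))"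
      using as_b by simp
  qed
  obtain L \<sigma>2 where \<sigma>2: "strict_mono (\<sigma>2 :: nat \<Rightarrow> nat)"
    and L: "((\<lambda>n. (\<xi>s0 (\<sigma>1 n), vs0 (\<sigma>1 n), as0 (\<sigma>1 n))) \<circ> \<sigma>2) \<longlonglongrightarrow> L"
    by (rule seq_compactE[OF compact_imp_seq_compact[OF cpt] seq]) blast
  define \<sigma> where "\<sigma> = (\<lambda>n. \<sigma>1 (\<sigma>2 n))"
  have "strict_mono \<sigma>" using strict_mono_o[OF \<sigma>1 \<sigma>2] by (simp add: o_def \<sigma>_def)
  then have \<sigma>: "n \<le> \<sigma> n" for n by (rule seq_suble)
  define Ds \<xi>s vs ks where "Ds = (\<lambda>n. Ds0 (\<sigma> n))" and "\<xi>s = (\<lambda>n. \<xi>s0 (\<sigma> n))"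
    and "vs = (\<lambda>n. vs0 (\<sigma> n))" and "ks = (\<lambda>n. ks0 (\<sigma> n))"
  define \<xi> v a where "\<xi> = fst L" and "v = fst (snd L)" and "a = snd (snd L)"
  have L3: "\<xi>s \<longlonglongrightarrow> \<xi>" "vs \<longlonglongrightarrow> v" "(\<lambda>n. as0 (\<sigma> n)) \<longlonglongrightarrow> a"
    using tendsto_fst[OF L] tendsto_fst[OF tendsto_snd[OF L]] tendsto_snd[OF tendsto_snd[OF L]]
    by (simp_all add: o_def \<xi>_def v_def a_def \<xi>s_def vs_def \<sigma>_def)
  define k where "k = (\<lambda>x. \<Sum>j\<in>UNIV. x $ j * a $ j)"
  have k: "complex_functional k"
    unfolding complex_functional_def k_def
    by (auto intro!: linearI simp: sum.distrib algebra_simps sum_distrib_left scaleR_sum_right)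
  have k_lim: "(\<lambda>n. ks n (xs n)) \<longlonglongrightarrow> k x" if x: "xs \<longlonglongrightarrow> x" for xs x
  proof -
    have "ks n (xs n) = (\<Sum>j\<in>UNIV. xs n $ j * as0 (\<sigma> n) $ j)" for n
      using functional_expand[OF ks0(1)[of "\<sigma> n"], of "xs n"] by (simp add: ks_def as0_def)
    then show ?thesis unfolding k_def by (simp only:) (intro tendsto_intros x L3)
  qed
  have bodys: "gauge_body (Ds n) 1" for n unfolding Ds_def by (rule body0)
  have lim: "(\<lambda>n. minkowski (Ds n) x) \<longlonglongrightarrow> minkowski D x" for x
    using LIMSEQ_subseq_LIMSEQ[OF lim1 \<sigma>2] by (simp add: o_def Ds_def \<sigma>_def)
  have lim': "(\<lambda>n. minkowski (Ds n) (xs n)) \<longlonglongrightarrow> minkowski D x" if "xs \<longlonglongrightarrow> x" for xs x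
    by (rule minkowski_tendsto_moving[OF bodys lim that])
  note in_D = gauge_body.minkowski_less_one[OF body] and in_Ds = gauge_body.minkowski_less_one[OF bodys]
  have op: "open D" "convex D" "0 \<in> D"
    using body gauge_body.zero_in[OF body] by (auto simp: gauge_body_def)
  have P: "Ds n \<in> XX"
    "\<And>y. (\<And>c. cmod c \<le> 1 \<Longrightarrow> c *s y \<in> Ds n) \<Longrightarrow> norm y \<le> b"
    "ks n (\<xi>s n) = 1" "ks n (vs n) = 0" "\<And>x. x \<in> Ds n \<Longrightarrow> Re (ks n x) < 1"
    "\<And>x. x \<in> Ds n \<Longrightarrow> norm x \<le> real (Suc (\<sigma> n)) \<Longrightarrow> \<bar>f (Ds n, x) - f (ball 0 1, 0)\<bar> \<le> 1 / real (Suc (\<sigma> n))"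
    "\<And>\<mu>. cmod (\<mu> + of_real (real (Suc (\<sigma> n)))) < real (Suc (\<sigma> n)) \<Longrightarrow> (1 + \<mu>) *s \<xi>s n \<in> Ds n"
    "\<And>T. 1 \<le> T \<Longrightarrow> T \<le> real (Suc (\<sigma> n)) \<Longrightarrow> \<exists>c. cmod c \<le> 3 * T powr (5/12) \<and> of_real (1 - T) *s \<xi>s n + c *s vs n \<notin> Ds n"
    for n
    using pic[of "\<sigma> n"] unfolding flat_picture_def Ds_def \<xi>s_def vs_def ks_def b_def by blast+
  have big: "\<forall>\<^sub>F n in sequentially. x < real (Suc (\<sigma> n))" for x
  proof -
    obtain m where m: "x < real m" using reals_Archimedean2 by blast
    show ?thesis unfolding eventually_sequentially
    proof (intro exI[of _ m] allI impI)
      fix n assume "m \<le> n"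
      then have "real m \<le> real (Suc (\<sigma> n))" using \<sigma>[of n] by simp
      then show "x < real (Suc (\<sigma> n))" using m by linarith
    qed
  qed
  have ev_in: "\<forall>\<^sub>F n in sequentially. x \<in> Ds n" if "x \<in> D" for x
  proof -
    have "\<forall>\<^sub>F n in sequentially. minkowski (Ds n) x < 1" using that by (intro order_tendstoD(2)[OF lim]) (simp add: in_D)
    then show ?thesis by (simp add: in_Ds)
  qed
  have k\<xi>: "k \<xi> = 1" using k_lim[OF L3(1)] P(3) LIMSEQ_unique[OF _ tendsto_const] by simp
  have kv: "k v = 0" using k_lim[OF L3(2)] P(4) LIMSEQ_unique[OF _ tendsto_const] by simp
  have Rek: "Re (k x) < 1" if x: "x \<in> D" for x
  proof -
    define m where "m = minkowski D x"
    have m: "0 \<le> m" "m < 1" using x gauge_body.minkowski_nonneg[OF body] in_D by (auto simp: m_def)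
    define s where "s = 2 / (1 + m)"
    have s: "1 < s" "s * m < 1" using m by (auto simp: s_def field_simps)
    have "minkowski D (s *\<^sub>R x) < 1" using s gauge_body.minkowski_scaleR[OF body, of s x] by (simp add: m_def)
    then have "s *\<^sub>R x \<in> D" by (simp only: in_D)
    then have "\<forall>\<^sub>F n in sequentially. s *\<^sub>R x \<in> Ds n" by (rule ev_in)
    then have "\<forall>\<^sub>F n in sequentially. Re (ks n (s *\<^sub>R x)) \<le> 1"
      by eventually_elim (use P(5) less_imp_le in blast)
    then have "Re (k (s *\<^sub>R x)) \<le> 1"
      using tendsto_Re[OF k_lim[OF tendsto_const]] by (intro tendsto_upperbound) auto
    then have le: "s * Re (k x) \<le> 1" by (simp add: complex_functional_scaleR[OF k])
    show ?thesis
    proof (rule ccontr)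
      assume "\<not> ?thesis"
      then have "s * 1 \<le> s * Re (k x)" using s by (intro mult_left_mono) auto
      then show False using le s by linarith
    qed
  qed
  have half: "\<eta> *s \<xi> \<in> D" if \<eta>: "Re \<eta> < 1" for \<eta>
  proof -
    have le: "minkowski D (\<eta> *s \<xi>) \<le> 1" if \<eta>: "Re \<eta> < 1" for \<eta>
    proof (rule tendsto_upperbound)
      show "(\<lambda>n. minkowski (Ds n) (\<eta> *s \<xi>s n)) \<longlonglongrightarrow> minkowski D (\<eta> *s \<xi>)"
        by (intro lim' tendsto_intros L3)
      define \<mu> where "\<mu> = \<eta> - 1"
      have \<mu>: "Re \<mu> < 0" using \<eta> by (simp add: \<mu>_def)
      show "\<forall>\<^sub>F n in sequentially. minkowski (Ds n) (\<eta> *s \<xi>s n) \<le> 1"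
        using big[of "(cmod \<mu>)\<^sup>2 / (- 2 * Re \<mu>)"]
      proof eventually_elim
        case (elim n)
        define N where "N = real (Suc (\<sigma> n))"
        have d: "0 < - 2 * Re \<mu>" using \<mu> by simp
        have "(cmod \<mu>)\<^sup>2 < N * (- 2 * Re \<mu>)"
          using elim unfolding N_def pos_divide_less_eq[OF d] .
        then have "(cmod (\<mu> + of_real N))\<^sup>2 < N\<^sup>2"
          unfolding cmod_power2 by (simp add: power2_eq_square algebra_simps)
        then have "cmod (\<mu> + of_real N) < N" by (rule power2_less_imp_less) (simp add: N_def)
        then have "(1 + \<mu>) *s \<xi>s n \<in> Ds n" unfolding N_def by (rule P(7))
        then show ?case using in_Ds[of n "\<eta> *s \<xi>s n"] by (simp add: \<mu>_def)
      qed
    qed simp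
    define w where "w = (1 - Re \<eta>) / (2 * (1 + \<bar>Re \<eta>\<bar>))"
    define s where "s = 1 + w"
    have w: "0 < w" unfolding w_def using \<eta> by (intro divide_pos_pos) auto
    have s: "1 < s" using w by (simp add: s_def)
    have "s * Re \<eta> < 1"
    proof -
      have "Re \<eta> * w \<le> (1 + \<bar>Re \<eta>\<bar>) * w" using w by (intro mult_right_mono) auto
      also have "\<dots> = (1 - Re \<eta>) / 2" by (simp add: w_def field_simps)
      finally have "Re \<eta> * w \<le> (1 - Re \<eta>) / 2" .
      moreover have "s * Re \<eta> = Re \<eta> + Re \<eta> * w" by (simp add: s_def algebra_simps)
      ultimately have "s * Re \<eta> \<le> Re \<eta> + (1 - Re \<eta>) / 2" by simp
      also have "\<dots> < 1" using \<eta> by (simp add: field_simps)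
      finally show ?thesis .
    qed
    then have "minkowski D ((of_real s * \<eta>) *s \<xi>) \<le> 1" by (intro le) simp
    moreover have "minkowski D ((of_real s * \<eta>) *s \<xi>) = s * minkowski D (\<eta> *s \<xi>)"
      using gauge_body.minkowski_scaleR[OF body, of s "\<eta> *s \<xi>"] s by (simp add: scaleR_eq_smult vector_smult_assoc)
    ultimately have le1: "s * minkowski D (\<eta> *s \<xi>) \<le> 1" by simp
    have "minkowski D (\<eta> *s \<xi>) < 1"
    proof (rule ccontr)
      assume "\<not> ?thesis"
      then have "s * 1 \<le> s * minkowski D (\<eta> *s \<xi>)" using s by (intro mult_left_mono) auto
      then show False using le1 s by linarith
    qed
    then show ?thesis by (simp add: in_D)
  qed
  \<comment> \<open>The Minkowski functional of \<open>D\<close> vanishes in the direction of a complex line in \<open>D\<close>,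
  so those of \<open>Ds n\<close> are small there for large \<open>n\<close>, against the bound on circled subsets.\<close>
  have "D \<in> XX"
  proof -
    have "\<not> (\<exists>l. complex_affine_line l \<and> l \<subseteq> D)"
    proof
      assume "\<exists>l. complex_affine_line l \<and> l \<subseteq> D"
      then obtain q w where w: "w \<noteq> 0" and sub: "\<And>c. q + c *s w \<in> D"
        unfolding complex_affine_line_def by blast
      have zero: "minkowski D (c *s w) = 0" for c
      proof (rule antisym)
        define m where "m = 1 + minkowski D (- q)"
        have le: "t * minkowski D (c *s w) \<le> m" if "0 < t" for t
        proof -
          have "t * minkowski D (c *s w) = minkowski D (t *\<^sub>R (c *s w))"
            using that by (intro gauge_body.minkowski_scaleR[OF body, symmetric]) simp
          also have "t *\<^sub>R (c *s w) = (q + (of_real t * c) *s w) + (- q)"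
            by (simp add: scaleR_eq_smult vector_smult_assoc)
          also have "minkowski D \<dots> \<le> minkowski D (q + (of_real t * c) *s w) + minkowski D (- q)"
            by (rule gauge_body.minkowski_triangle[OF body])
          also have "\<dots> \<le> m" using sub[of "of_real t * c"] in_D less_imp_le by (auto simp: m_def)
          finally show ?thesis .
        qed
        show "minkowski D (c *s w) \<le> 0"
        proof (rule ccontr)
          assume "\<not> ?thesis"
          then have g: "0 < minkowski D (c *s w)" by simp
          have "0 < m" unfolding m_def using gauge_body.minkowski_nonneg[OF body, of "- q"] by linarith
          then have "0 < 2 * m / minkowski D (c *s w)" using g by simp
          from le[OF this] show False using g \<open>0 < m\<close> by simp
        qed
        show "0 \<le> minkowski D (c *s w)" by (rule gauge_body.minkowski_nonneg[OF body])
      qed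
      define y where "y = of_real ((b + 1) / norm w) *s w"
      have b0: "0 \<le> b" by (simp add: b_def)
      have ny: "norm y = b + 1" using w b0 by (simp add: y_def norm_smult norm_divide)
      obtain n where n: "\<And>x. x \<in> cball 0 (b + 1) \<Longrightarrow> \<bar>minkowski (Ds n) x - minkowski D x\<bar> < 1"
        using eventually_happens'[OF sequentially_bot
            minkowski_tendsto_uniform[OF bodys body lim zero_less_one, of "b + 1"]] by blast
      have "norm y \<le> b"
      proof (rule P(2)[of y n])
        fix c assume c: "cmod c \<le> 1"
        have "cmod c * (b + 1) \<le> 1 * (b + 1)" using c b0 by (intro mult_right_mono) auto
        then have "c *s y \<in> cball 0 (b + 1)" by (simp add: norm_smult ny)
        moreover have "minkowski D (c *s y) = 0" unfolding y_def vector_smult_assoc by (rule zero)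
        ultimately have "minkowski (Ds n) (c *s y) < 1" using n[of "c *s y"] by simp
        then show "c *s y \<in> Ds n" by (simp add: in_Ds)
      qed
      then show False using ny by simp
    qed
    then show ?thesis using op by (auto simp: XX_def convex_domain_def)
  qed
  moreover have "f (D, x) = f (ball 0 1, 0)" if x: "x \<in> D" for x
  proof -
    obtain N where N: "\<And>n. N \<le> n \<Longrightarrow> x \<in> Ds n" using ev_in[OF x] unfolding eventually_sequentially by blast
    have "local_hausdorff_convergent (\<lambda>n. Ds (n + N)) D"
      by (rule local_hausdorff_convergentI[OF bodys body]) (rule LIMSEQ_ignore_initial_segment[OF lim])
    then have "(\<lambda>n. f (Ds (n + N), x)) \<longlonglongrightarrow> f (D, x)"
      using f[unfolded continuous_on_XX0_def, rule_format, of "\<lambda>n. Ds (n + N)" "\<lambda>n. x" D x]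
        P(1) N x \<open>D \<in> XX\<close> by (simp add: XX0_def)
    then have 1: "(\<lambda>n. f (Ds n, x)) \<longlonglongrightarrow> f (D, x)" by (rule LIMSEQ_offset)
    have "\<forall>\<^sub>F n in sequentially. norm (f (Ds n, x) - f (ball 0 1, 0)) \<le> 1 / real (Suc n)"
      using ev_in[OF x] big[of "norm x"]
    proof eventually_elim
      case (elim n)
      have "\<bar>f (Ds n, x) - f (ball 0 1, 0)\<bar> \<le> 1 / real (Suc (\<sigma> n))" using elim by (intro P(6)) auto
      also have "\<dots> \<le> 1 / real (Suc n)" using \<sigma>[of n] by (intro divide_left_mono) auto
      finally show ?case by simp
    qed
    moreover have "(\<lambda>n. 1 / real (Suc n)) \<longlonglongrightarrow> 0"
      using LIMSEQ_inverse_real_of_nat by (simp add: inverse_eq_divide)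
    ultimately have "(\<lambda>n. f (Ds n, x) - f (ball 0 1, 0)) \<longlonglongrightarrow> 0" by (rule Lim_null_comparison)
    then have "(\<lambda>n. f (Ds n, x)) \<longlonglongrightarrow> f (ball 0 1, 0)" by (simp add: LIM_zero_iff)
    then show ?thesis using 1 LIMSEQ_unique by blast
  qed
  ultimately have "biholomorphic D (ball 0 1)" using rigid by blast
  from halfplane_slice_radius[OF op(1,2) this half k Rek k\<xi> kv]
  obtain C where C: "0 < C" "\<And>T c. 1 \<le> T \<Longrightarrow> cmod c < C * sqrt T \<Longrightarrow> of_real (1 - T) *s \<xi> + c *s v \<in> D"
    by blast
  \<comment> \<open>A depth at which the two bounds on the radius contradict each other; a twelfth power makes both
    powers of \<open>T\<close> polynomial in \<open>q\<close>.\<close>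
  define q where "q = max 1 (3 / C + 1)"
  define T where "T = q ^ 12"
  have q: "1 \<le> q" "3 < C * q"
  proof -
    show "1 \<le> q" by (simp add: q_def)
    have "C * (3 / C + 1) \<le> C * q" using C(1) by (intro mult_left_mono) (auto simp: q_def)
    then show "3 < C * q" using C(1) by (simp add: algebra_simps)
  qed
  have T: "1 \<le> T" using q(1) by (simp add: T_def)
  have T1: "T powr (5/12) = q ^ 5"
  proof -
    have "T powr (5/12) = (q powr 12) powr (5/12)" using q(1) by (simp add: T_def powr_numeral)
    also have "\<dots> = q powr 5" by (simp add: powr_powr)
    also have "\<dots> = q ^ 5" using q(1) by (simp add: powr_numeral)
    finally show ?thesis .
  qed
  have T2: "sqrt T = q ^ 6"
  proof (rule real_sqrt_unique)
    show "(q ^ 6)\<^sup>2 = T" by (simp add: T_def flip: power_mult)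
  qed (use q in simp)
  have lt: "3 * T powr (5/12) < C * sqrt T"
  proof -
    have "3 * q ^ 5 < (C * q) * q ^ 5" using q by (intro mult_strict_right_mono) auto
    also have "\<dots> = C * q ^ 6" by (simp add: eval_nat_numeral)
    finally show ?thesis by (simp only: T1 T2)
  qed
  have "\<forall>\<^sub>F n in sequentially. \<exists>c\<in>cball 0 (3 * T powr (5/12)). of_real (1 - T) *s \<xi>s n + c *s vs n \<notin> Ds n"
    using big[of T]
  proof eventually_elim
    case (elim n)
    then show ?case using P(8)[OF T, of n] by auto
  qed
  then obtain N where "\<And>n. N \<le> n \<Longrightarrow> \<exists>c\<in>cball 0 (3 * T powr (5/12)). of_real (1 - T) *s \<xi>s n + c *s vs n \<notin> Ds n"
    unfolding eventually_sequentially by blast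
  then have "\<forall>n. \<exists>c\<in>cball 0 (3 * T powr (5/12)). of_real (1 - T) *s \<xi>s (n + N) + c *s vs (n + N) \<notin> Ds (n + N)" by simp
  then obtain cs where cs: "\<And>n. cs n \<in> cball 0 (3 * T powr (5/12))"
    "\<And>n. of_real (1 - T) *s \<xi>s (n + N) + cs n *s vs (n + N) \<notin> Ds (n + N)" by metis
  have csB: "\<forall>n. cs n \<in> cball 0 (3 * T powr (5/12))" using cs(1) by blast
  obtain c \<rho> where c: "c \<in> cball 0 (3 * T powr (5/12))" and \<rho>: "strict_mono (\<rho> :: nat \<Rightarrow> nat)" "(cs \<circ> \<rho>) \<longlonglongrightarrow> c"
    by (rule seq_compactE[OF compact_imp_seq_compact[OF compact_cball] csB]) blast
  have sub: "(\<lambda>n. X (\<rho> n + N)) \<longlonglongrightarrow> x" if "X \<longlonglongrightarrow> x" for X :: "nat \<Rightarrow> complex ^ 'd" and x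
    using LIMSEQ_subseq_LIMSEQ[OF LIMSEQ_ignore_initial_segment[OF that, of N] \<rho>(1)] by (simp add: o_def)
  have subm: "(\<lambda>n. minkowski (Ds (\<rho> n + N)) x) \<longlonglongrightarrow> minkowski D x" for x
    using LIMSEQ_subseq_LIMSEQ[OF LIMSEQ_ignore_initial_segment[OF lim, of N] \<rho>(1)] by (simp add: o_def)
  have "(\<lambda>n. minkowski (Ds (\<rho> n + N)) (of_real (1 - T) *s \<xi>s (\<rho> n + N) + cs (\<rho> n) *s vs (\<rho> n + N)))
      \<longlonglongrightarrow> minkowski D (of_real (1 - T) *s \<xi> + c *s v)"
    using \<rho>(2) by (intro minkowski_tendsto_moving[OF bodys subm] tendsto_intros sub L3) (simp add: o_def)
  moreover have "1 \<le> minkowski (Ds (\<rho> n + N)) (of_real (1 - T) *s \<xi>s (\<rho> n + N) + cs (\<rho> n) *s vs (\<rho> n + N))" for n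
    using cs(2)[of "\<rho> n"] in_Ds[of "\<rho> n + N"] by (meson not_less)
  ultimately have "1 \<le> minkowski D (of_real (1 - T) *s \<xi> + c *s v)"
    by (intro LIMSEQ_le_const) auto
  moreover have "of_real (1 - T) *s \<xi> + c *s v \<in> D" using C(2)[OF T, of c] lt c by simp
  ultimately show False using in_D[of "of_real (1 - T) *s \<xi> + c *s v"] by linarith
qed


section \<open>The gap theorem\<close>

theorem theorem1p14:
  fixes f :: "(complex ^ 'd) set \<times> (complex ^ 'd) \<Rightarrow> real"
  assumes "continuous_on_XX0 f"
    and "intrinsic f"
    and "\<And>\<Omega>. \<Omega> \<in> XX \<Longrightarrow> (\<forall>x\<in>\<Omega>. f (\<Omega>, x) = f (ball 0 1, 0)) \<Longrightarrow> biholomorphic \<Omega> (ball 0 1)"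
  shows "\<exists>\<epsilon>>0. \<forall>\<Omega>. convex_domain \<Omega> \<and> bounded \<Omega> \<and> smooth_boundary \<Omega> \<and>
      (\<exists>K. compact K \<and> K \<subseteq> \<Omega> \<and> (\<forall>z\<in>\<Omega> - K. \<bar>f (\<Omega>, z) - f (ball 0 1, 0)\<bar> \<le> \<epsilon>)) \<longrightarrow>
    strongly_pseudoconvex \<Omega> \<and>
    ((\<lambda>z. f (\<Omega>, z)) \<longlongrightarrow> f (ball 0 1, 0)) (to_boundary \<Omega>)"
proof -
  define H where "H = (\<lambda>\<epsilon> \<Omega>. convex_domain \<Omega> \<and> bounded \<Omega> \<and> smooth_boundary \<Omega> \<and>
      (\<exists>K. compact K \<and> K \<subseteq> \<Omega> \<and> (\<forall>z\<in>\<Omega> - K. \<bar>f (\<Omega>, z) - f (ball 0 1, 0)\<bar> \<le> \<epsilon>)))"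
  have "\<exists>\<epsilon>>0. \<forall>\<Omega>. H \<epsilon> \<Omega> \<longrightarrow> strongly_pseudoconvex \<Omega>"
  proof (rule ccontr)
    assume n: "\<not> ?thesis"
    have "\<exists>D \<xi> v k. flat_picture f (1 / real (Suc n)) (real (Suc n)) D \<xi> v k" for n :: nat
    proof -
      have "0 < 1 / real (Suc n)" by simp
      then obtain \<Omega> where \<Omega>: "H (1 / real (Suc n)) \<Omega>" "\<not> strongly_pseudoconvex \<Omega>" using n by blast
      obtain K where K: "compact K" "K \<subseteq> \<Omega>"
        "\<And>z. z \<in> \<Omega> - K \<Longrightarrow> \<bar>f (\<Omega>, z) - f (ball 0 1, 0)\<bar> \<le> 1 / real (Suc n)"
        using \<Omega>(1) unfolding H_def by blast
      have d: "convex_domain \<Omega>" "bounded \<Omega>" "smooth_boundary \<Omega>" using \<Omega>(1) by (simp_all add: H_def)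
      obtain p l \<nu> v \<rho> \<gamma> \<tau>0 where "flat_boundary_point \<Omega> p l \<nu> v \<rho> \<gamma> \<tau>0"
        using flat_boundary_point_exists[OF d(1,3) \<Omega>(2)] by blast
      from flat_picture_exists[OF assms(2) d(1,2) this K] show ?thesis by simp
    qed
    then obtain Ds \<xi>s vs ks
      where "\<And>n. flat_picture f (1 / real (Suc n)) (real (Suc n)) (Ds n) (\<xi>s n) (vs n) (ks n)" by metis
    then show False using flat_pictures_impossible[OF assms(1,3)] by blast
  qed
  then obtain \<epsilon> where "\<epsilon> > 0" "\<And>\<Omega>. H \<epsilon> \<Omega> \<Longrightarrow> strongly_pseudoconvex \<Omega>" by blast
  then show ?thesis
    using strongly_pseudoconvex_limit[OF assms(1,2)] unfolding H_def by blast
qed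

end
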